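(* Let $k$ be a natural number and let $T$ be a theory in-between $\mathsf{HA}+\mathrm{LEM}(\Pi_{k-1})$ ($\mathsf{HA}$ if $k=0$) and $\mathsf{PA}$. Then $T\vdash\mathrm{DNE}(\Sigma_k)+\mathrm{DNS}(\mathrm{U}_k^+)$ (i.e. $T$ proves both schemata) if and only if $\mathrm{PNFT}_T(\mathrm{E}_{k'},\Sigma_{k'})$ holds for all $k'\le k$.
   Context: $\mathsf{HA}$ is intuitionistic (Heyting) arithmetic in the language with function symbols for all primitive recursive functions and logical constants $\forall,\exists,\to,\land,\lor,\perp$; $\neg\varphi$ abbreviates $\varphi\to\perp$. $\mathsf{PA}$ is $\mathsf{HA}$ plus the law of excluded middle for all formulas. $S+\mathrm{P}$ adds all instances of schema $\mathrm{P}$ to $S$. A theory $T$ is in-between $S$ and $S'$ if it is a theory in the language of $\mathsf{HA}$ whose theorems include those of $S$ and are included in those of $S'$. $T\vdash\mathrm{P}$ means every instance of $\mathrm{P}$ is provable in $T$. $\mathrm{FV}(\varphi)$ is the set of free variables. $\Sigma_0=\Pi_0$ are the quantifier-free formulas; $\Pi_{k+1}$: formulas $Q_1\bar x_1\cdots Q_{k+1}\bar x_{k+1}\varphi_{qf}$ ($Q_i=\forall$ for odd $i$, $\exists$ for even $i$); $\Sigma_{k+1}$ likewise starting with $\exists$ (blocks may be empty by the paper's convention). $\Gamma(\bar x)$: formulas in $\Gamma$ with free variables among $\bar x$. $\mathrm{LEM}(\Gamma)$: $\forall x(\varphi(x)\lor\neg\varphi(x))$, $\varphi(x)\in\Gamma(x)$;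 $\mathrm{DNE}(\Gamma)$: $\forall x(\neg\neg\varphi(x)\to\varphi(x))$, $\varphi(x)\in\Gamma(x)$; $\mathrm{DNS}(\Gamma)$: $\forall x(\forall y\neg\neg\varphi(x,y)\to\neg\neg\forall y\varphi(x,y))$, $\varphi(x,y)\in\Gamma(x,y)$. $\mathrm{PNFT}_T(\Gamma,\Gamma')$: for every $\varphi\in\Gamma$ there is $\varphi'\in\Gamma'$ with $\mathrm{FV}(\varphi)=\mathrm{FV}(\varphi')$ and $T\vdash\varphi\leftrightarrow\varphi'$. Alternation paths: finite alternating sequences of $+,-$; $i(s)$ first symbol ($\times$ if empty), $s^\perp$ swaps signs, $l(s)$ length. $\mathrm{Alt}(\varphi)=\{\langle\rangle\}$ for quantifier-free $\varphi$; otherwise $\mathrm{Alt}(\neg\varphi_1)=\{s^\perp:s\in\mathrm{Alt}(\varphi_1)\}$, $\mathrm{Alt}(\varphi_1\land\varphi_2)=\mathrm{Alt}(\varphi_1\lor\varphi_2)=\mathrm{Alt}(\varphi_1)\cup\mathrm{Alt}(\varphi_2)$, $\mathrm{Alt}(\varphi_1\to\varphi_2)=\{s^\perp:s\in\mathrm{Alt}(\varphi_1)\}\cup\mathrm{Alt}(\varphi_2)$, $\mathrm{Alt}(\forall x\varphi_1)=\{s\in\mathrm{Alt}(\varphi_1):i(s)=-\}\cup\{-s:s\in\mathrm{Alt}(\varphi_1),i(s)\ne-\}$, $\mathrm{Alt}(\exists x\varphi_1)=\{s\in\mathrm{Alt}(\varphi_1):i(s)=+\}\cup\{+s:s\in\mathrm{Alt}(\varphi_1),i(s)\ne+\}$.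 $\deg\varphi=\max\{l(s):s\in\mathrm{Alt}(\varphi)\}$, $\mathrm{F}_k=\{\varphi:\deg\varphi=k\}$, $\mathrm{U}_0=\mathrm{E}_0=\mathrm{F}_0$, $\mathrm{U}_{k+1}=\{\varphi\in\mathrm{F}_{k+1}:i(s)=-$ for all $s\in\mathrm{Alt}(\varphi)$ with $l(s)=k+1\}$, $\mathrm{E}_{k+1}$ likewise with $+$, $\mathrm{U}_k^+=\mathrm{U}_k\cup\bigcup_{i<k}\mathrm{F}_i$. *)

theory Defs
  imports Main
begin

section \<open>The language of Heyting arithmetic\<close>

text \<open>
  Descriptions of primitive recursive functions. For every description \<open>f\<close> and every \<open>n\<close> there is
  an \<open>n\<close>-ary function symbol, whose applications are the terms \<open>Fn f ts\<close> with \<open>length ts = n\<close>.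
  So every element of type \<open>tm\<close> is a well-formed term. Missing and superfluous arguments are covered
  by the defining equations (see \<open>HA\<close> below), so that each of these symbols
  stands for an \<open>n\<close>-ary primitive recursive function, and every primitive recursive function has
  such a symbol.
\<close>

datatype primrec_fn =
    PZero
  | PSucc
  | PProj nat
  | PComp primrec_fn "primrec_fn list"
  | PRec primrec_fn primrec_fn

text \<open>Variables are de Bruijn indices; a quantifier binds index 0 of its body.\<close>

datatype tm = Var nat | Fn primrec_fn "tm list"

datatype fm =
    Eq tm tm
  | Bot
  | Imp fm fm
  | And fm fm
  | Or fm fm
  | All fm
  | Ex fm

abbreviation Neg :: "fm \<Rightarrow> fm" where
  "Neg \<phi> \<equiv> Imp \<phi> Bot"

abbreviation Iff :: "fm \<Rightarrow> fm \<Rightarrow> fm" where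
  "Iff \<phi> \<psi> \<equiv> And (Imp \<phi> \<psi>) (Imp \<psi> \<phi>)"

abbreviation zero :: tm where
  "zero \<equiv> Fn PZero []"

abbreviation succ :: "tm \<Rightarrow> tm" where
  "succ t \<equiv> Fn PSucc [t]"

fun fv_tm :: "tm \<Rightarrow> nat set" where
  "fv_tm (Var n) = {n}"
| "fv_tm (Fn f ts) = (\<Union>t\<in>set ts. fv_tm t)"

fun fv :: "fm \<Rightarrow> nat set" where
  "fv (Eq s t) = fv_tm s \<union> fv_tm t"
| "fv Bot = {}"
| "fv (Imp \<phi> \<psi>) = fv \<phi> \<union> fv \<psi>"
| "fv (And \<phi> \<psi>) = fv \<phi> \<union> fv \<psi>"
| "fv (Or \<phi> \<psi>) = fv \<phi> \<union> fv \<psi>"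
| "fv (All \<phi>) = {n. Suc n \<in> fv \<phi>}"
| "fv (Ex \<phi>) = {n. Suc n \<in> fv \<phi>}"

fun subst_tm :: "(nat \<Rightarrow> tm) \<Rightarrow> tm \<Rightarrow> tm" where
  "subst_tm \<sigma> (Var n) = \<sigma> n"
| "subst_tm \<sigma> (Fn f ts) = Fn f (map (subst_tm \<sigma>) ts)"

definition up :: "(nat \<Rightarrow> tm) \<Rightarrow> nat \<Rightarrow> tm" where
  "up \<sigma> = case_nat (Var 0) (\<lambda>n. subst_tm (\<lambda>m. Var (Suc m)) (\<sigma> n))"

fun subst :: "(nat \<Rightarrow> tm) \<Rightarrow> fm \<Rightarrow> fm" where
  "subst \<sigma> (Eq s t) = Eq (subst_tm \<sigma> s) (subst_tm \<sigma> t)"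
| "subst \<sigma> Bot = Bot"
| "subst \<sigma> (Imp \<phi> \<psi>) = Imp (subst \<sigma> \<phi>) (subst \<sigma> \<psi>)"
| "subst \<sigma> (And \<phi> \<psi>) = And (subst \<sigma> \<phi>) (subst \<sigma> \<psi>)"
| "subst \<sigma> (Or \<phi> \<psi>) = Or (subst \<sigma> \<phi>) (subst \<sigma> \<psi>)"
| "subst \<sigma> (All \<phi>) = All (subst (up \<sigma>) \<phi>)"
| "subst \<sigma> (Ex \<phi>) = Ex (subst (up \<sigma>) \<phi>)"

definition lift :: "fm \<Rightarrow> fm" where
  "lift \<phi> = subst (\<lambda>n. Var (Suc n)) \<phi>"

definition inst :: "tm \<Rightarrow> fm \<Rightarrow> fm" where
  "inst t \<phi> = subst (case_nat t Var) \<phi>"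

section \<open>Intuitionistic provability\<close>

text \<open>
  Natural deduction for intuitionistic predicate logic: \<open>prv T \<Gamma> \<phi>\<close> says that \<open>\<phi>\<close> is derivable
  from the nonlogical axioms \<open>T\<close> under the open assumptions \<open>\<Gamma>\<close>. The eigenvariable condition
  (shifting by \<open>lift\<close>) concerns \<open>\<Gamma>\<close> only, so a nonlogical axiom with free variables
  has the force of its universal closure.
\<close>

inductive prv :: "fm set \<Rightarrow> fm set \<Rightarrow> fm \<Rightarrow> bool" for T :: "fm set" where
  Axiom: "\<phi> \<in> T \<Longrightarrow> prv T \<Gamma> \<phi>"
| Assm: "\<phi> \<in> \<Gamma> \<Longrightarrow> prv T \<Gamma> \<phi>"
| BotE: "prv T \<Gamma> Bot \<Longrightarrow> prv T \<Gamma> \<phi>"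
| ImpI: "prv T (insert \<phi> \<Gamma>) \<psi> \<Longrightarrow> prv T \<Gamma> (Imp \<phi> \<psi>)"
| ImpE: "prv T \<Gamma> (Imp \<phi> \<psi>) \<Longrightarrow> prv T \<Gamma> \<phi> \<Longrightarrow> prv T \<Gamma> \<psi>"
| AndI: "prv T \<Gamma> \<phi> \<Longrightarrow> prv T \<Gamma> \<psi> \<Longrightarrow> prv T \<Gamma> (And \<phi> \<psi>)"
| AndE1: "prv T \<Gamma> (And \<phi> \<psi>) \<Longrightarrow> prv T \<Gamma> \<phi>"
| AndE2: "prv T \<Gamma> (And \<phi> \<psi>) \<Longrightarrow> prv T \<Gamma> \<psi>"
| OrI1: "prv T \<Gamma> \<phi> \<Longrightarrow> prv T \<Gamma> (Or \<phi> \<psi>)"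
| OrI2: "prv T \<Gamma> \<psi> \<Longrightarrow> prv T \<Gamma> (Or \<phi> \<psi>)"
| OrE: "prv T \<Gamma> (Or \<phi> \<psi>) \<Longrightarrow> prv T (insert \<phi> \<Gamma>) \<chi> \<Longrightarrow> prv T (insert \<psi> \<Gamma>) \<chi> \<Longrightarrow> prv T \<Gamma> \<chi>"
| AllI: "prv T (lift ` \<Gamma>) \<phi> \<Longrightarrow> prv T \<Gamma> (All \<phi>)"
| AllE: "prv T \<Gamma> (All \<phi>) \<Longrightarrow> prv T \<Gamma> (inst t \<phi>)"
| ExI: "prv T \<Gamma> (inst t \<phi>) \<Longrightarrow> prv T \<Gamma> (Ex \<phi>)"
| ExE: "prv T \<Gamma> (Ex \<phi>) \<Longrightarrow> prv T (insert \<phi> (lift ` \<Gamma>)) (lift \<chi>) \<Longrightarrow> prv T \<Gamma> \<chi>"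

text \<open>A theory is given by its set of nonlogical axioms.\<close>

definition theorems :: "fm set \<Rightarrow> fm set" where
  "theorems T = {\<phi>. prv T {} \<phi>}"

definition in_between :: "fm set \<Rightarrow> fm set \<Rightarrow> fm set \<Rightarrow> bool" where
  "in_between T S S' \<longleftrightarrow> theorems S \<subseteq> theorems T \<and> theorems T \<subseteq> theorems S'"

definition proves_schema :: "fm set \<Rightarrow> fm set \<Rightarrow> bool" where
  "proves_schema T P \<longleftrightarrow> (\<forall>\<phi>\<in>P. \<phi> \<in> theorems T)"

section \<open>Heyting and Peano arithmetic\<close>

inductive_set HA :: "fm set" where
  eq_refl: "Eq t t \<in> HA"
| eq_repl: "Imp (Eq s t) (Imp (inst s \<phi>) (inst t \<phi>)) \<in> HA"
| succ_nonzero: "Neg (Eq (succ t) zero) \<in> HA"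
| succ_inj: "Imp (Eq (succ s) (succ t)) (Eq s t) \<in> HA"
| def_Zero: "Eq (Fn PZero ts) zero \<in> HA"
| def_Succ_Nil: "Eq (Fn PSucc []) (succ zero) \<in> HA"
| def_Succ_Cons: "Eq (Fn PSucc (t # ts)) (succ t) \<in> HA"
| def_Proj: "Eq (Fn (PProj i) ts) (if i < length ts then ts ! i else zero) \<in> HA"
| def_Comp: "Eq (Fn (PComp f gs) ts) (Fn f (map (\<lambda>g. Fn g ts) gs)) \<in> HA"
| def_Rec_Nil: "Eq (Fn (PRec f g) []) zero \<in> HA"
| def_Rec_zero: "Eq (Fn (PRec f g) (zero # ts)) (Fn f ts) \<in> HA"
| def_Rec_succ:
    "Eq (Fn (PRec f g) (succ t # ts)) (Fn g (t # Fn (PRec f g) (t # ts) # ts)) \<in> HA"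
| induction:
    "Imp (And (inst zero \<phi>)
              (All (Imp \<phi> (subst (case_nat (succ (Var 0)) (\<lambda>n. Var (Suc n))) \<phi>))))
         (All \<phi>) \<in> HA"

definition PA :: "fm set" where
  "PA = HA \<union> {Or \<phi> (Neg \<phi>) | \<phi>. True}"

section \<open>Prenex classes and logical principles\<close>

fun qf :: "fm \<Rightarrow> bool" where
  "qf (Eq s t) = True"
| "qf Bot = True"
| "qf (Imp \<phi> \<psi>) = (qf \<phi> \<and> qf \<psi>)"
| "qf (And \<phi> \<psi>) = (qf \<phi> \<and> qf \<psi>)"
| "qf (Or \<phi> \<psi>) = (qf \<phi> \<and> qf \<psi>)"
| "qf (All \<phi>) = False"
| "qf (Ex \<phi>) = False"

text \<open>\<open>n\<close> is the length of the leading quantifier block, which may be empty.\<close>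

fun Sigma_fm :: "nat \<Rightarrow> fm set" and Pi_fm :: "nat \<Rightarrow> fm set" where
  "Sigma_fm 0 = {\<phi>. qf \<phi>}"
| "Sigma_fm (Suc k) = {(Ex ^^ n) \<phi> | n \<phi>. \<phi> \<in> Pi_fm k}"
| "Pi_fm 0 = {\<phi>. qf \<phi>}"
| "Pi_fm (Suc k) = {(All ^^ n) \<phi> | n \<phi>. \<phi> \<in> Sigma_fm k}"

definition LEM :: "fm set \<Rightarrow> fm set" where
  "LEM \<Gamma> = {All (Or \<phi> (Neg \<phi>)) | \<phi>. \<phi> \<in> \<Gamma> \<and> fv \<phi> \<subseteq> {0}}"

definition DNE :: "fm set \<Rightarrow> fm set" where
  "DNE \<Gamma> = {All (Imp (Neg (Neg \<phi>)) \<phi>) | \<phi>. \<phi> \<in> \<Gamma> \<and> fv \<phi> \<subseteq> {0}}"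

text \<open>In \<open>\<phi>(x, y)\<close>, the variable \<open>y\<close> is index 0 and \<open>x\<close> is index 1.\<close>

definition DNS :: "fm set \<Rightarrow> fm set" where
  "DNS \<Gamma> = {All (Imp (All (Neg (Neg \<phi>))) (Neg (Neg (All \<phi>)))) | \<phi>. \<phi> \<in> \<Gamma> \<and> fv \<phi> \<subseteq> {0, 1}}"

definition PNFT :: "fm set \<Rightarrow> fm set \<Rightarrow> fm set \<Rightarrow> bool" where
  "PNFT T \<Gamma> \<Gamma>' \<longleftrightarrow> (\<forall>\<phi>\<in>\<Gamma>. \<exists>\<phi>'\<in>\<Gamma>'. fv \<phi> = fv \<phi>' \<and> Iff \<phi> \<phi>' \<in> theorems T)"

section \<open>Alternation paths and the classes they determine\<close>

datatype sign = Plus | Minus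

fun flip :: "sign \<Rightarrow> sign" where
  "flip Plus = Minus"
| "flip Minus = Plus"

definition dual :: "sign list \<Rightarrow> sign list" where
  "dual s = map flip s"

text \<open>The value \<open>None\<close> is the symbol assigned to the empty path.\<close>

definition init :: "sign list \<Rightarrow> sign option" where
  "init s = (case s of [] \<Rightarrow> None | a # _ \<Rightarrow> Some a)"

text \<open>The clause for negation takes precedence over the one for implication.\<close>

fun Alt :: "fm \<Rightarrow> sign list set" where
  "Alt (Eq s t) = {[]}"
| "Alt Bot = {[]}"
| "Alt (Imp \<phi> \<psi>) =
     (if qf (Imp \<phi> \<psi>) then {[]}
      else if \<psi> = Bot then dual ` Alt \<phi>
      else dual ` Alt \<phi> \<union> Alt \<psi>)"
| "Alt (And \<phi> \<psi>) = (if qf (And \<phi> \<psi>) then {[]} else Alt \<phi> \<union> Alt \<psi>)"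
| "Alt (Or \<phi> \<psi>) = (if qf (Or \<phi> \<psi>) then {[]} else Alt \<phi> \<union> Alt \<psi>)"
| "Alt (All \<phi>) =
     {s \<in> Alt \<phi>. init s = Some Minus} \<union> {Minus # s | s. s \<in> Alt \<phi> \<and> init s \<noteq> Some Minus}"
| "Alt (Ex \<phi>) =
     {s \<in> Alt \<phi>. init s = Some Plus} \<union> {Plus # s | s. s \<in> Alt \<phi> \<and> init s \<noteq> Some Plus}"

definition deg :: "fm \<Rightarrow> nat" where
  "deg \<phi> = Max (length ` Alt \<phi>)"

definition F_fm :: "nat \<Rightarrow> fm set" where
  "F_fm k = {\<phi>. deg \<phi> = k}"

fun U_fm :: "nat \<Rightarrow> fm set" where
  "U_fm 0 = F_fm 0"
| "U_fm (Suc k) =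
     {\<phi> \<in> F_fm (Suc k). \<forall>s\<in>Alt \<phi>. length s = Suc k \<longrightarrow> init s = Some Minus}"

fun E_fm :: "nat \<Rightarrow> fm set" where
  "E_fm 0 = F_fm 0"
| "E_fm (Suc k) =
     {\<phi> \<in> F_fm (Suc k). \<forall>s\<in>Alt \<phi>. length s = Suc k \<longrightarrow> init s = Some Plus}"

definition U_plus :: "nat \<Rightarrow> fm set" where
  "U_plus k = U_fm k \<union> (\<Union>i<k. F_fm i)"

end

theory Submission
  imports Defs
begin

text \<open>
  Over HA with excluded middle for \<open>\<Pi>\<^sub>k\<^sub>-\<^sub>1\<close>, double negation elimination for \<open>\<Sigma>\<^sub>k\<close> makes all formulas of
  degree below \<open>k\<close> decidable, so that these have prenex normal forms. At level \<open>k\<close> one shows by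
  simultaneous induction that an \<open>E\<^sub>k\<^sup>+\<close>-formula is equivalent to a \<open>\<Sigma>\<^sub>k\<close>-formula, and that the negation
  of a \<open>U\<^sub>k\<^sup>+\<close>-formula is. The double negation shift is needed for \<open>\<not> \<forall>x \<phi>\<close> only.

  Conversely, if \<open>\<phi>\<close> is in \<open>\<Sigma>\<^sub>k\<close>, then \<open>\<not> \<not> \<phi>\<close> is equivalent in \<open>T\<close> to some \<open>\<psi>\<close> in \<open>\<Sigma>\<^sub>k\<close>, and PA proves
  \<open>\<psi> \<longrightarrow> \<phi>\<close>. Implications between \<open>\<Sigma>\<^sub>k\<close>-formulas are conserved from PA to HA with excluded middle for
  \<open>\<Sigma>\<^sub>k\<^sub>-\<^sub>1\<close>: in the negative translation read \<open>\<phi>\<close> for falsity, as Friedman did for \<open>k = 1\<close>. Likewise, the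
  double negation shift for \<open>\<phi>\<close> follows by conservation of \<open>\<beta> \<longrightarrow> \<exists>x \<alpha>\<close>, where \<open>\<alpha>\<close> and \<open>\<beta>\<close> are prenex
  normal forms of \<open>\<not> \<phi>\<close> and \<open>\<not> \<forall>x \<phi>\<close>.
\<close>

section \<open>Substitution\<close>

text \<open>The schemata admit a single parameter, but an induction on formulas needs instances with
  arbitrarily many. So HA has to code tuples of variables, for which Cantor's pairing is verified
  inside HA. \<open>T\<close> is known only by its theorems and may have axioms that no negative
  translation respects. Therefore only derivations in PA are translated, and they become derivations
  in HA. \<open>T\<close> is called upon afterwards, to remove the translation from prenex formulas,
  and this works as long as \<open>T\<close> decides whatever lies below the outer existential
  block. The hypothesis on \<open>T\<close> yields excluded middle on the \<Pi> side only; the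
  \<Sigma> side takes double negation elimination. Hence the converse climbs: elimination at level
  \<open>j\<close> makes \<open>T\<close> decide level \<open>j\<close>, which conservation at level
  \<open>j + 1\<close> presupposes, and so normal forms at lower levels are used as well.\<close>

lemma up_simps [simp]:
  "up \<sigma> 0 = Var 0"
  "up \<sigma> (Suc n) = subst_tm (\<lambda>m. Var (Suc m)) (\<sigma> n)"
  by (simp_all add: up_def)

lemma subst_tm_Var [simp]: "subst_tm Var t = t"
  by (induction t) (simp_all add: map_idI)

lemma subst_tm_comp: "subst_tm \<sigma> (subst_tm \<tau> t) = subst_tm (\<lambda>n. subst_tm \<sigma> (\<tau> n)) t"
  by (induction t) simp_all

lemma subst_tm_cong: "(\<And>n. n \<in> fv_tm t \<Longrightarrow> \<sigma> n = \<tau> n) \<Longrightarrow> subst_tm \<sigma> t = subst_tm \<tau> t"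
  by (induction t) auto

lemma fv_subst_tm: "fv_tm (subst_tm \<sigma> t) = (\<Union>n\<in>fv_tm t. fv_tm (\<sigma> n))"
  by (induction t) auto

lemma up_Var [simp]: "up Var = Var"
  by (rule ext, rename_tac n, case_tac n) simp_all

lemma up_comp: "(\<lambda>n. subst_tm (up \<sigma>) (up \<tau> n)) = up (\<lambda>n. subst_tm \<sigma> (\<tau> n))"
  by (rule ext, rename_tac n, case_tac n) (simp_all add: subst_tm_comp)

lemma subst_Var [simp]: "subst Var \<phi> = \<phi>"
  by (induction \<phi>) simp_all

lemma subst_comp: "subst \<sigma> (subst \<tau> \<phi>) = subst (\<lambda>n. subst_tm \<sigma> (\<tau> n)) \<phi>"
  by (induction \<phi> arbitrary: \<sigma> \<tau>) (simp_all add: subst_tm_comp up_comp)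

lemma subst_cong: "\<forall>n\<in>fv \<phi>. \<sigma> n = \<tau> n \<Longrightarrow> subst \<sigma> \<phi> = subst \<tau> \<phi>"
proof (induction \<phi> arbitrary: \<sigma> \<tau>)
  case (Eq s t)
  then show ?case by (auto intro: subst_tm_cong)
next
  case (All \<phi>)
  have "\<forall>n\<in>fv \<phi>. up \<sigma> n = up \<tau> n"
  proof
    fix n assume "n \<in> fv \<phi>"
    then show "up \<sigma> n = up \<tau> n" using All.prems by (cases n) auto
  qed
  then show ?case by (simp add: All.IH)
next
  case (Ex \<phi>)
  have "\<forall>n\<in>fv \<phi>. up \<sigma> n = up \<tau> n"
  proof
    fix n assume "n \<in> fv \<phi>"
    then show "up \<sigma> n = up \<tau> n" using Ex.prems by (cases n) auto
  qed
  then show ?case by (simp add: Ex.IH)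
next
  case Bot
  then show ?case by simp
next
  case (Imp \<phi> \<psi>)
  then show ?case using Imp.IH(1)[of \<sigma> \<tau>] Imp.IH(2)[of \<sigma> \<tau>] by simp
next
  case (And \<phi> \<psi>)
  then show ?case using And.IH(1)[of \<sigma> \<tau>] And.IH(2)[of \<sigma> \<tau>] by simp
next
  case (Or \<phi> \<psi>)
  then show ?case using Or.IH(1)[of \<sigma> \<tau>] Or.IH(2)[of \<sigma> \<tau>] by simp
qed

lemma fv_subst_up:
  "{n. Suc n \<in> (\<Union>m\<in>A. fv_tm (up \<sigma> m))} = (\<Union>m\<in>{n. Suc n \<in> A}. fv_tm (\<sigma> m))"
proof (intro set_eqI iffI)
  fix n assume "n \<in> {n. Suc n \<in> (\<Union>m\<in>A. fv_tm (up \<sigma> m))}"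
  then obtain m where "m \<in> A" "Suc n \<in> fv_tm (up \<sigma> m)" by auto
  then show "n \<in> (\<Union>m\<in>{n. Suc n \<in> A}. fv_tm (\<sigma> m))"
    by (cases m) (auto simp: fv_subst_tm)
next
  fix n assume "n \<in> (\<Union>m\<in>{n. Suc n \<in> A}. fv_tm (\<sigma> m))"
  then obtain m where "Suc m \<in> A" "n \<in> fv_tm (\<sigma> m)" by auto
  then show "n \<in> {n. Suc n \<in> (\<Union>m\<in>A. fv_tm (up \<sigma> m))}"
    by (auto intro!: bexI[of _ "Suc m"] simp: fv_subst_tm)
qed

lemma fv_subst: "fv (subst \<sigma> \<phi>) = (\<Union>n\<in>fv \<phi>. fv_tm (\<sigma> n))"
  by (induction \<phi> arbitrary: \<sigma>) (simp_all only: fv.simps subst.simps fv_subst_up, auto simp: fv_subst_tm)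

lemma fv_lift [simp]: "fv (lift \<phi>) = Suc ` fv \<phi>"
  by (auto simp: lift_def fv_subst)

lemma finite_fv_tm: "finite (fv_tm t)"
  by (induction t) auto

lemma finite_fv: "finite (fv \<phi>)"
proof (induction \<phi>)
  case (All \<phi>)
  then show ?case using finite_vimageI[of "fv \<phi>" Suc] by (simp add: vimage_def)
next
  case (Ex \<phi>)
  then show ?case using finite_vimageI[of "fv \<phi>" Suc] by (simp add: vimage_def)
qed (simp_all add: finite_fv_tm)

lemma fv_bounded: obtains n where "fv \<phi> \<subseteq> {..<n}"
  using finite_fv[of \<phi>] unfolding finite_nat_set_iff_bounded by auto

lemma lift_simps [simp]:
  "lift Bot = Bot"
  "lift (Imp \<phi> \<psi>) = Imp (lift \<phi>) (lift \<psi>)"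
  "lift (And \<phi> \<psi>) = And (lift \<phi>) (lift \<psi>)"
  "lift (Or \<phi> \<psi>) = Or (lift \<phi>) (lift \<psi>)"
  by (simp_all add: lift_def)

lemma inst_lift [simp]: "inst t (lift \<phi>) = \<phi>"
  by (simp add: inst_def lift_def subst_comp)

lemma subst_up_lift: "subst (up \<sigma>) (lift \<phi>) = lift (subst \<sigma> \<phi>)"
  by (simp add: lift_def subst_comp)

lemma inst_subst_up: "inst t (subst (up \<sigma>) \<phi>) = subst (case_nat t \<sigma>) \<phi>"
proof -
  have "(\<lambda>n. subst_tm (case_nat t Var) (up \<sigma> n)) = case_nat t \<sigma>"
    by (rule ext, rename_tac n, case_tac n) (simp_all add: subst_tm_comp)
  then show ?thesis by (simp add: inst_def subst_comp)
qed

lemma inst_Var_subst_up: "inst (Var 0) (subst (up (\<lambda>n. Var (Suc n))) \<phi>) = \<phi>"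
proof -
  have "case_nat (Var 0) (\<lambda>n. Var (Suc n)) = Var"
    by (rule ext, rename_tac n, case_tac n) simp_all
  then show ?thesis by (simp add: inst_subst_up)
qed

lemma qf_subst [simp]: "qf (subst \<sigma> \<phi>) = qf \<phi>"
  by (induction \<phi> arbitrary: \<sigma>) simp_all

section \<open>Derivability\<close>

abbreviation provable :: "fm set \<Rightarrow> fm \<Rightarrow> bool" (infix "\<turnstile>" 50) where
  "T \<turnstile> \<phi> \<equiv> prv T {} \<phi>"

lemma prv_weaken: "prv T \<Gamma> \<phi> \<Longrightarrow> \<Gamma> \<subseteq> \<Delta> \<Longrightarrow> prv T \<Delta> \<phi>"
proof (induction arbitrary: \<Delta> rule: prv.induct)
  case (Assm \<phi> \<Gamma>)
  then show ?case by (auto intro: prv.Assm)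
next
  case (ImpI \<phi> \<Gamma> \<psi>)
  then show ?case by (intro prv.ImpI ImpI.IH insert_mono)
next
  case (ImpE \<Gamma> \<phi> \<psi>)
  then show ?case by (meson prv.ImpE)
next
  case (AndE1 \<Gamma> \<phi> \<psi>)
  then show ?case by (meson prv.AndE1)
next
  case (AndE2 \<Gamma> \<phi> \<psi>)
  then show ?case by (meson prv.AndE2)
next
  case (OrE \<Gamma> \<phi> \<psi> \<chi>)
  then show ?case by (meson prv.OrE insert_mono)
next
  case (AllI \<Gamma> \<phi>)
  then show ?case by (simp add: prv.AllI image_mono)
next
  case (ExI \<Gamma> t \<phi>)
  then show ?case by (meson prv.ExI)
next
  case (ExE \<Gamma> \<phi> \<chi>)
  then show ?case by (meson prv.ExE image_mono insert_mono)
qed (simp_all add: prv.Axiom prv.BotE prv.AndI prv.OrI1 prv.OrI2 prv.AllE)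

lemma prv_theory_mono:
  assumes "\<And>\<phi>. \<phi> \<in> S \<Longrightarrow> T \<turnstile> \<phi>"
  shows "prv S \<Gamma> \<phi> \<Longrightarrow> prv T \<Gamma> \<phi>"
proof (induction rule: prv.induct)
  case (Axiom \<phi> \<Gamma>)
  then show ?case using prv_weaken[OF assms] by simp
qed (rule prv.intros; assumption)+

lemma prv_Alls: "T \<turnstile> \<phi> \<Longrightarrow> T \<turnstile> (All ^^ n) \<phi>"
  by (induction n) (auto intro: prv.AllI)

text \<open>The induction instantiates the outer quantifiers first, so \<open>\<sigma> 0\<close> is
  meant for the innermost one. Variables that are free in the closure come down by
  \<open>n\<close>.\<close>

lemma prv_Alls_inst:
  "prv T \<Gamma> ((All ^^ n) \<phi>) \<Longrightarrow> prv T \<Gamma> (subst (\<lambda>i. if i < n then \<sigma> i else Var (i - n)) \<phi>)"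
proof (induction n arbitrary: \<phi> \<sigma>)
  case (Suc n)
  let ?\<tau> = "\<lambda>i. if i < n then \<sigma> (Suc i) else Var (i - n)"
  have "prv T \<Gamma> (subst ?\<tau> (All \<phi>))"
    using Suc.IH[of "All \<phi>" "\<lambda>i. \<sigma> (Suc i)"] Suc.prems by (simp add: funpow_swap1)
  then have "prv T \<Gamma> (inst (\<sigma> 0) (subst (up ?\<tau>) \<phi>))" by (auto intro: prv.AllE)
  moreover have "case_nat (\<sigma> 0) ?\<tau> = (\<lambda>i. if i < Suc n then \<sigma> i else Var (i - Suc n))"
    by (rule ext, rename_tac i, case_tac i) simp_all
  ultimately show ?case by (simp add: inst_subst_up)
qed simp

text \<open>The axioms need not be closed under substitution, so an induction on derivations would
  fail at \<open>Axiom\<close>. Instead all free variables are generalised, which the empty context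
  permits, and then instantiated.\<close>

lemma prv_subst: "T \<turnstile> \<phi> \<Longrightarrow> prv T \<Gamma> (subst \<sigma> \<phi>)"
proof -
  assume "T \<turnstile> \<phi>"
  obtain n where n: "fv \<phi> \<subseteq> {..<n}" by (rule fv_bounded)
  have "T \<turnstile> subst (\<lambda>i. if i < n then \<sigma> i else Var (i - n)) \<phi>"
    by (rule prv_Alls_inst) (rule prv_Alls, fact)
  also have "subst (\<lambda>i. if i < n then \<sigma> i else Var (i - n)) \<phi> = subst \<sigma> \<phi>"
    using n by (intro subst_cong) auto
  finally show ?thesis by (rule prv_weaken) simp
qed

lemma prv_lift: "T \<turnstile> \<phi> \<Longrightarrow> T \<turnstile> lift \<phi>"
  by (simp add: lift_def prv_subst)

section \<open>Quantifier rules for the variable of index 0\<close>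

lemma prv_lift_All: "prv T \<Gamma> (lift (All \<phi>)) \<Longrightarrow> prv T \<Gamma> \<phi>"
  using prv.AllE[of T \<Gamma> "subst (up (\<lambda>n. Var (Suc n))) \<phi>" "Var 0"]
  by (simp add: lift_def inst_Var_subst_up)

lemma prv_lift_Ex: "prv T \<Gamma> \<phi> \<Longrightarrow> prv T \<Gamma> (lift (Ex \<phi>))"
  using prv.ExI[of T \<Gamma> "Var 0" "subst (up (\<lambda>n. Var (Suc n))) \<phi>"]
  by (simp add: lift_def inst_Var_subst_up)

text \<open>Quantifiers as adjoints of \<open>lift\<close>. In this form, and with the three lemmas
  that follow, quantifier steps become implications in which the propositional prover can treat
  \<open>lift (All \<phi>)\<close> and \<open>lift (Ex \<phi>)\<close> as atoms.\<close>

lemma All_elim: "T \<turnstile> Imp (lift (All \<phi>)) \<phi>"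
  by (rule prv.ImpI, rule prv_lift_All, rule prv.Assm) simp

lemma Ex_intro: "T \<turnstile> Imp \<phi> (lift (Ex \<phi>))"
  by (rule prv.ImpI, rule prv_lift_Ex, rule prv.Assm) simp

lemma Imp_AllI: "T \<turnstile> Imp (lift \<chi>) \<phi> \<Longrightarrow> T \<turnstile> Imp \<chi> (All \<phi>)"
proof (rule prv.ImpI, rule prv.AllI)
  assume "T \<turnstile> Imp (lift \<chi>) \<phi>"
  then have "prv T (lift ` {\<chi>}) (Imp (lift \<chi>) \<phi>)" by (rule prv_weaken) simp
  then show "prv T (lift ` {\<chi>}) \<phi>" by (rule prv.ImpE) (simp add: prv.Assm)
qed

lemma Imp_ExE: "T \<turnstile> Imp \<phi> (lift \<chi>) \<Longrightarrow> T \<turnstile> Imp (Ex \<phi>) \<chi>"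
proof (rule prv.ImpI, rule prv.ExE)
  show "prv T {Ex \<phi>} (Ex \<phi>)" by (simp add: prv.Assm)
  assume "T \<turnstile> Imp \<phi> (lift \<chi>)"
  then have "prv T (insert \<phi> (lift ` {Ex \<phi>})) (Imp \<phi> (lift \<chi>))" by (rule prv_weaken) simp
  then show "prv T (insert \<phi> (lift ` {Ex \<phi>})) (lift \<chi>)" by (rule prv.ImpE) (simp add: prv.Assm)
qed

lemma provable_All_iff: "T \<turnstile> All \<phi> \<longleftrightarrow> T \<turnstile> \<phi>"
proof
  assume "T \<turnstile> All \<phi>"
  then have "T \<turnstile> lift (All \<phi>)" by (rule prv_lift)
  then show "T \<turnstile> \<phi>" by (rule prv_lift_All)
qed (simp add: prv.AllI)

section \<open>A reflected prover for intuitionistic propositional logic\<close>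

datatype pfm = Atom nat | PBot | PImp pfm pfm | PAnd pfm pfm | POr pfm pfm

text \<open>
  Backward search in Dyckhoff's contraction-free calculus G4ip for the sequent with antecedents
  \<open>xs @ ys\<close>; \<open>xs\<close> still has to be decomposed, \<open>ys\<close> only contains formulas without invertible rule.
\<close>

fun search :: "nat \<Rightarrow> pfm list \<Rightarrow> pfm list \<Rightarrow> pfm \<Rightarrow> bool" where
  "search 0 xs ys g = False"
| "search (Suc n) xs ys g = (case g of
     PImp a b \<Rightarrow> search n (a # xs) ys b
   | PAnd a b \<Rightarrow> search n xs ys a \<and> search n xs ys b
   | _ \<Rightarrow> (case xs of
       x # xs \<Rightarrow> (case x of
         Atom i \<Rightarrow> search n xs (x # ys) g
       | PBot \<Rightarrow> True
       | PAnd a b \<Rightarrow> search n (a # b # xs) ys g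
       | POr a b \<Rightarrow> search n (a # xs) ys g \<and> search n (b # xs) ys g
       | PImp a c \<Rightarrow> (case a of
           PBot \<Rightarrow> search n xs ys g
         | PAnd a b \<Rightarrow> search n (PImp a (PImp b c) # xs) ys g
         | POr a b \<Rightarrow> search n (PImp a c # PImp b c # xs) ys g
         | _ \<Rightarrow> search n xs (x # ys) g))
     | [] \<Rightarrow> g \<in> set ys \<or>
         (case find (\<lambda>y. case y of PImp a c \<Rightarrow> a \<in> set ys | _ \<Rightarrow> False) ys of
           Some y \<Rightarrow> (case y of PImp a c \<Rightarrow> search n [c] (remove1 y ys) g | _ \<Rightarrow> False)
         | None \<Rightarrow>
             (case g of POr a b \<Rightarrow> search n [] ys a \<or> search n [] ys b | _ \<Rightarrow> False) \<or>
             (\<exists>y\<in>set ys. case y of PImp d c \<Rightarrow> (case d of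
                 PImp a b \<Rightarrow> search n [a, PImp b c] (remove1 y ys) b \<and> search n [c] (remove1 y ys) g
               | _ \<Rightarrow> False) | _ \<Rightarrow> False))))"

fun interp :: "fm list \<Rightarrow> pfm \<Rightarrow> fm" where
  "interp v (Atom i) = v ! i"
| "interp v PBot = Bot"
| "interp v (PImp a b) = Imp (interp v a) (interp v b)"
| "interp v (PAnd a b) = And (interp v a) (interp v b)"
| "interp v (POr a b) = Or (interp v a) (interp v b)"

text \<open>Rules that discharge an assumption enlarge the context, so \<Gamma> is generalised in
  the induction. Soundness is enough, since each application evaluates \<open>search\<close> on a
  concrete formula.\<close>

lemma search_sound:
  "search n xs ys g \<Longrightarrow> (\<And>x. x \<in> set xs \<union> set ys \<Longrightarrow> prv T \<Gamma> (interp v x)) \<Longrightarrow> prv T \<Gamma> (interp v g)"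
proof (induction n arbitrary: xs ys g \<Gamma>)
  case (Suc n)
  note prems = Suc.prems(1) and hyp = Suc.prems(2)
  have hyp': "prv T (insert \<phi> \<Gamma>) (interp v x)" if "x \<in> set xs \<union> set ys" for x \<phi>
    using hyp[OF that] by (rule prv_weaken) auto
  have assm: "prv T (insert \<phi> \<Gamma>) \<phi>" for \<phi>
    by (simp add: prv.Assm)
  have left: "prv T \<Gamma> (interp v g)"
    if g: "\<forall>a b. g \<noteq> PImp a b" "\<forall>a b. g \<noteq> PAnd a b"
  proof (cases xs)
    case (Cons x xs')
    have x: "prv T \<Gamma> (interp v x)" using hyp Cons by simp
    have *: "prv T \<Delta> (interp v g)" if "search n (zs @ xs') ys g" "\<Gamma> \<subseteq> \<Delta>"
      "\<And>z. z \<in> set zs \<Longrightarrow> prv T \<Delta> (interp v z)" for zs \<Delta>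
      using that(1)
    proof (rule Suc.IH)
      fix z assume z: "z \<in> set (zs @ xs') \<union> set ys"
      then have "z \<in> set zs \<or> z \<in> set xs \<union> set ys" using Cons by auto
      then show "prv T \<Delta> (interp v z)" using that(2,3) hyp prv_weaken by blast
    qed
    have move: "prv T \<Gamma> (interp v g)" if "search n xs' (x # ys) g"
      using that by (rule Suc.IH) (use hyp Cons in auto)
    show ?thesis
    proof (cases x)
      case (Atom i)
      then show ?thesis using prems g Cons by (intro move) (cases g; simp)
    next
      case PBot
      then show ?thesis using x prv.BotE by simp
    next
      case (PAnd a b)
      then have "search n ([a, b] @ xs') ys g" using prems g Cons by (cases g; simp)
      then show ?thesis
        by (rule *) (use x PAnd in \<open>auto intro: prv.AndE1 prv.AndE2\<close>)
    next
      case (POr a b)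
      then have s: "search n ([a] @ xs') ys g" "search n ([b] @ xs') ys g"
        using prems g Cons by (cases g; simp)+
      show ?thesis
      proof (rule prv.OrE)
        show "prv T \<Gamma> (Or (interp v a) (interp v b))" using x POr by simp
        show "prv T (insert (interp v a) \<Gamma>) (interp v g)"
          using s(1) by (rule *) (auto simp: prv.Assm)
        show "prv T (insert (interp v b) \<Gamma>) (interp v g)"
          using s(2) by (rule *) (auto simp: prv.Assm)
      qed
    next
      case (PImp d c)
      then have x: "prv T \<Gamma> (Imp (interp v d) (interp v c))" using x by simp
      have imp: "prv T \<Gamma> (Imp \<psi> (interp v c))" if "prv T (insert \<psi> \<Gamma>) (interp v d)" for \<psi>
        using x that by (meson prv.ImpI prv.ImpE prv_weaken subset_insertI)
      show ?thesis
      proof (cases d)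
        case (Atom i)
        then show ?thesis using prems g Cons PImp by (intro move) (cases g; simp)
      next
        case PBot
        then have "search n ([] @ xs') ys g" using prems g Cons PImp by (cases g; simp)
        then show ?thesis by (rule *) auto
      next
        case d: (PImp a b)
        then show ?thesis using prems g Cons PImp by (intro move) (cases g; simp)
      next
        case (PAnd a b)
        then have s: "search n ([pfm.PImp a (pfm.PImp b c)] @ xs') ys g"
          using prems g Cons PImp by (cases g; simp)
        have "prv T (insert (interp v b) (insert (interp v a) \<Gamma>)) (interp v d)"
          unfolding PAnd interp.simps by (rule prv.AndI) (simp_all add: prv.Assm)
        then have "prv T (insert (interp v b) (insert (interp v a) \<Gamma>)) (interp v c)"
          using x by (meson prv.ImpE prv_weaken subset_insertI)
        then have "prv T \<Gamma> (interp v (pfm.PImp a (pfm.PImp b c)))"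
          by (auto intro!: prv.ImpI)
        then show ?thesis by (intro *[OF s]) auto
      next
        case (POr a b)
        then have s: "search n ([pfm.PImp a c, pfm.PImp b c] @ xs') ys g"
          using prems g Cons PImp by (cases g; simp)
        have "prv T \<Gamma> (interp v (pfm.PImp a c))" "prv T \<Gamma> (interp v (pfm.PImp b c))"
          using POr by (simp_all add: imp prv.OrI1 prv.OrI2 prv.Assm)
        then show ?thesis by (intro *[OF s]) auto
      qed
    qed
  next
    case Nil
    have *: "prv T \<Delta> (interp v h)" if "search n zs (remove1 y ys) h" "\<Gamma> \<subseteq> \<Delta>"
      "\<And>z. z \<in> set zs \<Longrightarrow> prv T \<Delta> (interp v z)" for zs \<Delta> h y
      using that(1)
    proof (rule Suc.IH)
      fix z assume z: "z \<in> set zs \<union> set (remove1 y ys)"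
      then have "z \<in> set zs \<or> z \<in> set xs \<union> set ys" by (auto dest: notin_set_remove1)
      then show "prv T \<Delta> (interp v z)" using that(2,3) hyp prv_weaken by blast
    qed
    have same: "prv T \<Gamma> (interp v h)" if "search n [] ys h" for h
      using that by (rule Suc.IH) (use hyp in auto)
    let ?P = "\<lambda>y. case y of PImp a c \<Rightarrow> a \<in> set ys | _ \<Rightarrow> False"
    consider "g \<in> set ys" | y where "find ?P ys = Some y" "case y of PImp a c \<Rightarrow> search n [c] (remove1 y ys) g | _ \<Rightarrow> False"
      | a b where "g = POr a b" "search n [] ys a \<or> search n [] ys b"
      | y where "y \<in> set ys" "case y of PImp d c \<Rightarrow> (case d of
            PImp a b \<Rightarrow> search n [a, PImp b c] (remove1 y ys) b \<and> search n [c] (remove1 y ys) g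
          | _ \<Rightarrow> False) | _ \<Rightarrow> False"
      using prems g Nil by (cases g) (auto split: option.splits)
    then show ?thesis
    proof cases
      case 1
      then show ?thesis using hyp by simp
    next
      case (2 y)
      then obtain a c where y: "y = PImp a c" "search n [c] (remove1 y ys) g" by (cases y) auto
      have "y \<in> set ys \<and> ?P y" using 2(1) by (auto simp: find_Some_iff)
      then have "y \<in> set ys" "a \<in> set ys" using y(1) by simp_all
      then have "prv T \<Gamma> (interp v y)" "prv T \<Gamma> (interp v a)" using hyp by auto
      then have "prv T \<Gamma> (interp v c)" unfolding y(1) by (auto intro: prv.ImpE)
      then show ?thesis by (intro *[OF y(2)]) auto
    next
      case (3 a b)
      then show ?thesis using same by (auto intro: prv.OrI1 prv.OrI2)
    next
      case (4 y)
      then obtain a b c where abc: "y = PImp (PImp a b) c" "search n [a, PImp b c] (remove1 y ys) b"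
          "search n [c] (remove1 y ys) g"
        by (auto split: pfm.splits)
      have y: "prv T \<Gamma> (Imp (Imp (interp v a) (interp v b)) (interp v c))"
        using hyp[of y] 4(1) abc(1) by simp
      \<comment> \<open>From \<open>b\<close> one has \<open>a \<longrightarrow> b\<close>, so the
        nested implication already contains \<open>b \<longrightarrow> c\<close>. Dyckhoff's rule
        puts this smaller formula in its place while \<open>a \<longrightarrow> b\<close> is being
        proved.\<close>
      have "prv T (insert (interp v b) (insert (interp v a) \<Gamma>)) (interp v c)"
      proof (rule prv.ImpE)
        show "prv T (insert (interp v b) (insert (interp v a) \<Gamma>)) (Imp (Imp (interp v a) (interp v b)) (interp v c))"
          using y by (rule prv_weaken) auto
        show "prv T (insert (interp v b) (insert (interp v a) \<Gamma>)) (Imp (interp v a) (interp v b))"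
          by (rule prv.ImpI) (simp add: prv.Assm)
      qed
      then have "prv T (insert (interp v a) \<Gamma>) (interp v (PImp b c))" by (simp add: prv.ImpI)
      then have "prv T (insert (interp v a) \<Gamma>) (interp v b)" by (intro *[OF abc(2)]) (auto simp: prv.Assm)
      then have "prv T \<Gamma> (Imp (interp v a) (interp v b))" by (rule prv.ImpI)
      with y have "prv T \<Gamma> (interp v c)" by (rule prv.ImpE)
      then show ?thesis by (intro *[OF abc(3)]) auto
    qed
  qed
  show ?case
  proof (cases g)
    case (PImp a b)
    then have s: "search n (a # xs) ys b" using prems by simp
    have "prv T (insert (interp v a) \<Gamma>) (interp v b)"
      using s by (rule Suc.IH) (use hyp' assm in auto)
    then show ?thesis using PImp by (simp add: prv.ImpI)
  next
    case (PAnd a b)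
    then have "search n xs ys a" "search n xs ys b" using prems by simp_all
    then have "prv T \<Gamma> (interp v a)" "prv T \<Gamma> (interp v b)" using Suc.IH hyp by blast+
    then show ?thesis using PAnd by (simp add: prv.AndI)
  qed (use left in auto)
qed simp

text \<open>A relation rather than a function: the atoms in \<open>v\<close> are opaque terms, which
  only unification can compare. Since the connectives are listed before \<open>reifies_hd\<close>
  and \<open>reifies_tl\<close>, resolution with the introduction rules computes the propositional
  skeleton.\<close>

inductive reifies :: "fm list \<Rightarrow> pfm \<Rightarrow> fm \<Rightarrow> bool" where
  reifies_Bot: "reifies v PBot Bot"
| reifies_Imp: "reifies v a \<phi> \<Longrightarrow> reifies v b \<psi> \<Longrightarrow> reifies v (PImp a b) (Imp \<phi> \<psi>)"
| reifies_And: "reifies v a \<phi> \<Longrightarrow> reifies v b \<psi> \<Longrightarrow> reifies v (PAnd a b) (And \<phi> \<psi>)"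
| reifies_Or: "reifies v a \<phi> \<Longrightarrow> reifies v b \<psi> \<Longrightarrow> reifies v (POr a b) (Or \<phi> \<psi>)"
| reifies_hd: "reifies (\<phi> # v) (Atom 0) \<phi>"
| reifies_tl: "reifies v (Atom i) \<phi> \<Longrightarrow> reifies (\<psi> # v) (Atom (Suc i)) \<phi>"

lemma reifies_interp: "reifies v a \<phi> \<Longrightarrow> interp v a = \<phi>"
  by (induction rule: reifies.induct) simp_all

text \<open>60 is the fuel granted to \<open>search\<close>, a bound on its recursion depth;
  evaluation confirms at each use that it suffices.\<close>

lemma prop_valid: "reifies v g \<phi> \<Longrightarrow> search 60 [] [] g \<Longrightarrow> prv T \<Gamma> \<phi>"
  using search_sound[of 60 "[]" "[]" g T \<Gamma> v] by (simp add: reifies_interp)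

lemma prop_mp1: "prv T \<Gamma> \<alpha> \<Longrightarrow> reifies v g (Imp \<alpha> \<phi>) \<Longrightarrow> search 60 [] [] g \<Longrightarrow> prv T \<Gamma> \<phi>"
  by (rule prv.ImpE[OF prop_valid])

lemma prop_mp2: "prv T \<Gamma> \<alpha> \<Longrightarrow> prv T \<Gamma> \<beta> \<Longrightarrow> reifies v g (Imp \<alpha> (Imp \<beta> \<phi>)) \<Longrightarrow>
    search 60 [] [] g \<Longrightarrow> prv T \<Gamma> \<phi>"
  by (rule prv.ImpE[OF prop_mp1])

lemma prop_mp3: "prv T \<Gamma> \<alpha> \<Longrightarrow> prv T \<Gamma> \<beta> \<Longrightarrow> prv T \<Gamma> \<gamma> \<Longrightarrow>
    reifies v g (Imp \<alpha> (Imp \<beta> (Imp \<gamma> \<phi>))) \<Longrightarrow> search 60 [] [] g \<Longrightarrow> prv T \<Gamma> \<phi>"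
  by (rule prv.ImpE[OF prop_mp2])

lemma prop_mp4: "prv T \<Gamma> \<alpha> \<Longrightarrow> prv T \<Gamma> \<beta> \<Longrightarrow> prv T \<Gamma> \<gamma> \<Longrightarrow> prv T \<Gamma> \<delta> \<Longrightarrow>
    reifies v g (Imp \<alpha> (Imp \<beta> (Imp \<gamma> (Imp \<delta> \<phi>)))) \<Longrightarrow> search 60 [] [] g \<Longrightarrow> prv T \<Gamma> \<phi>"
  by (rule prv.ImpE[OF prop_mp3])

section \<open>Equality and arithmetic in HA\<close>

lemma eq_refl: "prv HA \<Gamma> (Eq t t)"
  by (simp add: prv.Axiom HA.eq_refl)

lemma eq_subst: "prv HA \<Gamma> (Eq s t) \<Longrightarrow> prv HA \<Gamma> (inst s \<phi>) \<Longrightarrow> prv HA \<Gamma> (inst t \<phi>)"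
  by (rule prv.ImpE, rule prv.ImpE[OF prv.Axiom[OF HA.eq_repl]])

abbreviation lift_tm :: "tm \<Rightarrow> tm" where
  "lift_tm \<equiv> subst_tm (\<lambda>n. Var (Suc n))"

lemma subst_tm_lift_tm [simp]: "subst_tm (case_nat s \<sigma>) (lift_tm t) = subst_tm \<sigma> t"
  by (simp add: subst_tm_comp)

lemma eq_sym: assumes "prv HA \<Gamma> (Eq s t)" shows "prv HA \<Gamma> (Eq t s)"
  using eq_subst[OF assms, of "Eq (Var 0) (lift_tm s)"] eq_refl by (simp add: inst_def)

lemma eq_trans [trans]: assumes "prv HA \<Gamma> (Eq s t)" "prv HA \<Gamma> (Eq t u)" shows "prv HA \<Gamma> (Eq s u)"
  using eq_subst[OF assms(2), of "Eq (lift_tm s) (Var 0)"] assms(1) by (simp add: inst_def)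

lemma eq_Fn_nth:
  assumes "prv HA \<Gamma> (Eq s t)"
  shows "prv HA \<Gamma> (Eq (Fn f (as @ s # bs)) (Fn f (as @ t # bs)))"
  using eq_subst[OF assms, of "Eq (Fn f (map lift_tm (as @ s # bs))) (Fn f (map lift_tm as @ Var 0 # map lift_tm bs))"]
    eq_refl by (simp add: inst_def comp_def)

lemma eq_Fn: "list_all2 (\<lambda>s t. prv HA \<Gamma> (Eq s t)) ss ts \<Longrightarrow> prv HA \<Gamma> (Eq (Fn f ss) (Fn f ts))"
proof -
  have "prv HA \<Gamma> (Eq (Fn f (as @ ss)) (Fn f (as @ ts)))"
    if "list_all2 (\<lambda>s t. prv HA \<Gamma> (Eq s t)) ss ts" for as
    using that
  proof (induction arbitrary: as rule: list_all2_induct)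
    case Nil
    then show ?case by (simp add: eq_refl)
  next
    case (Cons s ss t ts)
    have "prv HA \<Gamma> (Eq (Fn f (as @ s # ss)) (Fn f (as @ t # ss)))"
      by (rule eq_Fn_nth) (fact Cons)
    also have "prv HA \<Gamma> (Eq (Fn f (as @ t # ss)) (Fn f (as @ t # ts)))"
      using Cons.IH[of "as @ [t]"] by simp
    finally show ?case .
  qed
  from this[of "[]"] show "list_all2 (\<lambda>s t. prv HA \<Gamma> (Eq s t)) ss ts \<Longrightarrow> ?thesis" by simp
qed

lemma eq_Fn1: "prv HA \<Gamma> (Eq s s') \<Longrightarrow> prv HA \<Gamma> (Eq (Fn f [s]) (Fn f [s']))"
  by (rule eq_Fn) simp

lemma eq_Fn2: "prv HA \<Gamma> (Eq s s') \<Longrightarrow> prv HA \<Gamma> (Eq t t') \<Longrightarrow> prv HA \<Gamma> (Eq (Fn f [s, t]) (Fn f [s', t']))"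
  by (rule eq_Fn) simp

lemma eq_subst_tm:
  assumes "\<And>n. prv HA \<Gamma> (Eq (\<sigma> n) (\<tau> n))"
  shows "prv HA \<Gamma> (Eq (subst_tm \<sigma> t) (subst_tm \<tau> t))"
proof (induction t)
  case (Var n)
  then show ?case by (simp add: assms)
next
  case (Fn f ts)
  then show ?case by (auto intro!: eq_Fn simp: list_all2_conv_all_nth)
qed

lemma HA_induct:
  assumes "prv HA \<Gamma> (inst zero \<phi>)"
    and "prv HA (insert \<phi> (lift ` \<Gamma>)) (subst (case_nat (succ (Var 0)) (\<lambda>n. Var (Suc n))) \<phi>)"
  shows "prv HA \<Gamma> (All \<phi>)"
  by (rule prv.ImpE[OF prv.Axiom[OF HA.induction] prv.AndI])
     (auto intro!: prv.AllI prv.ImpI assms)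

lemma HA_induct_open:
  assumes "HA \<turnstile> inst zero \<phi>"
    and "prv HA {\<phi>} (subst (case_nat (succ (Var 0)) (\<lambda>n. Var (Suc n))) \<phi>)"
  shows "HA \<turnstile> \<phi>"
  using HA_induct[of "{}" \<phi>] assms by (simp add: provable_All_iff)

section \<open>Cantor's pairing function and its projections\<close>

definition padd :: primrec_fn where
  "padd = PRec (PProj 0) (PComp PSucc [PProj 1])"

text \<open>In \<open>PRec f g\<close> the step function receives the predecessor at position 0 and
  the previous value at position 1. Projecting to position 0 therefore gives the
  predecessor.\<close>

definition ppred :: primrec_fn where
  "ppred = PRec PZero (PProj 0)"

text \<open>Truncated subtraction with the subtrahend as first argument.\<close>

definition psub :: primrec_fn where
  "psub = PRec (PProj 0) (PComp ppred [PProj 1])"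

text \<open>Triangular numbers: antidiagonal \<open>s\<close> starts at \<open>tri s\<close> and has
  \<open>s + 1\<close> points.\<close>

definition ptri :: primrec_fn where
  "ptri = PRec PZero (PComp padd [PProj 1, PComp PSucc [PProj 0]])"

text \<open>
  The number of the antidiagonal on which Cantor's enumeration places \<open>z\<close>. If \<open>z\<close> is on diagonal \<open>s\<close>,
  then \<open>succ z - (tri s + s)\<close> is 1 if \<open>z\<close> is the last point on this diagonal, and 0 otherwise.
\<close>

definition pdiag :: primrec_fn where
  "pdiag = PRec PZero (PComp padd [PProj 1,
     PComp psub [PComp padd [PComp ptri [PProj 1], PProj 1], PComp PSucc [PProj 0]]])"

text \<open>The code of \<open>s\<close> and \<open>t\<close> is \<open>tri (s + t) + s\<close>: the
  sum names the antidiagonal and \<open>s\<close> the place on it. So the first component is the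
  distance of a code from the start of its diagonal, and the second is the remainder of the diagonal
  number.\<close>

definition ppair :: primrec_fn where
  "ppair = PComp padd [PComp ptri [padd], PProj 0]"

definition pfst :: primrec_fn where
  "pfst = PComp psub [PComp ptri [pdiag], PProj 0]"

definition psnd :: primrec_fn where
  "psnd = PComp psub [pfst, pdiag]"

abbreviation "add s t \<equiv> Fn padd [s, t]"
abbreviation "pred s \<equiv> Fn ppred [s]"
abbreviation "sub s t \<equiv> Fn psub [t, s]"
abbreviation "tri s \<equiv> Fn ptri [s]"
abbreviation "diag s \<equiv> Fn pdiag [s]"

lemma eq_Proj0: "prv HA \<Gamma> (Eq (Fn (PProj 0) (t # ts)) t)"
  using HA.def_Proj[of 0 "t # ts"] by (simp add: prv.Axiom)

lemma eq_Proj1: "prv HA \<Gamma> (Eq (Fn (PProj 1) (s # t # ts)) t)"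
  using HA.def_Proj[of 1 "s # t # ts"] by (simp add: prv.Axiom)

lemma eq_Comp1: "prv HA \<Gamma> (Eq (Fn g ts) s) \<Longrightarrow> prv HA \<Gamma> (Eq (Fn (PComp f [g]) ts) (Fn f [s]))"
  using eq_trans[OF prv.Axiom[OF HA.def_Comp[of f "[g]" ts]]] eq_Fn1 by simp

lemma eq_Comp2: "prv HA \<Gamma> (Eq (Fn g ts) s) \<Longrightarrow> prv HA \<Gamma> (Eq (Fn h ts) t) \<Longrightarrow>
    prv HA \<Gamma> (Eq (Fn (PComp f [g, h]) ts) (Fn f [s, t]))"
  using eq_trans[OF prv.Axiom[OF HA.def_Comp[of f "[g, h]" ts]]] eq_Fn2 by simp

lemmas eq_comp = eq_Proj0 eq_Proj1 eq_Comp1 eq_Comp2 eq_refl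

lemma eq_Rec_zero: "prv HA \<Gamma> (Eq (Fn f ts) t) \<Longrightarrow> prv HA \<Gamma> (Eq (Fn (PRec f g) (zero # ts)) t)"
  by (rule eq_trans[OF prv.Axiom[OF HA.def_Rec_zero]])

lemma eq_Rec_succ: "prv HA \<Gamma> (Eq (Fn g (s # Fn (PRec f g) (s # ts) # ts)) t) \<Longrightarrow>
    prv HA \<Gamma> (Eq (Fn (PRec f g) (succ s # ts)) t)"
  by (rule eq_trans[OF prv.Axiom[OF HA.def_Rec_succ]])

lemma add_zero: "prv HA \<Gamma> (Eq (add zero t) t)"
  unfolding padd_def by (intro eq_Rec_zero eq_comp)

lemma add_succ: "prv HA \<Gamma> (Eq (add (succ s) t) (succ (add s t)))"
  unfolding padd_def by (intro eq_Rec_succ eq_comp)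

lemma pred_zero: "prv HA \<Gamma> (Eq (pred zero) zero)"
  unfolding ppred_def by (intro eq_Rec_zero eq_refl)

lemma pred_succ: "prv HA \<Gamma> (Eq (pred (succ t)) t)"
  unfolding ppred_def by (intro eq_Rec_succ eq_comp)

lemma sub_zero: "prv HA \<Gamma> (Eq (sub t zero) t)"
  unfolding psub_def by (intro eq_Rec_zero eq_comp)

lemma sub_succ: "prv HA \<Gamma> (Eq (sub t (succ s)) (pred (sub t s)))"
  unfolding psub_def by (intro eq_Rec_succ eq_comp)

lemma tri_zero: "prv HA \<Gamma> (Eq (tri zero) zero)"
  unfolding ptri_def by (intro eq_Rec_zero eq_refl)

lemma tri_succ: "prv HA \<Gamma> (Eq (tri (succ s)) (add (tri s) (succ s)))"
  unfolding ptri_def by (intro eq_Rec_succ eq_comp)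

lemma diag_zero: "prv HA \<Gamma> (Eq (diag zero) zero)"
  unfolding pdiag_def by (intro eq_Rec_zero eq_refl)

lemma diag_succ:
  "prv HA \<Gamma> (Eq (diag (succ s)) (add (diag s) (sub (succ s) (add (tri (diag s)) (diag s)))))"
  unfolding pdiag_def by (intro eq_Rec_succ eq_comp)

lemma add_zero_right: "prv HA \<Gamma> (Eq (add t zero) t)"
proof -
  let ?\<phi> = "Eq (add (Var 0) zero) (Var 0)"
  have "HA \<turnstile> ?\<phi>"
  proof (rule HA_induct_open)
    show "HA \<turnstile> inst zero ?\<phi>" by (simp add: inst_def add_zero)
    have "prv HA {?\<phi>} (Eq (add (succ (Var 0)) zero) (succ (add (Var 0) zero)))" by (rule add_succ)
    also have "prv HA {?\<phi>} (Eq (succ (add (Var 0) zero)) (succ (Var 0)))"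
      by (rule eq_Fn1) (simp add: prv.Assm)
    finally show "prv HA {?\<phi>} (subst (case_nat (succ (Var 0)) (\<lambda>n. Var (Suc n))) ?\<phi>)" by simp
  qed
  from prv_subst[OF this, of \<Gamma> "\<lambda>_. t"] show ?thesis by simp
qed

lemma add_succ_right: "prv HA \<Gamma> (Eq (add s (succ t)) (succ (add s t)))"
proof -
  let ?\<phi> = "Eq (add (Var 0) (succ (Var 1))) (succ (add (Var 0) (Var 1)))"
  have "HA \<turnstile> ?\<phi>"
  proof (rule HA_induct_open)
    have "HA \<turnstile> Eq (add zero (succ (Var 0))) (succ (Var 0))" by (rule add_zero)
    also have "HA \<turnstile> Eq (succ (Var 0)) (succ (add zero (Var 0)))"
      by (rule eq_Fn1, rule eq_sym, rule add_zero)
    finally show "HA \<turnstile> inst zero ?\<phi>" by (simp add: inst_def)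
    have "prv HA {?\<phi>} (Eq (add (succ (Var 0)) (succ (Var 1))) (succ (add (Var 0) (succ (Var 1)))))"
      by (rule add_succ)
    also have "prv HA {?\<phi>} (Eq (succ (add (Var 0) (succ (Var 1)))) (succ (succ (add (Var 0) (Var 1)))))"
      by (rule eq_Fn1) (simp add: prv.Assm)
    also have "prv HA {?\<phi>} (Eq (succ (succ (add (Var 0) (Var 1)))) (succ (add (succ (Var 0)) (Var 1))))"
      by (rule eq_Fn1, rule eq_sym, rule add_succ)
    finally show "prv HA {?\<phi>} (subst (case_nat (succ (Var 0)) (\<lambda>n. Var (Suc n))) ?\<phi>)" by simp
  qed
  from prv_subst[OF this, of \<Gamma> "case_nat s (\<lambda>_. t)"] show ?thesis by simp
qed

lemma sub_succ_succ: "prv HA \<Gamma> (Eq (sub (succ s) (succ t)) (sub s t))"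
proof -
  let ?\<phi> = "Eq (sub (succ (Var 1)) (succ (Var 0))) (sub (Var 1) (Var 0))"
  have "HA \<turnstile> ?\<phi>"
  proof (rule HA_induct_open)
    have "HA \<turnstile> Eq (sub (succ (Var 0)) (succ zero)) (pred (sub (succ (Var 0)) zero))" by (rule sub_succ)
    also have "HA \<turnstile> Eq (pred (sub (succ (Var 0)) zero)) (pred (succ (Var 0)))"
      by (rule eq_Fn1, rule sub_zero)
    also have "HA \<turnstile> Eq (pred (succ (Var 0))) (Var 0)" by (rule pred_succ)
    also have "HA \<turnstile> Eq (Var 0) (sub (Var 0) zero)" by (rule eq_sym, rule sub_zero)
    finally show "HA \<turnstile> inst zero ?\<phi>" by (simp add: inst_def)
    let ?s = "Var 1" and ?t = "Var 0"
    have "prv HA {?\<phi>} (Eq (sub (succ ?s) (succ (succ ?t))) (pred (sub (succ ?s) (succ ?t))))"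
      by (rule sub_succ)
    also have "prv HA {?\<phi>} (Eq (pred (sub (succ ?s) (succ ?t))) (pred (sub ?s ?t)))"
      by (rule eq_Fn1) (simp add: prv.Assm)
    also have "prv HA {?\<phi>} (Eq (pred (sub ?s ?t)) (sub ?s (succ ?t)))"
      by (rule eq_sym, rule sub_succ)
    finally show "prv HA {?\<phi>} (subst (case_nat (succ (Var 0)) (\<lambda>n. Var (Suc n))) ?\<phi>)" by simp
  qed
  from prv_subst[OF this, of \<Gamma> "case_nat t (\<lambda>_. s)"] show ?thesis by simp
qed

lemma zero_sub: "prv HA \<Gamma> (Eq (sub zero t) zero)"
proof -
  let ?\<phi> = "Eq (sub zero (Var 0)) zero"
  have "HA \<turnstile> ?\<phi>"
  proof (rule HA_induct_open)
    show "HA \<turnstile> inst zero ?\<phi>" by (simp add: inst_def sub_zero)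
    have "prv HA {?\<phi>} (Eq (sub zero (succ (Var 0))) (pred (sub zero (Var 0))))" by (rule sub_succ)
    also have "prv HA {?\<phi>} (Eq (pred (sub zero (Var 0))) (pred zero))"
      by (rule eq_Fn1) (simp add: prv.Assm)
    also have "prv HA {?\<phi>} (Eq (pred zero) zero)" by (rule pred_zero)
    finally show "prv HA {?\<phi>} (subst (case_nat (succ (Var 0)) (\<lambda>n. Var (Suc n))) ?\<phi>)" by simp
  qed
  from prv_subst[OF this, of \<Gamma> "\<lambda>_. t"] show ?thesis by simp
qed

text \<open>Cancelling a common left summand replaces any theory of the order: with
  \<open>x \<le> m\<close> written as \<open>sub x m = 0\<close>, all that the pairing requires can
  be computed with equations.\<close>

lemma sub_add_add: "prv HA \<Gamma> (Eq (sub (add r s) (add r t)) (sub s t))"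
proof -
  let ?\<phi> = "Eq (sub (add (Var 0) (Var 1)) (add (Var 0) (Var 2))) (sub (Var 1) (Var 2))"
  have "HA \<turnstile> ?\<phi>"
  proof (rule HA_induct_open)
    show "HA \<turnstile> inst zero ?\<phi>" by (simp add: inst_def numeral_2_eq_2) (intro eq_Fn2 add_zero)
    let ?r = "Var 0" and ?s = "Var 1" and ?t = "Var 2"
    have "prv HA {?\<phi>} (Eq (sub (add (succ ?r) ?s) (add (succ ?r) ?t)) (sub (succ (add ?r ?s)) (succ (add ?r ?t))))"
      by (intro eq_Fn2 add_succ)
    also have "prv HA {?\<phi>} (Eq (sub (succ (add ?r ?s)) (succ (add ?r ?t))) (sub (add ?r ?s) (add ?r ?t)))"
      by (rule sub_succ_succ)
    also have "prv HA {?\<phi>} (Eq (sub (add ?r ?s) (add ?r ?t)) (sub ?s ?t))" by (simp add: prv.Assm)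
    finally show "prv HA {?\<phi>} (subst (case_nat (succ (Var 0)) (\<lambda>n. Var (Suc n))) ?\<phi>)"
      by (simp add: numeral_2_eq_2)
  qed
  from prv_subst[OF this, of \<Gamma> "case_nat r (case_nat s (\<lambda>_. t))"] show ?thesis
    by (simp add: numeral_2_eq_2)
qed

lemma sub_add_left: "prv HA \<Gamma> (Eq (sub (add r s) r) s)"
proof -
  have "prv HA \<Gamma> (Eq (sub (add r s) r) (sub (add r s) (add r zero)))"
    by (intro eq_Fn2 eq_refl eq_sym[OF add_zero_right])
  also have "prv HA \<Gamma> (Eq (sub (add r s) (add r zero)) (sub s zero))" by (rule sub_add_add)
  also have "prv HA \<Gamma> (Eq (sub s zero) s)" by (rule sub_zero)
  finally show ?thesis .
qed

lemma sub_add_self: "prv HA \<Gamma> (Eq (sub r (add r s)) zero)"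
proof -
  have "prv HA \<Gamma> (Eq (sub r (add r s)) (sub (add r zero) (add r s)))"
    by (intro eq_Fn2 eq_refl eq_sym[OF add_zero_right])
  also have "prv HA \<Gamma> (Eq (sub (add r zero) (add r s)) (sub zero s))" by (rule sub_add_add)
  also have "prv HA \<Gamma> (Eq (sub zero s) zero)" by (rule zero_sub)
  finally show ?thesis .
qed

lemma sub_self: "prv HA \<Gamma> (Eq (sub r r) zero)"
proof -
  have "prv HA \<Gamma> (Eq (sub r r) (sub r (add r zero)))"
    by (intro eq_Fn2 eq_refl eq_sym[OF add_zero_right])
  also have "prv HA \<Gamma> (Eq (sub r (add r zero)) zero)" by (rule sub_add_self)
  finally show ?thesis .
qed

text \<open>After cancelling \<open>tri m\<close> the increment is \<open>succ x - m\<close>. It is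
  0 as long as the next point is still on diagonal \<open>m\<close>, and 1 if \<open>x\<close> is
  the last place \<open>m\<close>.\<close>

lemma diag_step:
  assumes "prv HA \<Gamma> (Eq (diag (add (tri m) x)) m)"
  shows "prv HA \<Gamma> (Eq (diag (add (tri m) (succ x))) (add m (sub (succ x) m)))"
proof -
  let ?z = "add (tri m) x"
  have "prv HA \<Gamma> (Eq (diag (add (tri m) (succ x))) (diag (succ ?z)))"
    by (intro eq_Fn1 add_succ_right)
  also have "prv HA \<Gamma> (Eq (diag (succ ?z)) (add (diag ?z) (sub (succ ?z) (add (tri (diag ?z)) (diag ?z)))))"
    by (rule diag_succ)
  also have "prv HA \<Gamma> (Eq (add (diag ?z) (sub (succ ?z) (add (tri (diag ?z)) (diag ?z))))
      (add m (sub (add (tri m) (succ x)) (add (tri m) m))))"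
    by (intro eq_Fn2 eq_Fn1 assms eq_sym[OF add_succ_right])
  also have "prv HA \<Gamma> (Eq (add m (sub (add (tri m) (succ x)) (add (tri m) m))) (add m (sub (succ x) m)))"
    by (intro eq_Fn2 eq_refl sub_add_add)
  finally show ?thesis .
qed

text \<open>Induction on the place \<open>x\<close>. The bound \<open>x \<le> m\<close> is an
  antecedent of the induction formula, because it has to be passed down from \<open>succ x\<close>
  to \<open>x\<close>.\<close>

lemma diag_within:
  assumes "prv HA \<Gamma> (Eq (diag (tri m)) m)" "prv HA \<Gamma> (Eq (sub x m) zero)"
  shows "prv HA \<Gamma> (Eq (diag (add (tri m) x)) m)"
proof -
  let ?m = "lift_tm m" and ?x = "Var 0"
  let ?\<phi> = "Imp (Eq (sub ?x ?m) zero) (Eq (diag (add (tri ?m) ?x)) ?m)"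
  have "prv HA \<Gamma> (All ?\<phi>)"
  proof (rule HA_induct)
    have "prv HA \<Gamma> (Eq (diag (add (tri m) zero)) (diag (tri m)))"
      by (intro eq_Fn1 add_zero_right)
    then have "prv HA \<Gamma> (Eq (diag (add (tri m) zero)) m)" using assms(1) by (rule eq_trans)
    then have "prv HA \<Gamma> (Imp (Eq (sub zero m) zero) (Eq (diag (add (tri m) zero)) m))"
      by (intro prv.ImpI) (erule prv_weaken, auto)
    then show "prv HA \<Gamma> (inst zero ?\<phi>)" by (simp add: inst_def)
    let ?\<psi> = "Eq (sub (succ ?x) ?m) zero"
    let ?\<Delta> = "insert ?\<psi> (insert ?\<phi> (lift ` \<Gamma>))"
    have \<psi>: "prv HA ?\<Delta> (Eq (sub (succ ?x) ?m) zero)" by (simp add: prv.Assm)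
    \<comment> \<open>\<open>x - m\<close> is the predecessor of \<open>succ x - m\<close>, which is
      0 by assumption; so the induction hypothesis applies to \<open>x\<close>.\<close>
    have "prv HA ?\<Delta> (Eq (sub ?x ?m) (sub (succ ?x) (succ ?m)))"
      by (rule eq_sym[OF sub_succ_succ])
    also have "prv HA ?\<Delta> (Eq (sub (succ ?x) (succ ?m)) (pred (sub (succ ?x) ?m)))"
      by (rule sub_succ)
    also have "prv HA ?\<Delta> (Eq (pred (sub (succ ?x) ?m)) (pred zero))" by (rule eq_Fn1) fact
    also have "prv HA ?\<Delta> (Eq (pred zero) zero)" by (rule pred_zero)
    finally have "prv HA ?\<Delta> (Eq (sub ?x ?m) zero)" .
    moreover have "prv HA ?\<Delta> ?\<phi>" by (rule prv.Assm) simp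
    ultimately have IH: "prv HA ?\<Delta> (Eq (diag (add (tri ?m) ?x)) ?m)" by (rule prv.ImpE[rotated])
    then have "prv HA ?\<Delta> (Eq (diag (add (tri ?m) (succ ?x))) (add ?m (sub (succ ?x) ?m)))"
      by (rule diag_step)
    also have "prv HA ?\<Delta> (Eq (add ?m (sub (succ ?x) ?m)) (add ?m zero))"
      by (intro eq_Fn2 eq_refl \<psi>)
    also have "prv HA ?\<Delta> (Eq (add ?m zero) ?m)" by (rule add_zero_right)
    finally show "prv HA (insert ?\<phi> (lift ` \<Gamma>)) (subst (case_nat (succ (Var 0)) (\<lambda>n. Var (Suc n))) ?\<phi>)"
      by (simp add: prv.ImpI)
  qed
  from prv.AllE[OF this, of x] assms(2) show ?thesis by (auto simp: inst_def intro: prv.ImpE)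
qed

text \<open>The walk along diagonal \<open>m\<close> ends at \<open>tri m + m\<close>. The next
  number is \<open>tri (succ m)\<close>, where the diagonal number has to jump.\<close>

lemma diag_tri: "prv HA \<Gamma> (Eq (diag (tri t)) t)"
proof -
  let ?m = "Var 0"
  let ?\<phi> = "Eq (diag (tri ?m)) ?m"
  have "HA \<turnstile> ?\<phi>"
  proof (rule HA_induct_open)
    have "HA \<turnstile> Eq (diag (tri zero)) (diag zero)" by (intro eq_Fn1 tri_zero)
    also have "HA \<turnstile> Eq (diag zero) zero" by (rule diag_zero)
    finally show "HA \<turnstile> inst zero ?\<phi>" by (simp add: inst_def)
    have one: "prv HA {?\<phi>} (Eq (add ?m (succ zero)) (succ ?m))"
      by (rule eq_trans[OF add_succ_right]) (intro eq_Fn1 add_zero_right)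
    have last: "prv HA {?\<phi>} (Eq (diag (add (tri ?m) ?m)) ?m)"
      by (rule diag_within) (simp_all add: prv.Assm sub_self)
    have "prv HA {?\<phi>} (Eq (diag (tri (succ ?m))) (diag (add (tri ?m) (succ ?m))))"
      by (intro eq_Fn1 tri_succ)
    also have "prv HA {?\<phi>} (Eq (diag (add (tri ?m) (succ ?m))) (add ?m (sub (succ ?m) ?m)))"
      by (rule diag_step[OF last])
    \<comment> \<open>Writing \<open>succ m\<close> as \<open>m + 1\<close> lets the cancellation
      law evaluate \<open>succ m - m\<close> to 1.\<close>
    also have "prv HA {?\<phi>} (Eq (add ?m (sub (succ ?m) ?m)) (add ?m (sub (add ?m (succ zero)) ?m)))"
      by (intro eq_Fn2 eq_refl eq_sym[OF one])
    also have "prv HA {?\<phi>} (Eq (add ?m (sub (add ?m (succ zero)) ?m)) (add ?m (succ zero)))"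
      by (intro eq_Fn2 eq_refl sub_add_left)
    also have "prv HA {?\<phi>} (Eq (add ?m (succ zero)) (succ ?m))" by (rule one)
    finally show "prv HA {?\<phi>} (subst (case_nat (succ (Var 0)) (\<lambda>n. Var (Suc n))) ?\<phi>)" by simp
  qed
  from prv_subst[OF this, of \<Gamma> "\<lambda>_. t"] show ?thesis by simp
qed

lemma diag_pair: "prv HA \<Gamma> (Eq (diag (Fn ppair [s, t])) (add s t))"
proof -
  have "prv HA \<Gamma> (Eq (diag (Fn ppair [s, t])) (diag (add (tri (add s t)) s)))"
    unfolding ppair_def by (intro eq_Fn1 eq_comp)
  also have "prv HA \<Gamma> (Eq (diag (add (tri (add s t)) s)) (add s t))"
    by (intro diag_within diag_tri sub_add_self)
  finally show ?thesis .
qed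

lemma fst_pair: "prv HA \<Gamma> (Eq (Fn pfst [Fn ppair [s, t]]) s)"
proof -
  let ?z = "Fn ppair [s, t]"
  have "prv HA \<Gamma> (Eq (Fn pfst [?z]) (sub ?z (tri (diag ?z))))"
    unfolding pfst_def by (intro eq_comp)
  also have "prv HA \<Gamma> (Eq (sub ?z (tri (diag ?z))) (sub (add (tri (add s t)) s) (tri (add s t))))"
    by (intro eq_Fn2 eq_Fn1 diag_pair) (simp only: ppair_def, intro eq_comp)
  also have "prv HA \<Gamma> (Eq (sub (add (tri (add s t)) s) (tri (add s t))) s)" by (rule sub_add_left)
  finally show ?thesis .
qed

lemma snd_pair: "prv HA \<Gamma> (Eq (Fn psnd [Fn ppair [s, t]]) t)"
proof -
  let ?z = "Fn ppair [s, t]"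
  have "prv HA \<Gamma> (Eq (Fn psnd [?z]) (sub (diag ?z) (Fn pfst [?z])))"
    unfolding psnd_def by (intro eq_comp)
  also have "prv HA \<Gamma> (Eq (sub (diag ?z) (Fn pfst [?z])) (sub (add s t) s))"
    by (intro eq_Fn2 diag_pair fst_pair)
  also have "prv HA \<Gamma> (Eq (sub (add s t) s) t)" by (rule sub_add_left)
  finally show ?thesis .
qed

section \<open>Codes for tuples of variables\<close>

fun proj :: "nat \<Rightarrow> tm \<Rightarrow> tm" where
  "proj 0 t = Fn pfst [t]"
| "proj (Suc i) t = proj i (Fn psnd [t])"

text \<open>Pairs nested to the right and closed by \<open>zero\<close>, so that component
  \<open>j\<close> is reached by \<open>j\<close> second projections and one first
  projection.\<close>

fun tuple :: "nat \<Rightarrow> nat \<Rightarrow> tm" where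
  "tuple i 0 = zero"
| "tuple i (Suc n) = Fn ppair [Var i, tuple (Suc i) n]"

lemma eq_proj: "prv HA \<Gamma> (Eq s t) \<Longrightarrow> prv HA \<Gamma> (Eq (proj i s) (proj i t))"
  by (induction i arbitrary: s t) (simp_all add: eq_Fn1)

lemma proj_tuple: "j < n \<Longrightarrow> prv HA \<Gamma> (Eq (proj j (tuple i n)) (Var (i + j)))"
proof (induction n arbitrary: i j)
  case (Suc n)
  show ?case
  proof (cases j)
    case 0
    then show ?thesis by (simp add: fst_pair)
  next
    case j: (Suc j')
    have "prv HA \<Gamma> (Eq (proj j' (Fn psnd [tuple i (Suc n)])) (proj j' (tuple (Suc i) n)))"
      by (rule eq_proj) (simp add: snd_pair)
    also have "prv HA \<Gamma> (Eq (proj j' (tuple (Suc i) n)) (Var (Suc i + j')))"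
      by (rule Suc.IH) (use Suc.prems j in simp)
    finally show ?thesis by (simp add: j)
  qed
qed simp

lemma subst_tm_proj: "subst_tm \<sigma> (proj i t) = proj i (subst_tm \<sigma> t)"
  by (induction i arbitrary: t) simp_all

lemma fv_proj: "fv_tm (proj i t) = fv_tm t"
  by (induction i arbitrary: t) simp_all

text \<open>Induction on \<open>x\<close> with \<open>y\<close> quantified universally, since the
  case of two successors refers to both predecessors. The inner inductions on \<open>y\<close>
  distinguish whether \<open>y\<close> is zero. All decidability of quantifier-free formulas rests
  on this.\<close>

lemma eq_decidable: "prv HA \<Gamma> (Or (Eq s t) (Neg (Eq s t)))"
proof -
  let ?x = "Var 1" and ?y = "Var 0"
  let ?D = "\<lambda>s t. Or (Eq s t) (Neg (Eq s t))"
  have nonzero: "prv HA \<Gamma> (Neg (Eq (succ t) zero))" for \<Gamma> t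
    by (rule prv.Axiom) (rule HA.succ_nonzero)
  have "HA \<turnstile> All (?D ?x ?y)"
  proof (rule HA_induct_open)
    have "HA \<turnstile> All (?D zero ?y)"
    proof (rule HA_induct)
      show "HA \<turnstile> inst zero (?D zero ?y)" by (simp add: inst_def prv.OrI1 eq_refl)
      let ?\<Gamma> = "insert (?D zero ?y) (lift ` {})"
      have "prv HA (insert (Eq zero (succ ?y)) ?\<Gamma>) Bot"
        by (rule prv.ImpE[OF nonzero[of _ "Var 0"] eq_sym]) (simp add: prv.Assm)
      then show "prv HA ?\<Gamma> (subst (case_nat (succ (Var 0)) (\<lambda>n. Var (Suc n))) (?D zero ?y))"
        by (simp add: prv.OrI2 prv.ImpI)
    qed
    then show "HA \<turnstile> inst zero (All (?D ?x ?y))" by (simp add: inst_def)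
    let ?\<Gamma> = "{All (?D ?x ?y)}"
    have "prv HA ?\<Gamma> (All (?D (succ ?x) ?y))"
    proof (rule HA_induct)
      show "prv HA ?\<Gamma> (inst zero (?D (succ ?x) ?y))" by (simp add: inst_def prv.OrI2 nonzero)
      let ?\<Delta> = "insert (?D (succ ?x) ?y) (lift ` ?\<Gamma>)"
      have "prv HA ?\<Delta> (?D ?x ?y)" by (rule prv_lift_All) (simp add: prv.Assm)
      moreover have "prv HA (insert (Eq ?x ?y) ?\<Delta>) (?D (succ ?x) (succ ?y))"
        by (intro prv.OrI1 eq_Fn1) (simp add: prv.Assm)
      moreover have "prv HA (insert (Neg (Eq ?x ?y)) ?\<Delta>) (?D (succ ?x) (succ ?y))"
      proof (rule prv.OrI2, rule prv.ImpI)
        let ?E = "insert (Eq (succ ?x) (succ ?y)) (insert (Neg (Eq ?x ?y)) ?\<Delta>)"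
        have "prv HA ?E (Eq ?x ?y)"
          by (rule prv.ImpE[OF prv.Axiom[OF HA.succ_inj]]) (simp add: prv.Assm)
        moreover have "prv HA ?E (Neg (Eq ?x ?y))" by (simp add: prv.Assm)
        ultimately show "prv HA ?E Bot" by (rule prv.ImpE[rotated])
      qed
      ultimately have "prv HA ?\<Delta> (?D (succ ?x) (succ ?y))" by (rule prv.OrE)
      then show "prv HA ?\<Delta> (subst (case_nat (succ (Var 0)) (\<lambda>n. Var (Suc n))) (?D (succ ?x) ?y))"
        by simp
    qed
    then show "prv HA ?\<Gamma> (subst (case_nat (succ (Var 0)) (\<lambda>n. Var (Suc n))) (All (?D ?x ?y)))"
      by simp
  qed
  then have "HA \<turnstile> ?D ?x ?y" by (simp add: provable_All_iff)
  from prv_subst[OF this, of \<Gamma> "case_nat t (\<lambda>_. s)"] show ?thesis by simp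
qed

section \<open>Intuitionistic equivalences\<close>

lemma Imp_trans: "prv T \<Gamma> (Imp \<phi> \<psi>) \<Longrightarrow> prv T \<Gamma> (Imp \<psi> \<chi>) \<Longrightarrow> prv T \<Gamma> (Imp \<phi> \<chi>)"
  by (rule prop_mp2[where v = "[\<phi>, \<psi>, \<chi>]"], assumption+, (rule reifies.intros)+, code_simp)

lemma Iff_refl: "prv T \<Gamma> (Iff \<phi> \<phi>)"
  by (rule prop_valid[where v = "[\<phi>]"], (rule reifies.intros)+, code_simp)

lemma Iff_trans: "prv T \<Gamma> (Iff \<phi> \<psi>) \<Longrightarrow> prv T \<Gamma> (Iff \<psi> \<chi>) \<Longrightarrow> prv T \<Gamma> (Iff \<phi> \<chi>)"
  by (rule prop_mp2[where v = "[\<phi>, \<psi>, \<chi>]"], assumption+, (rule reifies.intros)+, code_simp)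

lemma Imp_cong: "prv T \<Gamma> (Iff \<phi> \<phi>') \<Longrightarrow> prv T \<Gamma> (Iff \<psi> \<psi>') \<Longrightarrow> prv T \<Gamma> (Iff (Imp \<phi> \<psi>) (Imp \<phi>' \<psi>'))"
  by (rule prop_mp2[where v = "[\<phi>, \<phi>', \<psi>, \<psi>']"], assumption+, (rule reifies.intros)+, code_simp)

lemma And_cong: "prv T \<Gamma> (Iff \<phi> \<phi>') \<Longrightarrow> prv T \<Gamma> (Iff \<psi> \<psi>') \<Longrightarrow> prv T \<Gamma> (Iff (And \<phi> \<psi>) (And \<phi>' \<psi>'))"
  by (rule prop_mp2[where v = "[\<phi>, \<phi>', \<psi>, \<psi>']"], assumption+, (rule reifies.intros)+, code_simp)

lemma Or_cong: "prv T \<Gamma> (Iff \<phi> \<phi>') \<Longrightarrow> prv T \<Gamma> (Iff \<psi> \<psi>') \<Longrightarrow> prv T \<Gamma> (Iff (Or \<phi> \<psi>) (Or \<phi>' \<psi>'))"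
  by (rule prop_mp2[where v = "[\<phi>, \<phi>', \<psi>, \<psi>']"], assumption+, (rule reifies.intros)+, code_simp)

lemma All_mono: "T \<turnstile> Imp \<phi> \<psi> \<Longrightarrow> T \<turnstile> Imp (All \<phi>) (All \<psi>)"
  by (rule Imp_AllI) (rule Imp_trans[OF All_elim])

lemma Ex_mono: "T \<turnstile> Imp \<phi> \<psi> \<Longrightarrow> T \<turnstile> Imp (Ex \<phi>) (Ex \<psi>)"
  by (rule Imp_ExE) (rule Imp_trans[OF _ Ex_intro])

lemma All_cong: "T \<turnstile> Iff \<phi> \<psi> \<Longrightarrow> T \<turnstile> Iff (All \<phi>) (All \<psi>)"
  by (blast intro: prv.AndI All_mono dest: prv.AndE1 prv.AndE2)

lemma Ex_cong: "T \<turnstile> Iff \<phi> \<psi> \<Longrightarrow> T \<turnstile> Iff (Ex \<phi>) (Ex \<psi>)"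
  by (blast intro: prv.AndI Ex_mono dest: prv.AndE1 prv.AndE2)

lemma Neg_Ex: "T \<turnstile> Iff (Neg (Ex \<phi>)) (All (Neg \<phi>))"
proof (rule prv.AndI)
  show "T \<turnstile> Imp (Neg (Ex \<phi>)) (All (Neg \<phi>))"
    by (rule Imp_AllI, rule prop_mp1[where v = "[\<phi>, lift (Ex \<phi>)]", OF Ex_intro[of T "\<phi>"]],
        unfold lift_simps, (rule reifies.intros)+, code_simp)
  have "T \<turnstile> Imp (Ex \<phi>) (Neg (All (Neg \<phi>)))"
    by (rule Imp_ExE, rule prop_mp1[where v = "[\<phi>, lift (All (Neg \<phi>))]", OF All_elim[of T "Neg \<phi>"]],
        unfold lift_simps, (rule reifies.intros)+, code_simp)
  then show "T \<turnstile> Imp (All (Neg \<phi>)) (Neg (Ex \<phi>))"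
    by - (rule prop_mp1[where v = "[Ex \<phi>, All (Neg \<phi>)]"], assumption+, (rule reifies.intros)+, code_simp)
qed

text \<open>This half is intuitionistic. The converse is what decidability, or stability together
  with the double negation shift, will supply.\<close>

lemma Ex_Neg: "T \<turnstile> Imp (Ex (Neg \<phi>)) (Neg (All \<phi>))"
  by (rule Imp_ExE, rule prop_mp1[where v = "[\<phi>, lift (All \<phi>)]", OF All_elim[of T "\<phi>"]],
      unfold lift_simps, (rule reifies.intros)+, code_simp)

lemma Ex_And_left: "T \<turnstile> Iff (And (Ex \<phi>) \<psi>) (Ex (And \<phi> (lift \<psi>)))"
proof (rule prv.AndI)
  have "T \<turnstile> Imp (Ex \<phi>) (Imp \<psi> (Ex (And \<phi> (lift \<psi>))))"
    by (rule Imp_ExE, rule prop_mp1[where v = "[\<phi>, lift \<psi>, lift (Ex (And \<phi> (lift \<psi>)))]", OF Ex_intro[of T "And \<phi> (lift \<psi>)"]],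
      unfold lift_simps, (rule reifies.intros)+, code_simp)
  then show "T \<turnstile> Imp (And (Ex \<phi>) \<psi>) (Ex (And \<phi> (lift \<psi>)))"
    by - (rule prop_mp1[where v = "[Ex \<phi>, \<psi>, Ex (And \<phi> (lift \<psi>))]"], assumption+, (rule reifies.intros)+, code_simp)
  show "T \<turnstile> Imp (Ex (And \<phi> (lift \<psi>))) (And (Ex \<phi>) \<psi>)"
    by (rule Imp_ExE, rule prop_mp1[where v = "[\<phi>, lift \<psi>, lift (Ex \<phi>)]", OF Ex_intro[of T "\<phi>"]],
      unfold lift_simps, (rule reifies.intros)+, code_simp)
qed

lemma Ex_Or_left: "T \<turnstile> Iff (Or (Ex \<phi>) \<psi>) (Ex (Or \<phi> (lift \<psi>)))"
proof (rule prv.AndI)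
  have "T \<turnstile> Imp (Ex \<phi>) (Ex (Or \<phi> (lift \<psi>)))"
    by (rule Ex_mono, rule prop_valid[where v = "[\<phi>, lift \<psi>]"], (rule reifies.intros)+, code_simp)
  moreover have "T \<turnstile> Imp \<psi> (Ex (Or \<phi> (lift \<psi>)))"
  proof (rule prv.ImpI, rule prv.ExI)
    \<comment> \<open>Any witness would do, as the bound variable does not occur in
      \<open>lift \<psi>\<close>; \<open>zero\<close> shows that the domain is inhabited.\<close>
    show "prv T {\<psi>} (inst zero (Or \<phi> (lift \<psi>)))"
      using inst_lift[of zero \<psi>] by (simp add: inst_def prv.OrI2 prv.Assm)
  qed
  ultimately show "T \<turnstile> Imp (Or (Ex \<phi>) \<psi>) (Ex (Or \<phi> (lift \<psi>)))"
    by - (rule prop_mp2[where v = "[Ex \<phi>, \<psi>, Ex (Or \<phi> (lift \<psi>))]"], assumption+, (rule reifies.intros)+, code_simp)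
  show "T \<turnstile> Imp (Ex (Or \<phi> (lift \<psi>))) (Or (Ex \<phi>) \<psi>)"
    by (rule Imp_ExE, rule prop_mp1[where v = "[\<phi>, lift \<psi>, lift (Ex \<phi>)]", OF Ex_intro[of T "\<phi>"]],
      unfold lift_simps, (rule reifies.intros)+, code_simp)
qed

lemma All_And_left: "T \<turnstile> Iff (And (All \<phi>) \<psi>) (All (And \<phi> (lift \<psi>)))"
proof (rule prv.AndI)
  show "T \<turnstile> Imp (And (All \<phi>) \<psi>) (All (And \<phi> (lift \<psi>)))"
    by (rule Imp_AllI, rule prop_mp1[where v = "[\<phi>, lift \<psi>, lift (All \<phi>)]", OF All_elim[of T "\<phi>"]],
      unfold lift_simps, (rule reifies.intros)+, code_simp)
  have "T \<turnstile> Imp (All (And \<phi> (lift \<psi>))) (All \<phi>)"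
    by (rule All_mono, rule prop_valid[where v = "[\<phi>, lift \<psi>]"], (rule reifies.intros)+, code_simp)
  moreover have "T \<turnstile> Imp (All (And \<phi> (lift \<psi>))) \<psi>"
  proof (rule prv.ImpI)
    have "prv T {All (And \<phi> (lift \<psi>))} (inst zero (And \<phi> (lift \<psi>)))"
      by (rule prv.AllE) (simp add: prv.Assm)
    then show "prv T {All (And \<phi> (lift \<psi>))} \<psi>"
      using inst_lift[of zero \<psi>] by (auto simp: inst_def intro: prv.AndE2)
  qed
  ultimately show "T \<turnstile> Imp (All (And \<phi> (lift \<psi>))) (And (All \<phi>) \<psi>)"
    by - (rule prop_mp2[where v = "[All \<phi>, \<psi>, All (And \<phi> (lift \<psi>))]"], assumption+, (rule reifies.intros)+, code_simp)
qed

text \<open>The direction from right to left is not intuitionistic. Deciding \<psi> settles it: if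
  \<psi> fails, every instance of the disjunction gives \<phi>.\<close>

lemma All_Or_left:
  assumes "T \<turnstile> Or \<psi> (Neg \<psi>)"
  shows "T \<turnstile> Iff (Or (All \<phi>) \<psi>) (All (Or \<phi> (lift \<psi>)))"
proof (rule prv.AndI)
  show "T \<turnstile> Imp (Or (All \<phi>) \<psi>) (All (Or \<phi> (lift \<psi>)))"
    by (rule Imp_AllI, rule prop_mp1[where v = "[\<phi>, lift \<psi>, lift (All \<phi>)]", OF All_elim[of T "\<phi>"]],
      unfold lift_simps, (rule reifies.intros)+, code_simp)
  have "T \<turnstile> Imp (And (All (Or \<phi> (lift \<psi>))) (Neg \<psi>)) (All \<phi>)"
    by (rule Imp_AllI, rule prop_mp1[where v = "[\<phi>, lift \<psi>, lift (All (Or \<phi> (lift \<psi>)))]", OF All_elim[of T "Or \<phi> (lift \<psi>)"]],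
      unfold lift_simps, (rule reifies.intros)+, code_simp)
  with assms show "T \<turnstile> Imp (All (Or \<phi> (lift \<psi>))) (Or (All \<phi>) \<psi>)"
    by - (rule prop_mp2[where v = "[All \<phi>, \<psi>, All (Or \<phi> (lift \<psi>))]"], assumption+, (rule reifies.intros)+, code_simp)
qed

lemma And_commute: "prv T \<Gamma> (Iff (And \<phi> \<psi>) (And \<psi> \<phi>))"
  by (rule prop_valid[where v = "[\<phi>, \<psi>]"], (rule reifies.intros)+, code_simp)

lemma Or_commute: "prv T \<Gamma> (Iff (Or \<phi> \<psi>) (Or \<psi> \<phi>))"
  by (rule prop_valid[where v = "[\<phi>, \<psi>]"], (rule reifies.intros)+, code_simp)

section \<open>Replacing parameters by a single one\<close>

text \<open>The axioms of HA are only required to be provable in \<open>T\<close>, because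
  \<open>in_between\<close> compares theorems and says nothing about axioms.\<close>

locale HA_extension =
  fixes T :: "fm set"
  assumes HA_axiom: "\<phi> \<in> HA \<Longrightarrow> T \<turnstile> \<phi>"
begin

lemma from_HA: "prv HA \<Gamma> \<phi> \<Longrightarrow> prv T \<Gamma> \<phi>"
  by (rule prv_theory_mono[OF HA_axiom])

end

text \<open>The equations are provable outright and not just under assumptions, so they may be
  shifted below quantifiers.\<close>

lemma HA_Iff_subst:
  "(\<And>n. HA \<turnstile> Eq (\<sigma> n) (\<tau> n)) \<Longrightarrow> HA \<turnstile> Iff (subst \<sigma> \<phi>) (subst \<tau> \<phi>)"
proof (induction \<phi> arbitrary: \<sigma> \<tau>)
  case (Eq s t)
  have s: "prv HA \<Gamma> (Eq (subst_tm \<sigma> s) (subst_tm \<tau> s))" for \<Gamma> s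
    by (rule eq_subst_tm) (rule prv_weaken[OF Eq], simp)
  show ?case
  proof (rule prv.AndI; simp; rule prv.ImpI)
    let ?G = "{Eq (subst_tm \<sigma> s) (subst_tm \<sigma> t)}"
    have "prv HA ?G (Eq (subst_tm \<sigma> s) (subst_tm \<sigma> t))" by (simp add: prv.Assm)
    then show "prv HA ?G (Eq (subst_tm \<tau> s) (subst_tm \<tau> t))"
      using s eq_sym eq_trans by meson
  next
    let ?G = "{Eq (subst_tm \<tau> s) (subst_tm \<tau> t)}"
    have "prv HA ?G (Eq (subst_tm \<tau> s) (subst_tm \<tau> t))" by (simp add: prv.Assm)
    then show "prv HA ?G (Eq (subst_tm \<sigma> s) (subst_tm \<sigma> t))"
      using s eq_sym eq_trans by meson
  qed
next
  case (All \<phi>)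
  have "HA \<turnstile> Eq (up \<sigma> n) (up \<tau> n)" for n
    using prv_lift[OF All.prems, of "n - 1"] by (cases n) (simp_all add: lift_def eq_refl)
  then show ?case by (simp add: All_cong All.IH)
next
  case (Ex \<phi>)
  have "HA \<turnstile> Eq (up \<sigma> n) (up \<tau> n)" for n
    using prv_lift[OF Ex.prems, of "n - 1"] by (cases n) (simp_all add: lift_def eq_refl)
  then show ?case by (simp add: Ex_cong Ex.IH)
qed (simp_all add: Imp_cong And_cong Or_cong Iff_refl)

text \<open>The contracted formula has a single free variable and is thus within reach of the
  schemata. Replacing this variable by a code of all variables of \<phi> and evaluating the
  projections gives \<phi> back.\<close>

lemma (in HA_extension) provable_if_contracted:
  assumes "T \<turnstile> subst (\<lambda>i. proj i (Var 0)) \<phi>"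
  shows "T \<turnstile> \<phi>"
proof -
  obtain n where n: "fv \<phi> \<subseteq> {..<n}" by (rule fv_bounded)
  \<comment> \<open>Variables from \<open>n\<close> on do not occur in \<phi>. Leaving them alone
    makes the substitution provably equal to \<open>Var\<close> at every index.\<close>
  let ?\<sigma> = "\<lambda>i. if i < n then proj i (tuple 0 n) else Var i"
  have "subst (\<lambda>_. tuple 0 n) (subst (\<lambda>i. proj i (Var 0)) \<phi>) = subst ?\<sigma> \<phi>"
    using n by (auto simp: subst_comp subst_tm_proj intro!: subst_cong)
  then have "T \<turnstile> subst ?\<sigma> \<phi>" using prv_subst[OF assms, of "{}" "\<lambda>_. tuple 0 n"] by simp
  moreover have "HA \<turnstile> Iff (subst ?\<sigma> \<phi>) (subst Var \<phi>)"
    by (rule HA_Iff_subst) (use proj_tuple[of _ n "{}" 0] in \<open>auto simp: eq_refl\<close>)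
  ultimately show ?thesis
    using from_HA by (metis subst_Var prv.AndE1 prv.ImpE)
qed

section \<open>Prenex classes up to provable equivalence\<close>

lemma Sigma_Pi_cumulative:
  "Sigma_fm k \<subseteq> Sigma_fm (Suc k) \<and> Pi_fm k \<subseteq> Pi_fm (Suc k)"
  "Pi_fm k \<subseteq> Sigma_fm (Suc k)"
  "Sigma_fm k \<subseteq> Pi_fm (Suc k)"
proof -
  show 1: "Pi_fm k \<subseteq> Sigma_fm (Suc k)" "Sigma_fm k \<subseteq> Pi_fm (Suc k)" for k
    by (auto intro: exI[of _ 0])
  show "Sigma_fm k \<subseteq> Sigma_fm (Suc k) \<and> Pi_fm k \<subseteq> Pi_fm (Suc k)"
  proof (induction k)
    case 0
    show ?case using 1[of 0] by simp
  next
    case (Suc k)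
    then show ?case
      unfolding Sigma_fm.simps(2)[of k] Sigma_fm.simps(2)[of "Suc k"]
        Pi_fm.simps(2)[of k] Pi_fm.simps(2)[of "Suc k"] by blast
  qed
qed

lemma Sigma_mono: "j \<le> k \<Longrightarrow> Sigma_fm j \<subseteq> Sigma_fm k"
  by (rule lift_Suc_mono_le[of Sigma_fm]) (use Sigma_Pi_cumulative in auto)

lemma Pi_mono: "j \<le> k \<Longrightarrow> Pi_fm j \<subseteq> Pi_fm k"
  by (rule lift_Suc_mono_le[of Pi_fm]) (use Sigma_Pi_cumulative in auto)

lemma Ex_Sigma: "\<phi> \<in> Sigma_fm (Suc k) \<Longrightarrow> Ex \<phi> \<in> Sigma_fm (Suc k)"
  by (auto simp del: funpow.simps) (metis funpow.simps(2) comp_apply)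

lemma All_Pi: "\<phi> \<in> Pi_fm (Suc k) \<Longrightarrow> All \<phi> \<in> Pi_fm (Suc k)"
  by (auto simp del: funpow.simps) (metis funpow.simps(2) comp_apply)

text \<open>Because blocks may be empty, the class is the closure of \<open>Pi_fm k\<close> under
  \<open>Ex\<close>. This rule adds one quantifier at a time and so avoids counting the length of
  the block.\<close>

lemma Sigma_Suc_induct [consumes 1, case_names Pi Ex]:
  assumes "\<phi> \<in> Sigma_fm (Suc k)"
    and "\<And>\<phi>. \<phi> \<in> Pi_fm k \<Longrightarrow> P \<phi>"
    and "\<And>\<phi>. \<phi> \<in> Sigma_fm (Suc k) \<Longrightarrow> P \<phi> \<Longrightarrow> P (Ex \<phi>)"
  shows "P \<phi>"
proof -
  obtain n \<psi> where \<phi>: "\<phi> = (Ex ^^ n) \<psi>" "\<psi> \<in> Pi_fm k" using assms(1) by auto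
  have "P ((Ex ^^ n) \<psi>)"
  proof (induction n)
    case 0
    show ?case using \<phi>(2) assms(2) by simp
  next
    case (Suc n)
    have "(Ex ^^ n) \<psi> \<in> Sigma_fm (Suc k)" using \<phi>(2) by auto
    from assms(3)[OF this Suc] show ?case by simp
  qed
  then show ?thesis using \<phi>(1) by simp
qed

lemma Pi_Suc_induct [consumes 1, case_names Sigma All]:
  assumes "\<phi> \<in> Pi_fm (Suc k)"
    and "\<And>\<phi>. \<phi> \<in> Sigma_fm k \<Longrightarrow> P \<phi>"
    and "\<And>\<phi>. \<phi> \<in> Pi_fm (Suc k) \<Longrightarrow> P \<phi> \<Longrightarrow> P (All \<phi>)"
  shows "P \<phi>"
proof -
  obtain n \<psi> where \<phi>: "\<phi> = (All ^^ n) \<psi>" "\<psi> \<in> Sigma_fm k" using assms(1) by auto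
  have "P ((All ^^ n) \<psi>)"
  proof (induction n)
    case 0
    show ?case using \<phi>(2) assms(2) by simp
  next
    case (Suc n)
    have "(All ^^ n) \<psi> \<in> Pi_fm (Suc k)" using \<phi>(2) by auto
    from assms(3)[OF this Suc] show ?case by simp
  qed
  then show ?thesis using \<phi>(1) by simp
qed

lemma subst_Sigma_Pi:
  "\<phi> \<in> Sigma_fm k \<Longrightarrow> subst \<sigma> \<phi> \<in> Sigma_fm k"
  "\<phi> \<in> Pi_fm k \<Longrightarrow> subst \<sigma> \<phi> \<in> Pi_fm k"
proof (induction k arbitrary: \<phi> \<sigma>)
  case (Suc k)
  {
    case 1
    then show ?case
    proof (induction arbitrary: \<sigma> rule: Sigma_Suc_induct)
      case (Pi \<phi>)
      then show ?case using Suc.IH(2) Sigma_Pi_cumulative(2) by blast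
    next
      case (Ex \<phi>)
      then show ?case by (simp only: subst.simps Ex_Sigma)
    qed
  next
    case 2
    then show ?case
    proof (induction arbitrary: \<sigma> rule: Pi_Suc_induct)
      case (Sigma \<phi>)
      then show ?case using Suc.IH(1) Sigma_Pi_cumulative(3) by blast
    next
      case (All \<phi>)
      then show ?case by (simp only: subst.simps All_Pi)
    qed
  }
qed simp_all

lemma lift_Sigma_Pi:
  "\<phi> \<in> Sigma_fm k \<Longrightarrow> lift \<phi> \<in> Sigma_fm k"
  "\<phi> \<in> Pi_fm k \<Longrightarrow> lift \<phi> \<in> Pi_fm k"
  by (simp_all add: lift_def subst_Sigma_Pi)

text \<open>Equality of the free variables is built in because \<open>PNFT\<close> demands it, so
  that each step of a normalisation has to preserve them.\<close>

definition equivalent :: "fm set \<Rightarrow> fm \<Rightarrow> fm \<Rightarrow> bool" where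
  "equivalent T \<phi> \<psi> \<longleftrightarrow> fv \<phi> = fv \<psi> \<and> T \<turnstile> Iff \<phi> \<psi>"

definition saturation :: "fm set \<Rightarrow> fm set \<Rightarrow> fm set" where
  "saturation T C = {\<phi>. \<exists>\<psi>\<in>C. equivalent T \<phi> \<psi>}"

lemma equivalent_refl: "equivalent T \<phi> \<phi>"
  by (simp add: equivalent_def Iff_refl)

lemma equivalent_trans: "equivalent T \<phi> \<psi> \<Longrightarrow> equivalent T \<psi> \<chi> \<Longrightarrow> equivalent T \<phi> \<chi>"
  by (auto simp: equivalent_def intro: Iff_trans)

lemma equivalent_cong:
  "equivalent T \<phi> \<phi>' \<Longrightarrow> equivalent T \<psi> \<psi>' \<Longrightarrow> equivalent T (Imp \<phi> \<psi>) (Imp \<phi>' \<psi>')"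
  "equivalent T \<phi> \<phi>' \<Longrightarrow> equivalent T \<psi> \<psi>' \<Longrightarrow> equivalent T (And \<phi> \<psi>) (And \<phi>' \<psi>')"
  "equivalent T \<phi> \<phi>' \<Longrightarrow> equivalent T \<psi> \<psi>' \<Longrightarrow> equivalent T (Or \<phi> \<psi>) (Or \<phi>' \<psi>')"
  "equivalent T \<phi> \<phi>' \<Longrightarrow> equivalent T (All \<phi>) (All \<phi>')"
  "equivalent T \<phi> \<phi>' \<Longrightarrow> equivalent T (Ex \<phi>) (Ex \<phi>')"
  by (simp_all add: equivalent_def Imp_cong And_cong Or_cong All_cong Ex_cong)

lemma saturation_incl: "\<phi> \<in> C \<Longrightarrow> \<phi> \<in> saturation T C"
  by (auto simp: saturation_def intro: equivalent_refl)

lemma saturation_mono: "C \<subseteq> D \<Longrightarrow> saturation T C \<subseteq> saturation T D"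
  by (auto simp: saturation_def)

lemma saturation_equivalent: "\<phi> \<in> saturation T C \<Longrightarrow> equivalent T \<psi> \<phi> \<Longrightarrow> \<psi> \<in> saturation T C"
  by (auto simp: saturation_def intro: equivalent_trans)

lemma saturation_Ex: "\<phi> \<in> saturation T (Sigma_fm (Suc k)) \<Longrightarrow> Ex \<phi> \<in> saturation T (Sigma_fm (Suc k))"
  unfolding saturation_def using Ex_Sigma equivalent_cong(5) by blast

lemma saturation_All: "\<phi> \<in> saturation T (Pi_fm (Suc k)) \<Longrightarrow> All \<phi> \<in> saturation T (Pi_fm (Suc k))"
  unfolding saturation_def using All_Pi equivalent_cong(4) by blast

section \<open>Decided levels and negations of prenex formulas\<close>

definition decidable :: "fm set \<Rightarrow> fm \<Rightarrow> bool" where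
  "decidable T \<phi> \<longleftrightarrow> T \<turnstile> Or \<phi> (Neg \<phi>)"

text \<open>Excluded middle on both sides of level \<open>k\<close> and with arbitrary parameters.
  This is the working hypothesis below, in place of the schemata.\<close>

definition decides :: "fm set \<Rightarrow> nat \<Rightarrow> bool" where
  "decides T k \<longleftrightarrow> (\<forall>\<phi>\<in>Sigma_fm k \<union> Pi_fm k. decidable T \<phi>)"

lemma decidable_connectives:
  assumes "decidable T \<phi>" "decidable T \<psi>"
  shows "decidable T (Imp \<phi> \<psi>)" "decidable T (And \<phi> \<psi>)" "decidable T (Or \<phi> \<psi>)"
  using assms unfolding decidable_def
  by - (rule prop_mp2[where v = "[\<phi>, \<psi>]"], assumption+, (rule reifies.intros)+, code_simp)+

lemma decidable_Bot: "decidable T Bot"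
  unfolding decidable_def by (rule prop_valid[where v = "[]"], (rule reifies.intros)+, code_simp)

lemma decidable_equivalent:
  assumes "equivalent T \<phi> \<psi>" "decidable T \<psi>"
  shows "decidable T \<phi>"
proof -
  have "T \<turnstile> Iff \<phi> \<psi>" using assms(1) by (simp add: equivalent_def)
  with assms(2) show ?thesis unfolding decidable_def
    by - (rule prop_mp2[where v = "[\<phi>, \<psi>]"], assumption+, (rule reifies.intros)+, code_simp)
qed

lemma decides_mono: "decides T k \<Longrightarrow> j \<le> k \<Longrightarrow> decides T j"
  using Sigma_mono[of j k] Pi_mono[of j k] by (auto simp: decides_def)

lemma decides_saturation:
  assumes "decides T k"
  shows "\<phi> \<in> saturation T (Sigma_fm k) \<Longrightarrow> decidable T \<phi>" "\<phi> \<in> saturation T (Pi_fm k) \<Longrightarrow> decidable T \<phi>"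
  using assms decidable_equivalent unfolding saturation_def decides_def by blast+

text \<open>If there is no counterexample, then \<phi> holds everywhere up to double negation, which
  decidability of \<phi> removes. As the existence of a counterexample is itself decidable, refuting
  \<open>All \<phi>\<close> yields one.\<close>

lemma Neg_All_decidable:
  assumes "decidable T \<phi>" "decidable T (Ex (Neg \<phi>))"
  shows "T \<turnstile> Iff (Neg (All \<phi>)) (Ex (Neg \<phi>))"
proof -
  have "T \<turnstile> Iff (Neg (Ex (Neg \<phi>))) (All (Neg (Neg \<phi>)))" by (rule Neg_Ex)
  moreover have "T \<turnstile> Imp (All (Neg (Neg \<phi>))) (All \<phi>)"
    using assms(1) unfolding decidable_def
    by - (rule All_mono, rule prop_mp1[where v = "[\<phi>]"], assumption+, (rule reifies.intros)+, code_simp)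
  ultimately show ?thesis
    using assms(2) Ex_Neg[of T \<phi>] unfolding decidable_def
    by - (rule prop_mp4[where v = "[All \<phi>, Ex (Neg \<phi>), All (Neg (Neg \<phi>))]"],
        assumption+, (rule reifies.intros)+, code_simp)
qed

text \<open>Moving a negation inside \<open>Ex\<close> is intuitionistic, so this reaches one level
  above what \<open>T\<close> decides. That extra level is what \<open>decides_Suc\<close>
  requires.\<close>

lemma Neg_Sigma_Suc:
  assumes "\<And>\<phi>. \<phi> \<in> Pi_fm k \<Longrightarrow> Neg \<phi> \<in> saturation T (Sigma_fm k)"
    and "\<phi> \<in> Sigma_fm (Suc k)"
  shows "Neg \<phi> \<in> saturation T (Pi_fm (Suc k))"
  using assms(2)
proof (induction rule: Sigma_Suc_induct)
  case (Pi \<phi>)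
  then show ?case using assms(1) Sigma_Pi_cumulative(3) saturation_mono by blast
next
  case (Ex \<phi>)
  then have "All (Neg \<phi>) \<in> saturation T (Pi_fm (Suc k))" by (intro saturation_All)
  then show ?case by (rule saturation_equivalent) (simp add: equivalent_def Neg_Ex)
qed

lemma Neg_Sigma_Pi:
  assumes "decides T k"
  shows "\<phi> \<in> Sigma_fm k \<Longrightarrow> Neg \<phi> \<in> saturation T (Pi_fm k)"
    and "\<phi> \<in> Pi_fm k \<Longrightarrow> Neg \<phi> \<in> saturation T (Sigma_fm k)"
  using assms
proof (induction k arbitrary: \<phi>)
  case 0
  {
    case 1
    then show ?case by (auto intro: saturation_incl)
  next
    case 2
    then show ?case by (auto intro: saturation_incl)
  }
next
  case (Suc k)
  have k: "decides T (Suc k) \<Longrightarrow> decides T k" using decides_mono by fastforce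
  {
    case 1
    show ?case by (rule Neg_Sigma_Suc) (use Suc.IH(2) k[OF 1(2)] 1 in auto)
  next
    case 2
    from 2(1) show ?case
    proof (induction rule: Pi_Suc_induct)
      case (Sigma \<phi>)
      then show ?case using Suc.IH(1) k[OF 2(2)] Sigma_Pi_cumulative(2) saturation_mono by blast
    next
      case (All \<phi>)
      then have Ex: "Ex (Neg \<phi>) \<in> saturation T (Sigma_fm (Suc k))" by (intro saturation_Ex)
      have "decidable T (Ex (Neg \<phi>))" using Ex 2(2) decides_saturation by blast
      moreover have "decidable T \<phi>" using All.hyps 2(2) by (simp add: decides_def)
      ultimately have "equivalent T (Neg (All \<phi>)) (Ex (Neg \<phi>))"
        using Neg_All_decidable by (simp add: equivalent_def)
      with Ex show ?case by (rule saturation_equivalent)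
    qed
  }
qed

text \<open>For \<phi> in \<open>Sigma_fm (Suc k)\<close> the negation is a \<Pi>-formula up to
  equivalence, hence decidable; double negation elimination turns a decision of
  \<open>Neg \<phi>\<close> into one of \<phi>.\<close>

lemma decides_Suc:
  assumes "decides T k"
    and Pi: "\<And>\<phi>. \<phi> \<in> Pi_fm (Suc k) \<Longrightarrow> decidable T \<phi>"
    and DNE: "\<And>\<phi>. \<phi> \<in> Sigma_fm (Suc k) \<Longrightarrow> T \<turnstile> Imp (Neg (Neg \<phi>)) \<phi>"
  shows "decides T (Suc k)"
proof -
  have "decidable T \<phi>" if "\<phi> \<in> Sigma_fm (Suc k)" for \<phi>
  proof -
    have "Neg \<phi> \<in> saturation T (Pi_fm (Suc k))"
      using Neg_Sigma_Suc[OF Neg_Sigma_Pi(2)] assms(1) that by blast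
    then obtain \<psi> where "\<psi> \<in> Pi_fm (Suc k)" "equivalent T (Neg \<phi>) \<psi>" by (auto simp: saturation_def)
    then have "decidable T (Neg \<phi>)" using Pi decidable_equivalent by blast
    then show ?thesis using DNE[OF that] unfolding decidable_def
      by - (rule prop_mp2[where v = "[\<phi>]"], assumption+, (rule reifies.intros)+, code_simp)
  qed
  then show ?thesis using Pi unfolding decides_def by blast
qed

text \<open>The left block is moved out first, past a member of \<open>C\<close>, and then the right
  one, past a member of \<open>B\<close>. The side formulas in \<open>left\<close> and
  \<open>right\<close> are restricted because moving \<forall> out of a disjunction requires a
  decidable side formula.\<close>

lemma saturation_block:
  assumes C: "C = {(Q ^^ n) \<phi> | n \<phi>. \<phi> \<in> B}"
    and lift: "\<And>\<phi>. \<phi> \<in> B \<Longrightarrow> lift \<phi> \<in> B" "\<And>\<phi>. \<phi> \<in> C \<Longrightarrow> lift \<phi> \<in> C"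
    and cong: "\<And>\<phi> \<psi>. equivalent T \<phi> \<psi> \<Longrightarrow> equivalent T (Q \<phi>) (Q \<psi>)"
    and left: "\<And>\<phi> \<psi>. \<psi> \<in> C \<Longrightarrow> equivalent T (c (Q \<phi>) \<psi>) (Q (c \<phi> (lift \<psi>)))"
    and right: "\<And>\<phi> \<psi>. \<phi> \<in> B \<Longrightarrow> equivalent T (c \<phi> (Q \<psi>)) (Q (c (lift \<phi>) \<psi>))"
    and base: "\<And>\<phi> \<psi>. \<phi> \<in> B \<Longrightarrow> \<psi> \<in> B \<Longrightarrow> c \<phi> \<psi> \<in> saturation T B"
    and "\<phi> \<in> C" "\<psi> \<in> C"
  shows "c \<phi> \<psi> \<in> saturation T C"
proof -
  have Q: "Q \<phi> \<in> saturation T C" if "\<phi> \<in> saturation T C" for \<phi>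
  proof -
    obtain \<psi> where \<psi>: "\<psi> \<in> C" "equivalent T \<phi> \<psi>" using \<open>\<phi> \<in> saturation T C\<close> by (auto simp: saturation_def)
    then obtain n \<chi> where "\<psi> = (Q ^^ n) \<chi>" "\<chi> \<in> B" by (auto simp: C)
    then have "Q \<psi> \<in> C" unfolding C by (auto intro!: exI[of _ "Suc n"])
    then show ?thesis using cong[OF \<psi>(2)] by (auto simp: saturation_def)
  qed
  have BC: "B \<subseteq> C" unfolding C by (auto intro: exI[of _ 0])
  have inner: "c \<phi> ((Q ^^ m) \<psi>) \<in> saturation T C" if "\<phi> \<in> B" "\<psi> \<in> B" for m \<phi> \<psi>
    using that(1)
  proof (induction m arbitrary: \<phi>)
    case 0
    then show ?case using base[OF _ that(2)] saturation_mono[OF BC] by auto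
  next
    case (Suc m)
    have "Q (c (lift \<phi>) ((Q ^^ m) \<psi>)) \<in> saturation T C" by (intro Q Suc.IH lift Suc.prems)
    then show ?case using right[OF Suc.prems] by (auto intro: saturation_equivalent)
  qed
  obtain n \<phi>' m \<psi>' where \<phi>: "\<phi> = (Q ^^ n) \<phi>'" "\<phi>' \<in> B" and "\<psi> = (Q ^^ m) \<psi>'" "\<psi>' \<in> B"
    using \<open>\<phi> \<in> C\<close> \<open>\<psi> \<in> C\<close> by (auto simp: C)
  have "c ((Q ^^ n) \<phi>') \<psi> \<in> saturation T C"
    using \<open>\<psi> \<in> C\<close>
  proof (induction n arbitrary: \<psi>)
    case 0
    then obtain m \<psi>' where "\<psi> = (Q ^^ m) \<psi>'" "\<psi>' \<in> B" by (auto simp: C)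
    then show ?case using inner \<phi>(2) by simp
  next
    case (Suc n)
    have "Q (c ((Q ^^ n) \<phi>') (lift \<psi>)) \<in> saturation T C" by (intro Q Suc.IH lift Suc.prems)
    then show ?case using left[OF Suc.prems] by (auto intro: saturation_equivalent)
  qed
  then show ?thesis using \<phi>(1) by simp
qed

lemma fv_lift_under: "{n. Suc n \<in> A \<or> Suc n \<in> Suc ` B} = {n. Suc n \<in> A} \<union> B"
  by auto

lemma equivalent_prenex:
  "equivalent T (And (Ex \<phi>) \<psi>) (Ex (And \<phi> (lift \<psi>)))"
  "equivalent T (Or (Ex \<phi>) \<psi>) (Ex (Or \<phi> (lift \<psi>)))"
  "equivalent T (And (All \<phi>) \<psi>) (All (And \<phi> (lift \<psi>)))"
  "decidable T \<psi> \<Longrightarrow> equivalent T (Or (All \<phi>) \<psi>) (All (Or \<phi> (lift \<psi>)))"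
  by (auto simp: equivalent_def fv_lift_under decidable_def
      intro: Ex_And_left Ex_Or_left All_And_left All_Or_left)

lemma equivalent_commute:
  "equivalent T (And \<phi> \<psi>) (And \<psi> \<phi>)" "equivalent T (Or \<phi> \<psi>) (Or \<psi> \<phi>)"
  by (auto simp: equivalent_def And_commute Or_commute)

lemma equivalent_prenex_right:
  "equivalent T (And \<psi> (Ex \<phi>)) (Ex (And (lift \<psi>) \<phi>))"
  "equivalent T (Or \<psi> (Ex \<phi>)) (Ex (Or (lift \<psi>) \<phi>))"
  "equivalent T (And \<psi> (All \<phi>)) (All (And (lift \<psi>) \<phi>))"
  "decidable T \<psi> \<Longrightarrow> equivalent T (Or \<psi> (All \<phi>)) (All (Or (lift \<psi>) \<phi>))"
  by (blast intro: equivalent_trans equivalent_prenex equivalent_commute equivalent_cong)+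

text \<open>Existential quantifiers leave conjunctions and disjunctions intuitionistically, so
  closure of \<open>Pi_fm k\<close> is enough and level \<open>Suc k\<close> need not be
  decided.\<close>

lemma Sigma_Suc_And_Or:
  assumes "\<And>\<phi> \<psi>. \<phi> \<in> Pi_fm k \<Longrightarrow> \<psi> \<in> Pi_fm k \<Longrightarrow> c \<phi> \<psi> \<in> saturation T (Pi_fm k)"
    and c: "c = And \<or> c = Or" and "\<phi> \<in> Sigma_fm (Suc k)" "\<psi> \<in> Sigma_fm (Suc k)"
  shows "c \<phi> \<psi> \<in> saturation T (Sigma_fm (Suc k))"
proof (rule saturation_block[where c = c and Q = Ex and B = "Pi_fm k"])
  show "equivalent T (c (Ex \<phi>) \<psi>) (Ex (c \<phi> (lift \<psi>)))" for \<phi> \<psi>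
    using c equivalent_prenex by auto
  show "equivalent T (c \<phi> (Ex \<psi>)) (Ex (c (lift \<phi>) \<psi>))" for \<phi> \<psi>
    using c equivalent_prenex_right by auto
  show "Sigma_fm (Suc k) = {(Ex ^^ n) \<phi> |n \<phi>. \<phi> \<in> Pi_fm k}" by simp
qed (use assms in \<open>auto simp del: Sigma_fm.simps intro: lift_Sigma_Pi equivalent_cong\<close>)

lemma Sigma_Pi_And_Or:
  assumes "decides T k" and c: "c = And \<or> c = Or"
  shows "\<phi> \<in> Sigma_fm k \<Longrightarrow> \<psi> \<in> Sigma_fm k \<Longrightarrow> c \<phi> \<psi> \<in> saturation T (Sigma_fm k)"
    and "\<phi> \<in> Pi_fm k \<Longrightarrow> \<psi> \<in> Pi_fm k \<Longrightarrow> c \<phi> \<psi> \<in> saturation T (Pi_fm k)"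
  using assms(1)
proof (induction k arbitrary: \<phi> \<psi>)
  case 0
  {
    case 1
    then show ?case using c by (auto intro!: saturation_incl)
  next
    case 2
    then show ?case using c by (auto intro!: saturation_incl)
  }
next
  case (Suc k)
  have k: "decides T (Suc k) \<Longrightarrow> decides T k" using decides_mono by fastforce
  {
    case 1
    show ?case by (rule Sigma_Suc_And_Or) (use Suc.IH(2) k[OF 1(3)] c 1 in auto)
  next
    case 2
    have dec: "decidable T \<phi>" if "\<phi> \<in> Pi_fm (Suc k)" for \<phi> using that 2(3) by (simp add: decides_def)
    show ?case
    proof (rule saturation_block[where c = c and Q = All and B = "Sigma_fm k"])
      show "equivalent T (c (All \<phi>) \<psi>) (All (c \<phi> (lift \<psi>)))" if "\<psi> \<in> Pi_fm (Suc k)" for \<phi> \<psi>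
        using c equivalent_prenex dec[OF that] by auto
      show "equivalent T (c \<phi> (All \<psi>)) (All (c (lift \<phi>) \<psi>))" if "\<phi> \<in> Sigma_fm k" for \<phi> \<psi>
        using c equivalent_prenex_right dec[of \<phi>] Sigma_Pi_cumulative(3) that by blast
      show "Pi_fm (Suc k) = {(All ^^ n) \<phi> |n \<phi>. \<phi> \<in> Sigma_fm k}" by simp
      show "c \<phi> \<psi> \<in> saturation T (Sigma_fm k)" if "\<phi> \<in> Sigma_fm k" "\<psi> \<in> Sigma_fm k" for \<phi> \<psi>
        using Suc.IH(1) that k[OF 2(3)] by blast
    qed (use 2 in \<open>auto simp del: Pi_fm.simps intro: lift_Sigma_Pi equivalent_cong\<close>)
  }
qed

lemma saturation_And_Or:
  assumes "\<And>\<phi> \<psi>. \<phi> \<in> C \<Longrightarrow> \<psi> \<in> C \<Longrightarrow> c \<phi> \<psi> \<in> saturation T C"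
    and c: "c = And \<or> c = Or" and "\<phi> \<in> saturation T C" "\<psi> \<in> saturation T C"
  shows "c \<phi> \<psi> \<in> saturation T C"
proof -
  obtain \<phi>' \<psi>' where "\<phi>' \<in> C" "equivalent T \<phi> \<phi>'" "\<psi>' \<in> C" "equivalent T \<psi> \<psi>'"
    using assms(3,4) by (auto simp: saturation_def)
  moreover from this have "equivalent T (c \<phi> \<psi>) (c \<phi>' \<psi>')" using c equivalent_cong by auto
  ultimately show ?thesis using assms(1) saturation_equivalent by blast
qed

lemma saturation_Neg:
  assumes "decides T k"
  shows "\<phi> \<in> saturation T (Sigma_fm k) \<Longrightarrow> Neg \<phi> \<in> saturation T (Pi_fm k)"
    and "\<phi> \<in> saturation T (Pi_fm k) \<Longrightarrow> Neg \<phi> \<in> saturation T (Sigma_fm k)"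
proof -
  have Neg: "Neg \<phi> \<in> saturation T D"
    if C: "\<phi> \<in> saturation T C" and *: "\<And>\<psi>. \<psi> \<in> C \<Longrightarrow> Neg \<psi> \<in> saturation T D" for C D
  proof -
    obtain \<psi> where "\<psi> \<in> C" "equivalent T \<phi> \<psi>" using C by (auto simp: saturation_def)
    then show ?thesis
      using * saturation_equivalent equivalent_cong(1)[OF _ equivalent_refl] by blast
  qed
  show "\<phi> \<in> saturation T (Sigma_fm k) \<Longrightarrow> Neg \<phi> \<in> saturation T (Pi_fm k)"
    using Neg Neg_Sigma_Pi(1)[OF assms] by blast
  show "\<phi> \<in> saturation T (Pi_fm k) \<Longrightarrow> Neg \<phi> \<in> saturation T (Sigma_fm k)"
    using Neg Neg_Sigma_Pi(2)[OF assms] by blast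
qed

lemma equivalent_Imp_decidable:
  assumes "decidable T \<phi>"
  shows "equivalent T (Imp \<phi> \<psi>) (Or (Neg \<phi>) \<psi>)"
  using assms unfolding decidable_def equivalent_def
  by - (rule conjI, simp, rule prop_mp1[where v = "[\<phi>, \<psi>]"], assumption+, (rule reifies.intros)+, code_simp)

lemma saturation_Sigma_Pi:
  assumes k: "decides T k"
  shows "c = And \<or> c = Or \<Longrightarrow> \<phi> \<in> saturation T (Sigma_fm k) \<Longrightarrow> \<psi> \<in> saturation T (Sigma_fm k) \<Longrightarrow>
      c \<phi> \<psi> \<in> saturation T (Sigma_fm k)"
    and "c = And \<or> c = Or \<Longrightarrow> \<phi> \<in> saturation T (Pi_fm k) \<Longrightarrow> \<psi> \<in> saturation T (Pi_fm k) \<Longrightarrow>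
      c \<phi> \<psi> \<in> saturation T (Pi_fm k)"
    and "\<phi> \<in> saturation T (Pi_fm k) \<Longrightarrow> \<psi> \<in> saturation T (Sigma_fm k) \<Longrightarrow> Imp \<phi> \<psi> \<in> saturation T (Sigma_fm k)"
    and "\<phi> \<in> saturation T (Sigma_fm k) \<Longrightarrow> \<psi> \<in> saturation T (Pi_fm k) \<Longrightarrow> Imp \<phi> \<psi> \<in> saturation T (Pi_fm k)"
proof -
  show 1: "c \<phi> \<psi> \<in> saturation T (Sigma_fm k)"
    if "c = And \<or> c = Or" "\<phi> \<in> saturation T (Sigma_fm k)" "\<psi> \<in> saturation T (Sigma_fm k)" for c \<phi> \<psi>
    using saturation_And_Or[OF Sigma_Pi_And_Or(1)[OF k that(1)] that] .
  show 2: "c \<phi> \<psi> \<in> saturation T (Pi_fm k)"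
    if "c = And \<or> c = Or" "\<phi> \<in> saturation T (Pi_fm k)" "\<psi> \<in> saturation T (Pi_fm k)" for c \<phi> \<psi>
    using saturation_And_Or[OF Sigma_Pi_And_Or(2)[OF k that(1)] that] .
  show "Imp \<phi> \<psi> \<in> saturation T (Sigma_fm k)" if "\<phi> \<in> saturation T (Pi_fm k)" "\<psi> \<in> saturation T (Sigma_fm k)"
    using 1[of Or "Neg \<phi>" \<psi>] that saturation_Neg(2)[OF k] decides_saturation(2)[OF k]
      saturation_equivalent equivalent_Imp_decidable by blast
  show "Imp \<phi> \<psi> \<in> saturation T (Pi_fm k)" if "\<phi> \<in> saturation T (Sigma_fm k)" "\<psi> \<in> saturation T (Pi_fm k)"
    using 2[of Or "Neg \<phi>" \<psi>] that saturation_Neg(1)[OF k] decides_saturation(1)[OF k]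
      saturation_equivalent equivalent_Imp_decidable by blast
qed

lemma (in HA_extension) decidable_Eq: "decidable T (Eq s t)"
  unfolding decidable_def by (rule from_HA) (rule eq_decidable)

lemma (in HA_extension) decidable_qf: "qf \<phi> \<Longrightarrow> decidable T \<phi>"
  by (induction \<phi>) (simp_all add: decidable_connectives decidable_Bot decidable_Eq)

lemma (in HA_extension) decides_0: "decides T 0"
  by (simp add: decides_def decidable_qf)

section \<open>Conservation of PA\<close>

text \<open>
  The negative translation relative to a formula \<open>A\<close>, in which \<open>A\<close> plays the role of falsity.
  Since \<open>A\<close> may have free variables, it is shifted below quantifiers.
\<close>

abbreviation dn :: "fm \<Rightarrow> fm \<Rightarrow> fm" where
  "dn A \<phi> \<equiv> Imp (Imp \<phi> A) A"

fun neg_tr :: "fm \<Rightarrow> fm \<Rightarrow> fm" where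
  "neg_tr A (Eq s t) = dn A (Eq s t)"
| "neg_tr A Bot = A"
| "neg_tr A (Imp \<phi> \<psi>) = Imp (neg_tr A \<phi>) (neg_tr A \<psi>)"
| "neg_tr A (And \<phi> \<psi>) = And (neg_tr A \<phi>) (neg_tr A \<psi>)"
| "neg_tr A (Or \<phi> \<psi>) = dn A (Or (neg_tr A \<phi>) (neg_tr A \<psi>))"
| "neg_tr A (All \<phi>) = All (neg_tr (lift A) \<phi>)"
| "neg_tr A (Ex \<phi>) = dn A (Ex (neg_tr (lift A) \<phi>))"

text \<open>The substitution has to act on the falsity formula as well. For instantiation this is
  harmless: \<open>A\<close> is lifted below the quantifier, and \<open>inst\<close> undoes the
  lifting.\<close>

lemma neg_tr_subst: "neg_tr (subst \<sigma> A) (subst \<sigma> \<phi>) = subst \<sigma> (neg_tr A \<phi>)"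
  by (induction \<phi> arbitrary: \<sigma> A) (simp_all flip: subst_up_lift)

lemma neg_tr_lift: "neg_tr (lift A) (lift \<phi>) = lift (neg_tr A \<phi>)"
  by (simp add: lift_def neg_tr_subst)

lemma neg_tr_inst: "neg_tr A (inst t \<phi>) = inst t (neg_tr (lift A) \<phi>)"
  using neg_tr_subst[of "case_nat t Var" "lift A" \<phi>] inst_lift[of t A] by (simp add: inst_def)

text \<open>Equations, disjunctions and existential formulas are translated to something of the form
  \<open>dn A _\<close>, where three negations reduce to one, and \<open>Bot\<close> becomes
  \<open>A\<close> itself. The other connectives inherit stability from their parts.\<close>

lemma neg_tr_stable: "T \<turnstile> Imp (dn A (neg_tr A \<phi>)) (neg_tr A \<phi>)"
proof (induction \<phi> arbitrary: A)
  case (Eq s t)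
  show ?case unfolding neg_tr.simps
    by (rule prop_valid[where v = "[A, Eq s t]"], (rule reifies.intros)+, code_simp)
next
  case Bot
  show ?case unfolding neg_tr.simps
    by (rule prop_valid[where v = "[A]"], (rule reifies.intros)+, code_simp)
next
  case (Imp \<phi> \<psi>)
  from Imp(2)[of A] show ?case unfolding neg_tr.simps
    by - (rule prop_mp1[where v = "[A, neg_tr A \<phi>, neg_tr A \<psi>]"], assumption+, (rule reifies.intros)+, code_simp)
next
  case (And \<phi> \<psi>)
  from And[of A] show ?case unfolding neg_tr.simps
    by - (rule prop_mp2[where v = "[A, neg_tr A \<phi>, neg_tr A \<psi>]"], assumption+, (rule reifies.intros)+, code_simp)
next
  case (Or \<phi> \<psi>)
  show ?case unfolding neg_tr.simps
    by (rule prop_valid[where v = "[A, neg_tr A \<phi>, neg_tr A \<psi>]"], (rule reifies.intros)+, code_simp)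
next
  case (All \<phi>)
  let ?\<psi> = "neg_tr (lift A) \<phi>"
  from All[of "lift A"] All_elim[of T ?\<psi>] show ?case unfolding neg_tr.simps
    by - (rule Imp_AllI, unfold lift_simps, rule prop_mp2[where v = "[lift A, ?\<psi>, lift (All ?\<psi>)]"],
        assumption+, (rule reifies.intros)+, code_simp)
next
  case (Ex \<phi>)
  show ?case unfolding neg_tr.simps
    by (rule prop_valid[where v = "[A, Ex (neg_tr (lift A) \<phi>)]"], (rule reifies.intros)+, code_simp)
qed

text \<open>Elimination rules act on formulas under \<open>dn A\<close>; stability of the conclusion
  permits reasoning as if this prefix were absent.\<close>

lemma neg_tr_bind:
  assumes "prv T \<Gamma> (dn A \<chi>)" "prv T \<Gamma> (Imp \<chi> (neg_tr A \<phi>))"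
  shows "prv T \<Gamma> (neg_tr A \<phi>)"
proof -
  have "prv T \<Gamma> (Imp (dn A (neg_tr A \<phi>)) (neg_tr A \<phi>))"
    by (rule prv_weaken[OF neg_tr_stable]) simp
  with assms show ?thesis
    by - (rule prop_mp3[where v = "[A, \<chi>, neg_tr A \<phi>]"], assumption+, (rule reifies.intros)+, code_simp)
qed

lemma dn_intro: "prv T \<Gamma> \<phi> \<Longrightarrow> prv T \<Gamma> (dn A \<phi>)"
  by (rule prop_mp1[where v = "[A, \<phi>]"], assumption+, (rule reifies.intros)+, code_simp)

lemma neg_tr_HA: "\<phi> \<in> HA \<Longrightarrow> HA \<turnstile> neg_tr A \<phi>"
proof (induction rule: HA.induct)
  case (eq_repl s t \<phi>)
  let ?\<psi> = "neg_tr (lift A) \<phi>"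
  \<comment> \<open>The translated equation is only available under \<open>dn A\<close>. Stability
    of the target formula absorbs this.\<close>
  have stable: "HA \<turnstile> Imp (dn A (inst t ?\<psi>)) (inst t ?\<psi>)"
    using neg_tr_stable[of HA A "inst t \<phi>"] by (simp add: neg_tr_inst)
  have "HA \<turnstile> Imp (Eq s t) (Imp (inst s ?\<psi>) (inst t ?\<psi>))" by (rule prv.Axiom[OF HA.eq_repl])
  with stable show ?case unfolding neg_tr.simps neg_tr_inst
    by - (rule prop_mp2[where v = "[A, Eq s t, inst s ?\<psi>, inst t ?\<psi>]"],
        assumption+, (rule reifies.intros)+, code_simp)
next
  case (succ_nonzero t)
  have "HA \<turnstile> Neg (Eq (succ t) zero)" by (rule prv.Axiom[OF HA.succ_nonzero])
  then show ?case unfolding neg_tr.simps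
    by - (rule prop_mp1[where v = "[A, Eq (succ t) zero]"], assumption+, (rule reifies.intros)+, code_simp)
next
  case (succ_inj s t)
  have "HA \<turnstile> Imp (Eq (succ s) (succ t)) (Eq s t)" by (rule prv.Axiom[OF HA.succ_inj])
  then show ?case unfolding neg_tr.simps
    by - (rule prop_mp1[where v = "[A, Eq (succ s) (succ t), Eq s t]"],
        assumption+, (rule reifies.intros)+, code_simp)
next
  case (induction \<phi>)
  let ?\<psi> = "neg_tr (lift A) \<phi>" and ?S = "case_nat (succ (Var 0)) (\<lambda>n. Var (Suc n))"
  \<comment> \<open>The induction variable does not occur in \<open>lift A\<close>, so the step
    formula of the translated axiom is an instance of induction again.\<close>
  have "subst ?S (lift A) = lift A" by (simp add: lift_def subst_comp)
  then have "neg_tr (lift A) (subst ?S \<phi>) = subst ?S ?\<psi>"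
    using neg_tr_subst[of ?S "lift A" \<phi>] by simp
  then show ?case using prv.Axiom[OF HA.induction[of ?\<psi>]] by (simp add: neg_tr_inst)
qed (simp_all add: dn_intro prv.Axiom HA.intros)

lemma neg_tr_PA: "prv PA \<Gamma> \<phi> \<Longrightarrow> prv HA (neg_tr A ` \<Gamma>) (neg_tr A \<phi>)"
proof (induction arbitrary: A rule: prv.induct)
  case (Axiom \<phi> \<Gamma>)
  then consider "\<phi> \<in> HA" | \<psi> where "\<phi> = Or \<psi> (Neg \<psi>)" by (auto simp: PA_def)
  then show ?case
  proof cases
    case 1
    then show ?thesis by (intro prv_weaken[OF neg_tr_HA]) auto
  next
    case (2 \<psi>)
    \<comment> \<open>\<open>Neg \<psi>\<close> is translated with \<open>A\<close> as its
      conclusion, so the claim is the double negation of excluded middle with \<open>A\<close> for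
      falsity.\<close>
    show ?thesis unfolding 2 neg_tr.simps
      by (rule prop_valid[where v = "[A, neg_tr A \<psi>]"], (rule reifies.intros)+, code_simp)
  qed
next
  case (Assm \<phi> \<Gamma>)
  then show ?case by (simp add: prv.Assm)
next
  case (BotE \<Gamma> \<phi>)
  \<comment> \<open>A derivation of falsity has become one of \<open>A\<close>, which implies
    nothing by itself; but it gives \<open>dn A Bot\<close>, and stability of the conclusion does
    the rest.\<close>
  from BotE.IH[of A] have "prv HA (neg_tr A ` \<Gamma>) (dn A Bot)" unfolding neg_tr.simps
    by - (rule prop_mp1[where v = "[A]"], assumption+, (rule reifies.intros)+, code_simp)
  then show ?case by (rule neg_tr_bind) (auto intro: prv.ImpI prv.BotE prv.Assm)
next
  case (ImpI \<phi> \<Gamma> \<psi>)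
  then show ?case by (simp add: prv.ImpI)
next
  case (ImpE \<Gamma> \<phi> \<psi>)
  then show ?case using prv.ImpE by fastforce
next
  case (AndI \<Gamma> \<phi> \<psi>)
  then show ?case by (simp add: prv.AndI)
next
  case (AndE1 \<Gamma> \<phi> \<psi>)
  then show ?case using prv.AndE1 by fastforce
next
  case (AndE2 \<Gamma> \<phi> \<psi>)
  then show ?case using prv.AndE2 by fastforce
next
  case (OrI1 \<Gamma> \<phi> \<psi>)
  then show ?case by (simp add: dn_intro prv.OrI1)
next
  case (OrI2 \<Gamma> \<psi> \<phi>)
  then show ?case by (simp add: dn_intro prv.OrI2)
next
  case (OrE \<Gamma> \<phi> \<psi> \<chi>)
  let ?G = "neg_tr A ` \<Gamma>" and ?O = "Or (neg_tr A \<phi>) (neg_tr A \<psi>)"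
  have "prv HA (insert ?O ?G) (neg_tr A \<chi>)"
  proof (rule prv.OrE)
    show "prv HA (insert ?O ?G) ?O" by (simp add: prv.Assm)
    show "prv HA (insert (neg_tr A \<phi>) (insert ?O ?G)) (neg_tr A \<chi>)"
      using OrE.IH(2)[of A] by (rule prv_weaken) auto
    show "prv HA (insert (neg_tr A \<psi>) (insert ?O ?G)) (neg_tr A \<chi>)"
      using OrE.IH(3)[of A] by (rule prv_weaken) auto
  qed
  then show ?case using neg_tr_bind[OF _ prv.ImpI] OrE.IH(1)[of A] by simp
next
  case (AllI \<Gamma> \<phi>)
  then show ?case using AllI.IH[of "lift A"] by (simp add: prv.AllI image_image neg_tr_lift)
next
  case (AllE \<Gamma> \<phi> t)
  then show ?case by (simp add: neg_tr_inst prv.AllE)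
next
  case (ExI \<Gamma> t \<phi>)
  then have "prv HA (neg_tr A ` \<Gamma>) (inst t (neg_tr (lift A) \<phi>))" by (simp add: neg_tr_inst)
  then show ?case by (simp add: dn_intro prv.ExI)
next
  case (ExE \<Gamma> \<phi> \<chi>)
  let ?G = "neg_tr A ` \<Gamma>" and ?E = "Ex (neg_tr (lift A) \<phi>)"
  have "prv HA (insert ?E ?G) (neg_tr A \<chi>)"
  proof (rule prv.ExE)
    show "prv HA (insert ?E ?G) ?E" by (simp add: prv.Assm)
    have "prv HA (insert (neg_tr (lift A) \<phi>) (lift ` ?G)) (lift (neg_tr A \<chi>))"
      using ExE.IH(2)[of "lift A"] by (simp add: image_image neg_tr_lift)
    then show "prv HA (insert (neg_tr (lift A) \<phi>) (lift ` insert ?E ?G)) (lift (neg_tr A \<chi>))"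
      by (rule prv_weaken) auto
  qed
  then show ?case using neg_tr_bind[OF _ prv.ImpI] ExE.IH(1)[of A] by simp
qed

section \<open>Removing the translation from prenex formulas\<close>

lemma dn_cong: "prv T \<Gamma> (Iff \<phi> \<psi>) \<Longrightarrow> prv T \<Gamma> (Iff (dn A \<phi>) (dn A \<psi>))"
  by (intro Imp_cong Iff_refl)

lemma dn_Ex: "T \<turnstile> Iff (dn A (Ex (dn (lift A) \<phi>))) (dn A (Ex \<phi>))"
proof -
  have "T \<turnstile> Imp (Ex \<phi>) (Ex (dn (lift A) \<phi>))"
    by (rule Ex_mono, rule prop_valid[where v = "[\<phi>, lift A]"], (rule reifies.intros)+, code_simp)
  moreover have "T \<turnstile> Imp (Ex (dn (lift A) \<phi>)) (dn A (Ex \<phi>))"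
    by (rule Imp_ExE, rule prop_mp1[where v = "[\<phi>, lift A, lift (Ex \<phi>)]", OF Ex_intro[of T \<phi>]],
        unfold lift_simps, (rule reifies.intros)+, code_simp)
  ultimately show ?thesis
    by - (rule prop_mp2[where v = "[A, Ex (dn (lift A) \<phi>), Ex \<phi>]"],
        assumption+, (rule reifies.intros)+, code_simp)
qed

text \<open>Decide whether \<phi> has a counterexample. If so,
  \<open>\<phi> \<longrightarrow> A\<close> holds there by ex falso, and the left side gives
  \<open>A\<close>; otherwise \<open>All \<phi>\<close> holds. The converse direction is
  intuitionistic.\<close>

lemma dn_All:
  assumes "decidable T \<phi>" "decidable T (Ex (Neg \<phi>))"
  shows "T \<turnstile> Iff (All (dn (lift A) \<phi>)) (dn A (All \<phi>))"
proof -
  let ?\<psi> = "dn (lift A) \<phi>"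
  have 1: "T \<turnstile> Imp (dn A (All \<phi>)) (All ?\<psi>)"
    by (rule Imp_AllI, unfold lift_simps,
        rule prop_mp1[where v = "[\<phi>, lift A, lift (All \<phi>)]", OF All_elim[of T \<phi>]],
        (rule reifies.intros)+, code_simp)
  have "T \<turnstile> Imp (Ex (Neg \<phi>)) (Imp (All ?\<psi>) A)"
    by (rule Imp_ExE, unfold lift_simps,
        rule prop_mp1[where v = "[\<phi>, lift A, lift (All ?\<psi>)]", OF All_elim[of T ?\<psi>]],
        (rule reifies.intros)+, code_simp)
  moreover have "T \<turnstile> Iff (Neg (Ex (Neg \<phi>))) (All (Neg (Neg \<phi>)))" by (rule Neg_Ex)
  moreover have "T \<turnstile> Imp (All (Neg (Neg \<phi>))) (All \<phi>)"
    using assms(1) unfolding decidable_def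
    by - (rule All_mono, rule prop_mp1[where v = "[\<phi>]"], assumption+, (rule reifies.intros)+, code_simp)
  ultimately have "T \<turnstile> Imp (All ?\<psi>) (dn A (All \<phi>))"
    using assms(2) unfolding decidable_def
    by - (rule prop_mp4[where v = "[All \<phi>, Ex (Neg \<phi>), All (Neg (Neg \<phi>)), A, All ?\<psi>]"],
        assumption+, (rule reifies.intros)+, code_simp)
  then show ?thesis using 1 by (rule prv.AndI)
qed

text \<open>At an implication the premise is decided: if it fails, the implication holds by ex
  falso; if it holds, it is available under \<open>dn A\<close>.\<close>

lemma (in HA_extension) neg_tr_qf: "qf \<phi> \<Longrightarrow> T \<turnstile> Iff (neg_tr A \<phi>) (dn A \<phi>)"
proof (induction \<phi>)
  case (Eq s t)
  show ?case unfolding neg_tr.simps by (rule Iff_refl)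
next
  case Bot
  show ?case unfolding neg_tr.simps
    by (rule prop_valid[where v = "[A]"], (rule reifies.intros)+, code_simp)
next
  case (Imp \<phi> \<psi>)
  then have "T \<turnstile> Or \<phi> (Neg \<phi>)" using decidable_qf by (simp add: decidable_def)
  moreover have "T \<turnstile> Iff (neg_tr A \<phi>) (dn A \<phi>)" "T \<turnstile> Iff (neg_tr A \<psi>) (dn A \<psi>)" using Imp by simp_all
  ultimately show ?case unfolding neg_tr.simps
    by - (rule prop_mp3[where v = "[A, neg_tr A \<phi>, neg_tr A \<psi>, \<phi>, \<psi>]"],
        assumption+, (rule reifies.intros)+, code_simp)
next
  case (And \<phi> \<psi>)
  then have "T \<turnstile> Iff (neg_tr A \<phi>) (dn A \<phi>)" "T \<turnstile> Iff (neg_tr A \<psi>) (dn A \<psi>)" by simp_all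
  then show ?case unfolding neg_tr.simps
    by - (rule prop_mp2[where v = "[A, neg_tr A \<phi>, neg_tr A \<psi>, \<phi>, \<psi>]"],
        assumption+, (rule reifies.intros)+, code_simp)
next
  case (Or \<phi> \<psi>)
  then have "T \<turnstile> Iff (neg_tr A \<phi>) (dn A \<phi>)" "T \<turnstile> Iff (neg_tr A \<psi>) (dn A \<psi>)" by simp_all
  then show ?case unfolding neg_tr.simps
    by - (rule prop_mp2[where v = "[A, neg_tr A \<phi>, neg_tr A \<psi>, \<phi>, \<psi>]"],
        assumption+, (rule reifies.intros)+, code_simp)
qed simp_all

text \<open>Nested prefixes \<open>dn\<close> below \<open>Ex\<close> are absorbed by the outer one,
  whatever \<open>T\<close> decides. So \<Sigma> is reached one level above the decided
  ones.\<close>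

lemma neg_tr_Sigma_Suc:
  assumes "\<And>A \<phi>. \<phi> \<in> Pi_fm k \<Longrightarrow> T \<turnstile> Iff (neg_tr A \<phi>) (dn A \<phi>)"
    and "\<phi> \<in> Sigma_fm (Suc k)"
  shows "T \<turnstile> Iff (neg_tr A \<phi>) (dn A \<phi>)"
  using assms(2)
proof (induction arbitrary: A rule: Sigma_Suc_induct)
  case (Pi \<phi>)
  then show ?case by (rule assms(1))
next
  case (Ex \<phi>)
  show ?case unfolding neg_tr.simps
    by (rule Iff_trans[OF dn_cong[OF Ex_cong[OF Ex.IH]] dn_Ex])
qed

lemma (in HA_extension) neg_tr_Sigma_Pi:
  assumes "decides T k"
  shows "\<phi> \<in> Sigma_fm k \<Longrightarrow> T \<turnstile> Iff (neg_tr A \<phi>) (dn A \<phi>)"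
    and "\<phi> \<in> Pi_fm k \<Longrightarrow> T \<turnstile> Iff (neg_tr A \<phi>) (dn A \<phi>)"
  using assms
proof (induction k arbitrary: A \<phi>)
  case (Suc k)
  have k: "decides T (Suc k) \<Longrightarrow> decides T k" using decides_mono by fastforce
  {
    case 1
    show ?case by (rule neg_tr_Sigma_Suc[OF _ 1(1)]) (use Suc.IH(2) k[OF 1(2)] in blast)
  next
    case 2
    from 2(1) show ?case
    proof (induction arbitrary: A rule: Pi_Suc_induct)
      case (Sigma \<phi>)
      then show ?case using Suc.IH(1) k[OF 2(2)] by blast
    next
      case (All \<phi>)
      have "decidable T \<phi>" using All.hyps 2(2) unfolding decides_def by blast
      moreover have "Ex (Neg \<phi>) \<in> saturation T (Sigma_fm (Suc k))"
        using Neg_Sigma_Pi(2)[OF 2(2) All.hyps] by (rule saturation_Ex)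
      then have "decidable T (Ex (Neg \<phi>))" by (rule decides_saturation(1)[OF 2(2)])
      ultimately show ?case unfolding neg_tr.simps
        by (intro Iff_trans[OF All_cong[OF All.IH]] dn_All)
    qed
  }
qed (simp_all add: neg_tr_qf)

text \<open>With \<psi> as falsity, \<open>dn \<psi> \<psi>\<close> is equivalent to \<psi>, while
  \<phi> implies \<open>dn \<psi> \<phi>\<close>. The translated derivation uses HA only, so further
  axioms of \<open>T\<close> do not interfere.\<close>

theorem (in HA_extension) PA_conservative:
  assumes "decides T k" "\<phi> \<in> Sigma_fm (Suc k)" "\<psi> \<in> Sigma_fm (Suc k)" "PA \<turnstile> Imp \<phi> \<psi>"
  shows "T \<turnstile> Imp \<phi> \<psi>"
proof -
  have tr: "T \<turnstile> Iff (neg_tr \<psi> \<chi>) (dn \<psi> \<chi>)" if "\<chi> \<in> Sigma_fm (Suc k)" for \<chi>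
    using neg_tr_Sigma_Suc[OF neg_tr_Sigma_Pi(2)[OF assms(1)] that] .
  have "T \<turnstile> Imp (neg_tr \<psi> \<phi>) (neg_tr \<psi> \<psi>)"
    using from_HA[OF neg_tr_PA[OF assms(4), of \<psi>]] by simp
  with tr[OF assms(2)] tr[OF assms(3)] show ?thesis
    by - (rule prop_mp3[where v = "[\<phi>, \<psi>, neg_tr \<psi> \<phi>, neg_tr \<psi> \<psi>]"],
        assumption+, (rule reifies.intros)+, code_simp)
qed

section \<open>Alternation paths\<close>

text \<open>\<open>E_upto k\<close> corresponds to the paper's class \<open>E\<^sub>k\<^sup>+\<close>, and \<open>U_upto k\<close> to \<open>U\<^sub>k\<^sup>+\<close>.\<close>

definition E_upto :: "nat \<Rightarrow> fm \<Rightarrow> bool" where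
  "E_upto k \<phi> \<longleftrightarrow> (\<forall>s\<in>Alt \<phi>. length s \<le> k \<and> (length s = k \<longrightarrow> init s \<noteq> Some Minus))"

definition U_upto :: "nat \<Rightarrow> fm \<Rightarrow> bool" where
  "U_upto k \<phi> \<longleftrightarrow> (\<forall>s\<in>Alt \<phi>. length s \<le> k \<and> (length s = k \<longrightarrow> init s \<noteq> Some Plus))"

lemma length_dual [simp]: "length (dual s) = length s"
  by (simp add: dual_def)

lemma init_simps [simp]: "init [] = None" "init (a # s) = Some a"
  by (simp_all add: init_def)

lemma init_dual [simp]:
  "init (dual s) = Some Plus \<longleftrightarrow> init s = Some Minus"
  "init (dual s) = Some Minus \<longleftrightarrow> init s = Some Plus"
proof -
  have "flip a = Plus \<longleftrightarrow> a = Minus" "flip a = Minus \<longleftrightarrow> a = Plus" for a by (cases a; simp)+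
  then show "init (dual s) = Some Plus \<longleftrightarrow> init s = Some Minus"
    "init (dual s) = Some Minus \<longleftrightarrow> init s = Some Plus"
    by (cases s; simp add: dual_def)+
qed

lemma Alt_qf: "qf \<phi> \<Longrightarrow> Alt \<phi> = {[]}"
  by (cases \<phi>) simp_all

lemma Alt_nonempty: "Alt \<phi> \<noteq> {}"
  by (induction \<phi>) auto

lemma finite_Alt: "finite (Alt \<phi>)"
proof (induction \<phi>)
  case (All \<phi>)
  have "{Minus # s |s. s \<in> Alt \<phi> \<and> init s \<noteq> Some Minus} \<subseteq> Cons Minus ` Alt \<phi>" by auto
  then show ?case using All by (auto intro: finite_subset)
next
  case (Ex \<phi>)
  have "{Plus # s |s. s \<in> Alt \<phi> \<and> init s \<noteq> Some Plus} \<subseteq> Cons Plus ` Alt \<phi>" by auto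
  then show ?case using Ex by (auto intro: finite_subset)
qed auto

lemma Alt_subst: "Alt (subst \<sigma> \<phi>) = Alt \<phi>"
proof (induction \<phi> arbitrary: \<sigma>)
  case (Imp \<phi> \<psi>)
  \<comment> \<open>\<open>Alt\<close> recognises negations by comparing with \<open>Bot\<close>, so
    substitution must neither create nor destroy \<open>Bot\<close>.\<close>
  have "subst \<sigma> \<psi> = Bot \<longleftrightarrow> \<psi> = Bot" by (cases \<psi>) simp_all
  then show ?case using Imp by simp
qed simp_all

lemma init_Alt_All: "s \<in> Alt (All \<phi>) \<Longrightarrow> init s = Some Minus"
  by auto

lemma init_Alt_Ex: "s \<in> Alt (Ex \<phi>) \<Longrightarrow> init s = Some Plus"
  by auto

lemma deg_le_iff: "deg \<phi> \<le> k \<longleftrightarrow> (\<forall>s\<in>Alt \<phi>. length s \<le> k)"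
  unfolding deg_def using finite_Alt Alt_nonempty by simp

lemma deg_attained: "\<exists>s\<in>Alt \<phi>. length s = deg \<phi>"
proof -
  have "Max (length ` Alt \<phi>) \<in> length ` Alt \<phi>" using finite_Alt Alt_nonempty by (intro Max_in) auto
  then show ?thesis by (auto simp: deg_def)
qed

lemma upto_qf: "qf \<phi> \<Longrightarrow> E_upto k \<phi>" "qf \<phi> \<Longrightarrow> U_upto k \<phi>"
  by (simp_all add: E_upto_def U_upto_def Alt_qf)

text \<open>The special clauses of \<open>Alt\<close> for quantifier-free formulas and for negations
  affect only the empty path, which satisfies both conditions at every \<open>k\<close>. Dualising
  the paths of a premise exchanges the two classes.\<close>

lemma upto_connectives:
  "E_upto k (Imp \<phi> \<psi>) \<longleftrightarrow> U_upto k \<phi> \<and> E_upto k \<psi>"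
  "U_upto k (Imp \<phi> \<psi>) \<longleftrightarrow> E_upto k \<phi> \<and> U_upto k \<psi>"
  "E_upto k (And \<phi> \<psi>) \<longleftrightarrow> E_upto k \<phi> \<and> E_upto k \<psi>"
  "U_upto k (And \<phi> \<psi>) \<longleftrightarrow> U_upto k \<phi> \<and> U_upto k \<psi>"
  "E_upto k (Or \<phi> \<psi>) \<longleftrightarrow> E_upto k \<phi> \<and> E_upto k \<psi>"
  "U_upto k (Or \<phi> \<psi>) \<longleftrightarrow> U_upto k \<phi> \<and> U_upto k \<psi>"
  unfolding E_upto_def U_upto_def by (auto simp: Alt_qf ball_Un)

lemma E_upto_Ex: assumes "E_upto k (Ex \<phi>)" shows "E_upto k \<phi> \<and> (\<exists>j. k = Suc j)"
proof -
  have "length s \<le> k \<and> (length s = k \<longrightarrow> init s \<noteq> Some Minus)" if "s \<in> Alt \<phi>" for s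
  proof (cases "init s = Some Plus")
    case True
    then show ?thesis using assms that by (auto simp: E_upto_def)
  next
    case False
    then have "Plus # s \<in> Alt (Ex \<phi>)" using that by simp
    then show ?thesis using assms unfolding E_upto_def by fastforce
  qed
  moreover obtain s where "s \<in> Alt (Ex \<phi>)" using Alt_nonempty by blast
  then have "s \<noteq> []" "length s \<le> k" using assms init_Alt_Ex by (force simp: E_upto_def simp del: Alt.simps)+
  then have "\<exists>j. k = Suc j" by (cases k) auto
  ultimately show ?thesis by (auto simp: E_upto_def)
qed

lemma U_upto_All: assumes "U_upto k (All \<phi>)" shows "U_upto k \<phi> \<and> (\<exists>j. k = Suc j)"
proof -
  have "length s \<le> k \<and> (length s = k \<longrightarrow> init s \<noteq> Some Plus)" if "s \<in> Alt \<phi>" for s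
  proof (cases "init s = Some Minus")
    case True
    then show ?thesis using assms that by (auto simp: U_upto_def)
  next
    case False
    then have "Minus # s \<in> Alt (All \<phi>)" using that by simp
    then show ?thesis using assms unfolding U_upto_def by fastforce
  qed
  moreover obtain s where "s \<in> Alt (All \<phi>)" using Alt_nonempty by blast
  then have "s \<noteq> []" "length s \<le> k" using assms init_Alt_All by (force simp: U_upto_def simp del: Alt.simps)+
  then have "\<exists>j. k = Suc j" by (cases k) auto
  ultimately show ?thesis by (auto simp: U_upto_def)
qed

text \<open>All paths of \<open>Ex \<phi>\<close> begin with \<open>Plus\<close>, so none may have
  the full length \<open>k\<close>. The formula belongs to the level below, which \<open>T\<close>
  decides in the situation of interest.\<close>

lemma U_upto_Ex: assumes "U_upto k (Ex \<phi>)" shows "\<exists>j. k = Suc j \<and> E_upto j (Ex \<phi>)"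
proof -
  have lt: "length s < k \<and> init s = Some Plus" if "s \<in> Alt (Ex \<phi>)" for s
    using assms that init_Alt_Ex[OF that] unfolding U_upto_def by fastforce
  obtain s where "s \<in> Alt (Ex \<phi>)" using Alt_nonempty by blast
  then have "length s < k" using lt by blast
  then obtain j where "k = Suc j" by (cases k) auto
  moreover have "E_upto j (Ex \<phi>)"
    unfolding E_upto_def
  proof
    fix s assume "s \<in> Alt (Ex \<phi>)"
    from lt[OF this] show "length s \<le> j \<and> (length s = j \<longrightarrow> init s \<noteq> Some Minus)"
      using \<open>k = Suc j\<close> by auto
  qed
  ultimately show ?thesis by blast
qed

lemma E_upto_All: assumes "E_upto k (All \<phi>)" shows "\<exists>j. k = Suc j \<and> U_upto j (All \<phi>)"
proof -
  have lt: "length s < k \<and> init s = Some Minus" if "s \<in> Alt (All \<phi>)" for s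
    using assms that init_Alt_All[OF that] unfolding E_upto_def by fastforce
  obtain s where "s \<in> Alt (All \<phi>)" using Alt_nonempty by blast
  then have "length s < k" using lt by blast
  then obtain j where "k = Suc j" by (cases k) auto
  moreover have "U_upto j (All \<phi>)"
    unfolding U_upto_def
  proof
    fix s assume "s \<in> Alt (All \<phi>)"
    from lt[OF this] show "length s \<le> j \<and> (length s = j \<longrightarrow> init s \<noteq> Some Plus)"
      using \<open>k = Suc j\<close> by auto
  qed
  ultimately show ?thesis by blast
qed

section \<open>Comparison with the classes of exact degree\<close>

lemma E_fm_iff: "\<phi> \<in> E_fm k \<longleftrightarrow> deg \<phi> = k \<and> E_upto k \<phi>"
proof (cases k)
  case 0
  have "E_upto 0 \<phi>" if "deg \<phi> = 0" using that deg_le_iff[of \<phi> 0] by (auto simp: E_upto_def)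
  then show ?thesis by (auto simp: 0 F_fm_def)
next
  case (Suc j)
  have init: "init s \<noteq> Some Minus \<longleftrightarrow> init s = Some Plus" if "length s = Suc j" for s
    using that by (cases s; cases "hd s") auto
  show ?thesis using deg_le_iff[of \<phi> k] init by (auto simp: Suc F_fm_def E_upto_def)
qed

lemma U_fm_iff: "\<phi> \<in> U_fm k \<longleftrightarrow> deg \<phi> = k \<and> U_upto k \<phi>"
proof (cases k)
  case 0
  have "U_upto 0 \<phi>" if "deg \<phi> = 0" using that deg_le_iff[of \<phi> 0] by (auto simp: U_upto_def)
  then show ?thesis by (auto simp: 0 F_fm_def)
next
  case (Suc j)
  have init: "init s \<noteq> Some Plus \<longleftrightarrow> init s = Some Minus" if "length s = Suc j" for s
    using that by (cases s; cases "hd s") auto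
  show ?thesis using deg_le_iff[of \<phi> k] init by (auto simp: Suc F_fm_def U_upto_def)
qed

lemma U_plus_iff: "\<phi> \<in> U_plus k \<longleftrightarrow> U_upto k \<phi>"
proof
  assume "\<phi> \<in> U_plus k"
  then consider "\<phi> \<in> U_fm k" | "deg \<phi> < k" by (auto simp: U_plus_def F_fm_def)
  then show "U_upto k \<phi>"
  proof cases
    case 2
    then have "length s < k" if "s \<in> Alt \<phi>" for s using deg_le_iff[of \<phi> "deg \<phi>"] that by auto
    then show ?thesis unfolding U_upto_def by fastforce
  qed (simp add: U_fm_iff)
next
  assume U: "U_upto k \<phi>"
  then have "deg \<phi> \<le> k" by (simp add: deg_le_iff U_upto_def)
  then show "\<phi> \<in> U_plus k" using U by (auto simp: U_plus_def U_fm_iff F_fm_def)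
qed

text \<open>The longest paths of \<phi> begin with \<open>Minus\<close> and absorb the new
  quantifier; the shorter ones grow by at most one. So the degree stays the same, and
  \<open>Neg (All \<phi>)\<close> will have the exact degree that \<open>E_fm\<close> asks
  for.\<close>

lemma deg_All: "U_upto (Suc k) \<phi> \<Longrightarrow> deg \<phi> = Suc k \<Longrightarrow> All \<phi> \<in> U_fm (Suc k)"
proof -
  assume U: "U_upto (Suc k) \<phi>" and deg: "deg \<phi> = Suc k"
  have "length s \<le> Suc k" if s: "s \<in> Alt (All \<phi>)" for s
  proof -
    from s consider "s \<in> Alt \<phi>" | s' where "s = Minus # s'" "s' \<in> Alt \<phi>" "init s' \<noteq> Some Minus"
      by auto
    then show ?thesis
    proof cases
      case 1
      then show ?thesis using U by (simp add: U_upto_def)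
    next
      case 2
      have "length s' \<noteq> Suc k"
      proof
        assume "length s' = Suc k"
        then show False using 2 U by (cases s'; cases "hd s'") (auto simp: U_upto_def)
      qed
      then show ?thesis using 2 U by (fastforce simp: U_upto_def)
    qed
  qed
  then have "deg (All \<phi>) \<le> Suc k" using deg_le_iff by blast
  moreover obtain s where s: "s \<in> Alt \<phi>" "length s = Suc k" using deg_attained[of \<phi>] deg by auto
  have "init s = Some Minus" using s U by (cases s; cases "hd s") (auto simp: U_upto_def)
  then have "s \<in> Alt (All \<phi>)" using s by simp
  then have "\<not> deg (All \<phi>) \<le> k" using s(2) deg_le_iff[of "All \<phi>" k] by fastforce
  ultimately have "deg (All \<phi>) = Suc k" by simp
  moreover from this have "U_upto (Suc k) (All \<phi>)"
    using deg_le_iff[of "All \<phi>" "Suc k"] init_Alt_All unfolding U_upto_def by fastforce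
  ultimately show ?thesis by (simp add: U_fm_iff del: U_fm.simps)
qed

lemma deg_Neg: "deg (Neg \<phi>) = deg \<phi>"
proof -
  have "length ` Alt (Neg \<phi>) = length ` Alt \<phi>" by (auto simp: Alt_qf image_image)
  then show ?thesis by (simp add: deg_def)
qed

lemma Neg_U_fm: "\<phi> \<in> U_fm k \<Longrightarrow> Neg \<phi> \<in> E_fm k"
  by (simp add: U_fm_iff E_fm_iff deg_Neg upto_connectives upto_qf)

lemma Neg_Neg_E_fm: "\<phi> \<in> E_fm k \<Longrightarrow> Neg (Neg \<phi>) \<in> E_fm k"
  by (simp add: E_fm_iff deg_Neg upto_connectives upto_qf)

text \<open>Blocks may be empty, so a prenex formula can have a smaller degree than its class
  suggests. Hence the cumulative classes appear here.\<close>

lemma Alt_Sigma_Pi: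
  "\<phi> \<in> Sigma_fm k \<Longrightarrow> E_upto k \<phi>"
  "\<phi> \<in> Pi_fm k \<Longrightarrow> U_upto k \<phi>"
proof (induction k arbitrary: \<phi>)
  case (Suc k)
  {
    case 1
    then show ?case
    proof (induction rule: Sigma_Suc_induct)
      case (Pi \<phi>)
      then show ?case using Suc.IH(2)[OF Pi] by (fastforce simp: E_upto_def U_upto_def)
    next
      case (Ex \<phi>)
      have "length s \<noteq> Suc k" if "s \<in> Alt \<phi>" "init s \<noteq> Some Plus" for s
        using Ex.IH that by (cases s; cases "hd s") (auto simp: E_upto_def)
      then show ?case using Ex.IH by (fastforce simp: E_upto_def)
    qed
  next
    case 2
    then show ?case
    proof (induction rule: Pi_Suc_induct)
      case (Sigma \<phi>)
      then show ?case using Suc.IH(1)[OF Sigma] by (fastforce simp: E_upto_def U_upto_def)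
    next
      case (All \<phi>)
      have "length s \<noteq> Suc k" if "s \<in> Alt \<phi>" "init s \<noteq> Some Minus" for s
        using All.IH that by (cases s; cases "hd s") (auto simp: U_upto_def)
      then show ?case using All.IH by (fastforce simp: U_upto_def)
    qed
  }
qed (simp_all add: upto_qf)

section \<open>Prenex normal forms\<close>

text \<open>On decided levels all side formulas are decidable, so the classical prenex operations
  are valid. A quantifier of the wrong kind lowers the level by one, and cumulativity leads
  back.\<close>

lemma prenex_decided:
  assumes "decides T m" "j \<le> m"
  shows "E_upto j \<phi> \<Longrightarrow> \<phi> \<in> saturation T (Sigma_fm j)"
    and "U_upto j \<phi> \<Longrightarrow> \<phi> \<in> saturation T (Pi_fm j)"
  using assms(2)
proof (induction \<phi> arbitrary: j)
  case (Eq s t)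
  {
    case 1
    show ?case using Sigma_mono[of 0 j] by (auto intro!: saturation_incl)
  next
    case 2
    show ?case using Pi_mono[of 0 j] by (auto intro!: saturation_incl)
  }
next
  case Bot
  {
    case 1
    show ?case using Sigma_mono[of 0 j] by (auto intro!: saturation_incl)
  next
    case 2
    show ?case using Pi_mono[of 0 j] by (auto intro!: saturation_incl)
  }
next
  case (Imp \<phi> \<psi>)
  {
    case 1
    then show ?case
      using saturation_Sigma_Pi(3)[OF decides_mono[OF assms(1)] Imp.IH(2) Imp.IH(3)]
      by (simp add: upto_connectives)
  next
    case 2
    then show ?case
      using saturation_Sigma_Pi(4)[OF decides_mono[OF assms(1)] Imp.IH(1) Imp.IH(4)]
      by (simp add: upto_connectives)
  }
next
  case (And \<phi> \<psi>)
  {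
    case 1
    then show ?case
      using saturation_Sigma_Pi(1)[of T j And, OF decides_mono[OF assms(1)] _ And.IH(1) And.IH(3)]
      by (simp add: upto_connectives)
  next
    case 2
    then show ?case
      using saturation_Sigma_Pi(2)[of T j And, OF decides_mono[OF assms(1)] _ And.IH(2) And.IH(4)]
      by (simp add: upto_connectives)
  }
next
  case (Or \<phi> \<psi>)
  {
    case 1
    then show ?case
      using saturation_Sigma_Pi(1)[of T j Or, OF decides_mono[OF assms(1)] _ Or.IH(1) Or.IH(3)]
      by (simp add: upto_connectives)
  next
    case 2
    then show ?case
      using saturation_Sigma_Pi(2)[of T j Or, OF decides_mono[OF assms(1)] _ Or.IH(2) Or.IH(4)]
      by (simp add: upto_connectives)
  }
next
  case (All \<phi>)
  have U: "All \<phi> \<in> saturation T (Pi_fm j)" if "U_upto j (All \<phi>)" "j \<le> m" for j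
    using U_upto_All[OF that(1)] All.IH(2) that(2) saturation_All by blast
  {
    case 1
    then obtain i where "j = Suc i" "U_upto i (All \<phi>)" using E_upto_All by blast
    then show ?case using U[of i] 1(2) saturation_mono[OF Sigma_Pi_cumulative(2)] by auto
  next
    case 2
    then show ?case using U by blast
  }
next
  case (Ex \<phi>)
  have E: "Ex \<phi> \<in> saturation T (Sigma_fm j)" if "E_upto j (Ex \<phi>)" "j \<le> m" for j
    using E_upto_Ex[OF that(1)] Ex.IH(1) that(2) saturation_Ex by blast
  {
    case 1
    then show ?case using E by blast
  next
    case 2
    then obtain i where "j = Suc i" "E_upto i (Ex \<phi>)" using U_upto_Ex by blast
    then show ?case using E[of i] 2(2) saturation_mono[OF Sigma_Pi_cumulative(3)] by auto
  }
qed

text \<open>Such a formula may lie in neither class of level \<open>m\<close>, as its longest paths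
  can begin with either sign. But connectives preserve decidability, and it remains to treat
  quantified subformulas.\<close>

lemma (in HA_extension) decidable_deg:
  assumes "decides T m"
  shows "deg \<phi> \<le> m \<Longrightarrow> decidable T \<phi>"
  unfolding deg_le_iff
proof (induction \<phi>)
  case (Imp \<phi> \<psi>)
  show ?case
  proof (cases "qf (Imp \<phi> \<psi>)")
    case False
    have "\<forall>s\<in>Alt \<phi>. length s \<le> m" "\<forall>s\<in>Alt \<psi>. length s \<le> m"
      using Imp.prems False by (auto simp: ball_Un split: if_splits)
    then show ?thesis using Imp.IH decidable_connectives by blast
  qed (rule decidable_qf)
next
  case (And \<phi> \<psi>)
  show ?case
  proof (cases "qf (And \<phi> \<psi>)")
    case False
    then show ?thesis using And decidable_connectives by (auto split: if_splits)
  qed (rule decidable_qf)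
next
  case (Or \<phi> \<psi>)
  show ?case
  proof (cases "qf (Or \<phi> \<psi>)")
    case False
    then show ?thesis using Or decidable_connectives by (auto split: if_splits)
  qed (rule decidable_qf)
next
  case (All \<phi>)
  \<comment> \<open>All paths of a universal formula begin with \<open>Minus\<close>, so the bound
    on the degree already places it in the class.\<close>
  then have "U_upto m (All \<phi>)" using init_Alt_All unfolding U_upto_def by fastforce
  then show ?case using prenex_decided(2)[OF assms] decides_saturation(2)[OF assms] by blast
next
  case (Ex \<phi>)
  then have "E_upto m (Ex \<phi>)" using init_Alt_Ex unfolding E_upto_def by fastforce
  then show ?case using prenex_decided(1)[OF assms] decides_saturation(1)[OF assms] by blast
qed (simp_all add: decidable_qf)

text \<open>\<Pi>-formulas of level \<open>Suc m\<close> are avoided, because they are not known to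
  be decidable. \<open>U\<close>-formulas enter through their negations, so that everything happens
  in the saturation of \<open>Sigma_fm (Suc m)\<close>, whose members are stable.\<close>

lemma prenex_E:
  assumes m: "decides T m"
    and DNE: "\<And>\<phi>. \<phi> \<in> Sigma_fm (Suc m) \<Longrightarrow> T \<turnstile> Imp (Neg (Neg \<phi>)) \<phi>"
    and DNS: "\<And>\<phi>. U_upto (Suc m) \<phi> \<Longrightarrow> T \<turnstile> Imp (All (Neg (Neg \<phi>))) (Neg (Neg (All \<phi>)))"
  shows "E_upto (Suc m) \<phi> \<Longrightarrow> \<phi> \<in> saturation T (Sigma_fm (Suc m))"
    and "U_upto (Suc m) \<phi> \<Longrightarrow> Neg \<phi> \<in> saturation T (Sigma_fm (Suc m))"
proof -
  let ?S = "saturation T (Sigma_fm (Suc m))"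
  have Pi_S: "saturation T (Pi_fm m) \<subseteq> ?S" by (rule saturation_mono[OF Sigma_Pi_cumulative(2)])
  have S_binop: "c \<phi> \<psi> \<in> ?S" if c: "c = And \<or> c = Or" and "\<phi> \<in> ?S" "\<psi> \<in> ?S" for c \<phi> \<psi>
  proof (rule saturation_And_Or[where c = c])
    show "c \<phi> \<psi> \<in> ?S" if "\<phi> \<in> Sigma_fm (Suc m)" "\<psi> \<in> Sigma_fm (Suc m)" for \<phi> \<psi>
      using Sigma_Suc_And_Or[where c = c] Sigma_Pi_And_Or(2)[OF m c] c that by blast
  qed (use that in auto)
  have S_And: "And \<phi> \<psi> \<in> ?S" if "\<phi> \<in> ?S" "\<psi> \<in> ?S" for \<phi> \<psi>
    using S_binop[of And] that by blast
  have S_Or: "Or \<phi> \<psi> \<in> ?S" if "\<phi> \<in> ?S" "\<psi> \<in> ?S" for \<phi> \<psi>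
    using S_binop[of Or] that by blast
  have S_equivalent: "\<phi> \<in> ?S" if "\<psi> \<in> ?S" "T \<turnstile> Iff \<phi> \<psi>" "fv \<phi> = fv \<psi>" for \<phi> \<psi>
    using saturation_equivalent[OF that(1)] that(2,3) unfolding equivalent_def by blast
  have qf: "\<phi> \<in> ?S" if "qf \<phi>" for \<phi>
    using that Sigma_mono[of 0 "Suc m"] by (auto intro!: saturation_incl simp del: Sigma_fm.simps(2))
  have stable: "T \<turnstile> Imp (Neg (Neg \<phi>)) \<phi>" if "\<phi> \<in> ?S" for \<phi>
  proof -
    obtain \<psi> where \<psi>: "\<psi> \<in> Sigma_fm (Suc m)" "equivalent T \<phi> \<psi>"
      using \<open>\<phi> \<in> ?S\<close> unfolding saturation_def by blast
    have "T \<turnstile> Iff \<phi> \<psi>" using \<psi>(2) by (simp add: equivalent_def)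
    then show ?thesis using DNE[OF \<psi>(1)]
      by - (rule prop_mp2[where v = "[\<phi>, \<psi>]"], assumption+, (rule reifies.intros)+, code_simp)
  qed
  show "E_upto (Suc m) \<phi> \<Longrightarrow> \<phi> \<in> ?S" "U_upto (Suc m) \<phi> \<Longrightarrow> Neg \<phi> \<in> ?S"
  proof (induction \<phi>)
    case (Eq s t)
    {
      case 1
      show ?case by (rule qf) simp
    next
      case 2
      show ?case by (rule qf) simp
    }
  next
    case Bot
    {
      case 1
      show ?case by (rule qf) simp
    next
      case 2
      show ?case by (rule qf) simp
    }
  next
    case (Imp \<phi> \<psi>)
    {
      case 1
      then have "Or (Neg \<phi>) \<psi> \<in> ?S" using Imp.IH by (simp del: Sigma_fm.simps add: upto_connectives S_Or)
      \<comment> \<open>The implication refutes every refutation of the disjunction, so stability of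
        the disjunction suffices where one would otherwise decide \<phi>.\<close>
      moreover from stable[OF this] have "T \<turnstile> Iff (Imp \<phi> \<psi>) (Or (Neg \<phi>) \<psi>)"
        by - (rule prop_mp1[where v = "[\<phi>, \<psi>]"], assumption+, (rule reifies.intros)+, code_simp)
      ultimately show ?case by (rule S_equivalent) simp
    next
      case 2
      then have \<phi>: "\<phi> \<in> ?S" and "Neg \<psi> \<in> ?S" using Imp.IH by (simp_all del: Sigma_fm.simps add: upto_connectives)
      then have "And \<phi> (Neg \<psi>) \<in> ?S" by (rule S_And)
      moreover from stable[OF \<phi>] have "T \<turnstile> Iff (Neg (Imp \<phi> \<psi>)) (And \<phi> (Neg \<psi>))"
        by - (rule prop_mp1[where v = "[\<phi>, \<psi>]"], assumption+, (rule reifies.intros)+, code_simp)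
      ultimately show ?case by (rule S_equivalent) simp
    }
  next
    case (And \<phi> \<psi>)
    {
      case 1
      then show ?case using And.IH by (simp del: Sigma_fm.simps add: upto_connectives S_And)
    next
      case 2
      then have "Or (Neg \<phi>) (Neg \<psi>) \<in> ?S" using And.IH by (simp del: Sigma_fm.simps add: upto_connectives S_Or)
      moreover from stable[OF this] have "T \<turnstile> Iff (Neg (And \<phi> \<psi>)) (Or (Neg \<phi>) (Neg \<psi>))"
        by - (rule prop_mp1[where v = "[\<phi>, \<psi>]"], assumption+, (rule reifies.intros)+, code_simp)
      ultimately show ?case by (rule S_equivalent) simp
    }
  next
    case (Or \<phi> \<psi>)
    {
      case 1
      then show ?case using Or.IH by (simp del: Sigma_fm.simps add: upto_connectives S_Or)
    next
      case 2
      then have "And (Neg \<phi>) (Neg \<psi>) \<in> ?S" using Or.IH by (simp del: Sigma_fm.simps add: upto_connectives S_And)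
      moreover have "T \<turnstile> Iff (Neg (Or \<phi> \<psi>)) (And (Neg \<phi>) (Neg \<psi>))"
        by (rule prop_valid[where v = "[\<phi>, \<psi>]"], (rule reifies.intros)+, code_simp)
      ultimately show ?case by (rule S_equivalent) simp
    }
  next
    case (All \<phi>)
    {
      case 1
      then have "U_upto m (All \<phi>)" using E_upto_All by blast
      then show ?case using prenex_decided(2)[OF m] Pi_S by blast
    next
      case 2
      then have U: "U_upto (Suc m) \<phi>" using U_upto_All by blast
      then have Ex: "Ex (Neg \<phi>) \<in> ?S" using All.IH(2) by (intro saturation_Ex)
      have "T \<turnstile> Iff (Neg (All \<phi>)) (Ex (Neg \<phi>))"
        using stable[OF Ex] DNS[OF U] Ex_Neg[of T \<phi>] Neg_Ex[of T "Neg \<phi>"]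
        by - (rule prop_mp4[where v = "[All \<phi>, Ex (Neg \<phi>), All (Neg (Neg \<phi>))]"],
            assumption+, (rule reifies.intros)+, code_simp)
      with Ex show ?case by (rule S_equivalent) simp
    }
  next
    case (Ex \<phi>)
    {
      case 1
      then show ?case using Ex.IH(1) E_upto_Ex saturation_Ex by blast
    next
      case 2
      then have "E_upto m (Ex \<phi>)" using U_upto_Ex by blast
      then show ?case using prenex_decided(1)[OF m] saturation_Neg(1)[OF m] Pi_S by blast
    }
  qed
qed

lemma PNFT_iff: "PNFT T C D \<longleftrightarrow> C \<subseteq> saturation T D"
  by (auto simp: PNFT_def saturation_def equivalent_def theorems_def)

lemma DNE_decidable: "decidable T \<phi> \<Longrightarrow> T \<turnstile> Imp (Neg (Neg \<phi>)) \<phi>"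
  unfolding decidable_def
  by (rule prop_mp1[where v = "[\<phi>]"], assumption+, (rule reifies.intros)+, code_simp)

lemma DNS_decidable:
  assumes "decidable T \<phi>"
  shows "T \<turnstile> Imp (All (Neg (Neg \<phi>))) (Neg (Neg (All \<phi>)))"
  using All_mono[OF DNE_decidable[OF assms]]
  by - (rule prop_mp1[where v = "[All (Neg (Neg \<phi>)), All \<phi>]"], assumption+, (rule reifies.intros)+, code_simp)

lemma PA_decidable: "decidable PA \<phi>"
  unfolding decidable_def by (rule prv.Axiom) (auto simp: PA_def)

section \<open>The principles with arbitrary parameters\<close>

lemma U_upto_subst: "U_upto k (subst \<sigma> \<phi>) \<longleftrightarrow> U_upto k \<phi>"
  by (simp add: U_upto_def Alt_subst)

context HA_extension
begin

text \<open>Contracting the parameters by projections keeps the formula in its class, so the schema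
  with one parameter covers all formulas.\<close>

lemma LEM_open:
  assumes "proves_schema T (LEM (Pi_fm k))" "\<phi> \<in> Pi_fm k"
  shows "decidable T \<phi>"
proof -
  let ?\<psi> = "subst (\<lambda>i. proj i (Var 0)) \<phi>"
  have "?\<psi> \<in> Pi_fm k" using assms(2) by (rule subst_Sigma_Pi)
  moreover have "fv ?\<psi> \<subseteq> {0}" by (auto simp: fv_subst fv_proj)
  ultimately have "All (Or ?\<psi> (Neg ?\<psi>)) \<in> LEM (Pi_fm k)" unfolding LEM_def by blast
  then have "T \<turnstile> All (Or ?\<psi> (Neg ?\<psi>))" using assms(1) unfolding proves_schema_def theorems_def by blast
  then show ?thesis unfolding decidable_def
    by - (rule provable_if_contracted, simp add: provable_All_iff)
qed

lemma DNE_open: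
  "proves_schema T (DNE (Sigma_fm k)) \<longleftrightarrow> (\<forall>\<phi>\<in>Sigma_fm k. T \<turnstile> Imp (Neg (Neg \<phi>)) \<phi>)"
proof
  assume P: "proves_schema T (DNE (Sigma_fm k))"
  show "\<forall>\<phi>\<in>Sigma_fm k. T \<turnstile> Imp (Neg (Neg \<phi>)) \<phi>"
  proof
    fix \<phi> assume \<phi>: "\<phi> \<in> Sigma_fm k"
    let ?\<psi> = "subst (\<lambda>i. proj i (Var 0)) \<phi>"
    have "?\<psi> \<in> Sigma_fm k" using \<phi> by (rule subst_Sigma_Pi)
    moreover have "fv ?\<psi> \<subseteq> {0}" by (auto simp: fv_subst fv_proj)
    ultimately have "All (Imp (Neg (Neg ?\<psi>)) ?\<psi>) \<in> DNE (Sigma_fm k)" unfolding DNE_def by blast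
    then have "T \<turnstile> All (Imp (Neg (Neg ?\<psi>)) ?\<psi>)" using P unfolding proves_schema_def theorems_def by blast
    then show "T \<turnstile> Imp (Neg (Neg \<phi>)) \<phi>"
      by - (rule provable_if_contracted, simp add: provable_All_iff)
  qed
qed (auto simp: proves_schema_def DNE_def theorems_def provable_All_iff)

lemma DNS_open:
  "proves_schema T (DNS (U_plus k)) \<longleftrightarrow>
    (\<forall>\<phi>. U_upto k \<phi> \<longrightarrow> T \<turnstile> Imp (All (Neg (Neg \<phi>))) (Neg (Neg (All \<phi>))))"
proof
  assume P: "proves_schema T (DNS (U_plus k))"
  show "\<forall>\<phi>. U_upto k \<phi> \<longrightarrow> T \<turnstile> Imp (All (Neg (Neg \<phi>))) (Neg (Neg (All \<phi>)))"
  proof (intro allI impI)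
    fix \<phi> assume \<phi>: "U_upto k \<phi>"
    \<comment> \<open>\<open>up\<close> protects the variable \<open>y\<close> of the shift, so that
      only the parameters are contracted, to index 1.\<close>
    let ?\<psi> = "subst (up (\<lambda>i. proj i (Var 0))) \<phi>"
    have "?\<psi> \<in> U_plus k" using \<phi> by (simp add: U_plus_iff U_upto_subst)
    moreover have "fv_tm (up (\<lambda>i. proj i (Var 0)) n) \<subseteq> {0, 1}" for n
      by (cases n) (auto simp: fv_subst_tm fv_proj)
    then have "fv ?\<psi> \<subseteq> {0, 1}" by (auto simp: fv_subst)
    ultimately have "All (Imp (All (Neg (Neg ?\<psi>))) (Neg (Neg (All ?\<psi>)))) \<in> DNS (U_plus k)"
      unfolding DNS_def by blast
    then have "T \<turnstile> All (Imp (All (Neg (Neg ?\<psi>))) (Neg (Neg (All ?\<psi>))))"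
      using P unfolding proves_schema_def theorems_def by blast
    then show "T \<turnstile> Imp (All (Neg (Neg \<phi>))) (Neg (Neg (All \<phi>)))"
      by - (rule provable_if_contracted, simp add: provable_All_iff)
  qed
qed (auto simp: proves_schema_def DNS_def theorems_def provable_All_iff U_plus_iff)

lemma decides_if_LEM_DNE:
  assumes "\<And>\<phi>. \<phi> \<in> Pi_fm m \<Longrightarrow> decidable T \<phi>"
    and "\<And>\<phi>. \<phi> \<in> Sigma_fm m \<Longrightarrow> T \<turnstile> Imp (Neg (Neg \<phi>)) \<phi>"
  shows "decides T m"
  using assms
proof (induction m)
  case 0
  show ?case by (rule decides_0)
next
  case (Suc m)
  have "decides T m"
    by (rule Suc.IH) (use Suc.prems Sigma_Pi_cumulative(1)[of m] in blast)+
  then show ?case using Suc.prems by (rule decides_Suc)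
qed

text \<open>The normal form hypothesis concerns degree exactly \<open>Suc m\<close>, whereas \<phi>
  may have a smaller degree; then \<open>T\<close> decides it.\<close>

lemma DNE_if_PNFT:
  assumes PA: "theorems T \<subseteq> theorems PA" and m: "decides T m"
    and PNFT: "E_fm (Suc m) \<subseteq> saturation T (Sigma_fm (Suc m))" and \<phi>: "\<phi> \<in> Sigma_fm (Suc m)"
  shows "T \<turnstile> Imp (Neg (Neg \<phi>)) \<phi>"
proof (cases "deg \<phi> \<le> m")
  case True
  then show ?thesis using decidable_deg[OF m] DNE_decidable by blast
next
  case False
  have E: "E_upto (Suc m) \<phi>" using \<phi> by (rule Alt_Sigma_Pi)
  then have "deg \<phi> \<le> Suc m" by (simp add: deg_le_iff E_upto_def)
  then have "\<phi> \<in> E_fm (Suc m)" using E False unfolding E_fm_iff by simp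
  then have "Neg (Neg \<phi>) \<in> E_fm (Suc m)" by (rule Neg_Neg_E_fm)
  then obtain \<psi> where \<psi>: "\<psi> \<in> Sigma_fm (Suc m)" "T \<turnstile> Iff (Neg (Neg \<phi>)) \<psi>"
    using PNFT unfolding saturation_def equivalent_def by blast
  have "PA \<turnstile> Iff (Neg (Neg \<phi>)) \<psi>" using \<psi>(2) PA by (auto simp: theorems_def)
  then have "PA \<turnstile> Imp \<psi> \<phi>"
    by (rule Imp_trans[OF prv.AndE2 DNE_decidable[OF PA_decidable]])
  then have "T \<turnstile> Imp \<psi> \<phi>" by (rule PA_conservative[OF m \<psi>(1) \<phi>])
  with \<psi>(2) show ?thesis
    by (rule Imp_trans[OF prv.AndE1])
qed

lemma DNS_if_PNFT:
  assumes PA: "theorems T \<subseteq> theorems PA" and m: "decides T m"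
    and PNFT: "E_fm (Suc m) \<subseteq> saturation T (Sigma_fm (Suc m))" and U: "U_upto (Suc m) \<phi>"
  shows "T \<turnstile> Imp (All (Neg (Neg \<phi>))) (Neg (Neg (All \<phi>)))"
proof (cases "deg \<phi> \<le> m")
  case True
  then show ?thesis using decidable_deg[OF m] DNS_decidable by blast
next
  case False
  have "deg \<phi> \<le> Suc m" using U by (simp add: deg_le_iff U_upto_def)
  then have deg: "deg \<phi> = Suc m" using False by simp
  then have "Neg \<phi> \<in> E_fm (Suc m)" using U Neg_U_fm U_fm_iff by blast
  then obtain \<alpha> where \<alpha>: "\<alpha> \<in> Sigma_fm (Suc m)" "T \<turnstile> Iff (Neg \<phi>) \<alpha>"
    using PNFT unfolding saturation_def equivalent_def by blast
  have "Neg (All \<phi>) \<in> E_fm (Suc m)" using deg_All[OF U deg] by (rule Neg_U_fm)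
  then obtain \<beta> where \<beta>: "\<beta> \<in> Sigma_fm (Suc m)" "T \<turnstile> Iff (Neg (All \<phi>)) \<beta>"
    using PNFT unfolding saturation_def equivalent_def by blast
  have "PA \<turnstile> Iff (Neg \<phi>) \<alpha>" "PA \<turnstile> Iff (Neg (All \<phi>)) \<beta>"
    using \<alpha>(2) \<beta>(2) PA by (auto simp: theorems_def)
  then have "PA \<turnstile> Imp \<beta> (Neg (All \<phi>))" "PA \<turnstile> Imp (Ex (Neg \<phi>)) (Ex \<alpha>)"
    by (blast intro: prv.AndE1 prv.AndE2 Ex_mono)+
  moreover have "PA \<turnstile> Imp (Neg (All \<phi>)) (Ex (Neg \<phi>))"
    using Neg_All_decidable[OF PA_decidable PA_decidable] by (rule prv.AndE1)
  ultimately have "PA \<turnstile> Imp \<beta> (Ex \<alpha>)" using Imp_trans by blast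
  \<comment> \<open>A further existential quantifier keeps the conclusion in the \<Sigma>-class, so
    conservation applies.\<close>
  then have "T \<turnstile> Imp \<beta> (Ex \<alpha>)" by (rule PA_conservative[OF m \<beta>(1) Ex_Sigma[OF \<alpha>(1)]])
  \<comment> \<open>\<open>All (Neg (Neg \<phi>))\<close> excludes \<open>Ex (Neg \<phi>)\<close>,
    hence \<open>Ex \<alpha>\<close>, hence \<beta>, which is equivalent to
    \<open>Neg (All \<phi>)\<close>.\<close>
  then show ?thesis using \<beta>(2) Ex_cong[OF \<alpha>(2)] Neg_Ex[of T "Neg \<phi>"]
    by - (rule prop_mp4[where v = "[Ex (Neg \<phi>), Ex \<alpha>, All \<phi>, \<beta>, All (Neg (Neg \<phi>))]"],
        assumption+, (rule reifies.intros)+, code_simp)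
qed

end

theorem theorem7p12:
  fixes k :: nat and T :: "fm set"
  assumes "in_between T (if k = 0 then HA else HA \<union> LEM (Pi_fm (k - 1))) PA"
  shows "(proves_schema T (DNE (Sigma_fm k)) \<and> proves_schema T (DNS (U_plus k)))
    \<longleftrightarrow> (\<forall>k'\<le>k. PNFT T (E_fm k') (Sigma_fm k'))"
proof -
  have PA: "theorems T \<subseteq> theorems PA" using assms by (simp add: in_between_def)
  have ax: "T \<turnstile> \<phi>" if "\<phi> \<in> (if k = 0 then HA else HA \<union> LEM (Pi_fm (k - 1)))" for \<phi>
    using assms prv.Axiom[OF that, of "{}"] unfolding in_between_def theorems_def by blast
  interpret HA_extension T by unfold_locales (use ax in auto)
  have E: "E_fm j \<subseteq> saturation T (Sigma_fm j)" if "decides T m" "j \<le> m" for j m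
    using prenex_decided(1)[OF that] E_fm_iff by blast
  show ?thesis
  proof (cases k)
    case 0
    \<comment> \<open>At level 0 both sides of the equivalence hold outright, since formulas of
      degree 0 are decidable.\<close>
    have "decidable T \<phi>" if "U_upto 0 \<phi>" for \<phi>
      using that unfolding U_upto_def 
      by (intro decidable_deg[OF decides_0]) (auto simp: deg_le_iff simp del: le_zero_eq)
    then show ?thesis
      unfolding 0 PNFT_iff DNE_open DNS_open
      using E[OF decides_0, of 0] decidable_qf by (auto intro: DNE_decidable DNS_decidable)
  next
    case (Suc m)
    have Pi: "decidable T \<phi>" if "\<phi> \<in> Pi_fm m" for \<phi>
      by (rule LEM_open[OF _ that]) (use ax Suc in \<open>auto simp: proves_schema_def theorems_def\<close>)
    have Pi': "decidable T \<phi>" if "\<phi> \<in> Pi_fm j" "j \<le> m" for \<phi> j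
      using Pi Pi_mono[OF that(2)] that(1) by blast
    show ?thesis
      unfolding PNFT_iff DNE_open DNS_open Suc
    proof (intro iffI allI impI conjI)
      fix k' assume "k' \<le> Suc m"
        and *: "(\<forall>\<phi>\<in>Sigma_fm (Suc m). T \<turnstile> Imp (Neg (Neg \<phi>)) \<phi>) \<and>
          (\<forall>\<phi>. U_upto (Suc m) \<phi> \<longrightarrow> T \<turnstile> Imp (All (Neg (Neg \<phi>))) (Neg (Neg (All \<phi>))))"
      have m: "decides T m"
        by (rule decides_if_LEM_DNE[OF Pi]) (use * Sigma_Pi_cumulative(1)[of m] in blast)+
      show "E_fm k' \<subseteq> saturation T (Sigma_fm k')"
      proof (cases "k' = Suc m")
        case True
        then show ?thesis using prenex_E(1)[OF m] * E_fm_iff by blast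
      next
        case False
        then show ?thesis using E[OF m] \<open>k' \<le> Suc m\<close> by simp
      qed
    next
      assume *: "\<forall>k'\<le>Suc m. E_fm k' \<subseteq> saturation T (Sigma_fm k')"
      \<comment> \<open>Elimination at level \<open>j\<close>, with the given excluded middle for
        \<open>Pi_fm j\<close>, makes \<open>T\<close> decide level \<open>j\<close>. The normal
        forms at level \<open>Suc j\<close> then yield elimination there.\<close>
      have DNE: "\<forall>\<phi>\<in>Sigma_fm j. T \<turnstile> Imp (Neg (Neg \<phi>)) \<phi>" if "j \<le> Suc m" for j
        using that
      proof (induction j)
        case 0
        then show ?case using decides_0 DNE_decidable by (auto simp: decides_def)
      next
        case (Suc j)
        have "decides T j"
          by (rule decides_if_LEM_DNE) (use Suc Pi' in auto)
        then show ?case using DNE_if_PNFT[OF PA] * Suc.prems by blast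
      qed
      then show "\<forall>\<phi>\<in>Sigma_fm (Suc m). T \<turnstile> Imp (Neg (Neg \<phi>)) \<phi>" by blast
      have "decides T m"
        by (rule decides_if_LEM_DNE[OF Pi]) (use DNE[of m] in auto)
      then show "T \<turnstile> Imp (All (Neg (Neg \<phi>))) (Neg (Neg (All \<phi>)))" if "U_upto (Suc m) \<phi>" for \<phi>
        using DNS_if_PNFT[OF PA] * that by blast
    qed
  qed
qed

end
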